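(* Let $X$ be a rearrangement invariant space on $[0,1]$ which is an interpolation space between $L^1([0,1])$ and $L^\infty([0,1])$. The following are equivalent: (i) The continuous embeddings $G\subset X$ and $G\subset X'$ hold, i.e. there are $C,C'>0$ with $\|f\|_X\le C\|f\|_{L^{M_2}}$ and $\|f\|_{X'}\le C'\|f\|_{L^{M_2}}$ for all $f\in L^\infty$. (ii) For every $q>1$ and every $q$-lacunary sequence $(w_{n_k})$ of Walsh functions, the closed linear span $[w_{n_k}]_X$ of $\{w_{n_k}\}$ in $X$ is complemented in $X$. (iii) There exist $q>1$ and a $q$-lacunary sequence $(w_{n_k})$ of Walsh functions such that $[w_{n_k}]_X$ is complemented in $X$.
   Context: $m$ is Lebesgue measure. A Banach function space $X$ over $[0,1]$ is a linear space of measurable functions with a complete norm such that $g\in X$, $|f|\le|g|$ a.e. imply $f\in X$, $\|f\|_X\le\|g\|_X$; it is rearrangement invariant (r.i.) if equimeasurable functions have equal norms (and membership). The associate space $X'$ consists of measurable $g$ with $\|g\|_{X'}=\sup\{|\int_0^1fg\,dm|:\|f\|_X\le1\}<\infty$. $X$ is an interpolation space between $L^1$ and $L^\infty$ if $L^\infty\subset X\subset L^1$ continuously and every linear operator bounded on $L^1$ and on $L^\infty$ is bounded on $X$. $L^{M_2}$ is the Orlicz space with $M_2(t)=\exp(t^2)-1$ and norm $\|f\|_{L^{M_2}}=\inf\{\lambda>0:\int_0^1M_2(|f|/\lambda)dm\le1\}$; $G$ is the closure of $L^\infty$ in $L^{M_2}$. Rademacher functions $r_k(t)=\mathrm{sign}\sin(2^k\pi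 t)$; Walsh functions (Paley numbering) $w_0=1$, $w_k=r_1^{a_1}\cdots r_n^{a_n}$ for $k=\sum_{i=1}^na_i2^{i-1}$, $a_i\in\{0,1\}$. $(w_{n_k})$ is $q$-lacunary if $n_{k+1}/n_k\ge q>1$ for all $k$. A closed subspace is complemented if it is the range of a bounded linear projection on $X$. *)

theory Defs
  imports "HOL-Analysis.Analysis"
begin

text \<open>The underlying measure space: Lebesgue measure on [0,1].
  A (quasi-)Banach function space X is represented by its function norm
  N :: (real \<Rightarrow> real) \<Rightarrow> ennreal; X consists of the measurable f with N f < \<infinity>.
  Elements of X are identified when equal a.e.\<close>

abbreviation I01 :: "real measure" where
  "I01 \<equiv> lebesgue_on {0..1}"

definition inX :: "((real \<Rightarrow> real) \<Rightarrow> ennreal) \<Rightarrow> (real \<Rightarrow> real) \<Rightarrow> bool" where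
  "inX N f \<longleftrightarrow> f \<in> borel_measurable I01 \<and> N f < \<infinity>"

definition banach_function_space :: "((real \<Rightarrow> real) \<Rightarrow> ennreal) \<Rightarrow> bool" where
  "banach_function_space N \<longleftrightarrow>
     (\<forall>f g. f \<in> borel_measurable I01 \<longrightarrow> g \<in> borel_measurable I01 \<longrightarrow>
         N (\<lambda>x. f x + g x) \<le> N f + N g) \<and>
     (\<forall>f c. f \<in> borel_measurable I01 \<longrightarrow> N (\<lambda>x. c * f x) = ennreal \<bar>c\<bar> * N f) \<and>
     (\<forall>f. f \<in> borel_measurable I01 \<longrightarrow> (N f = 0 \<longleftrightarrow> (AE x in I01. f x = 0))) \<and>
     (\<forall>f g. f \<in> borel_measurable I01 \<longrightarrow> g \<in> borel_measurable I01 \<longrightarrow>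
         (AE x in I01. \<bar>f x\<bar> \<le> \<bar>g x\<bar>) \<longrightarrow> N f \<le> N g) \<and>
     (\<forall>F :: nat \<Rightarrow> real \<Rightarrow> real. (\<forall>k. inX N (F k)) \<longrightarrow>
         (\<forall>e>0. \<exists>m. \<forall>i\<ge>m. \<forall>j\<ge>m. N (\<lambda>x. F i x - F j x) < ennreal e) \<longrightarrow>
         (\<exists>g. inX N g \<and> ((\<lambda>k. N (\<lambda>x. F k x - g x)) \<longlonglongrightarrow> 0)))"

definition equimeasurable :: "(real \<Rightarrow> real) \<Rightarrow> (real \<Rightarrow> real) \<Rightarrow> bool" where
  "equimeasurable f g \<longleftrightarrow>
     (\<forall>t. emeasure I01 {x \<in> space I01. \<bar>f x\<bar> > t} = emeasure I01 {x \<in> space I01. \<bar>g x\<bar> > t})"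

definition rearrangement_invariant :: "((real \<Rightarrow> real) \<Rightarrow> ennreal) \<Rightarrow> bool" where
  "rearrangement_invariant N \<longleftrightarrow>
     (\<forall>f g. f \<in> borel_measurable I01 \<longrightarrow> g \<in> borel_measurable I01 \<longrightarrow>
        equimeasurable f g \<longrightarrow> N f = N g)"

definition assoc_norm :: "((real \<Rightarrow> real) \<Rightarrow> ennreal) \<Rightarrow> (real \<Rightarrow> real) \<Rightarrow> ennreal" where
  "assoc_norm N g = (SUP f \<in> {f. f \<in> borel_measurable I01 \<and> N f \<le> 1}.
                        (\<integral>\<^sup>+ x. ennreal \<bar>f x * g x\<bar> \<partial>I01))"

definition Linf_fun :: "(real \<Rightarrow> real) \<Rightarrow> bool" where
  "Linf_fun f \<longleftrightarrow> f \<in> borel_measurable I01 \<and> (\<exists>c. AE x in I01. \<bar>f x\<bar> \<le> c)"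

definition L1_fun :: "(real \<Rightarrow> real) \<Rightarrow> bool" where
  "L1_fun f \<longleftrightarrow> f \<in> borel_measurable I01 \<and> integrable I01 f"

definition bounded_L1_Linf_op :: "((real \<Rightarrow> real) \<Rightarrow> (real \<Rightarrow> real)) \<Rightarrow> bool" where
  "bounded_L1_Linf_op T \<longleftrightarrow>
     (\<forall>f. L1_fun f \<longrightarrow> T f \<in> borel_measurable I01) \<and>
     (\<forall>f g a b. L1_fun f \<longrightarrow> L1_fun g \<longrightarrow>
        (AE x in I01. T (\<lambda>t. a * f t + b * g t) x = a * T f x + b * T g x)) \<and>
     (\<exists>K. \<forall>f. L1_fun f \<longrightarrow>
        (\<integral>\<^sup>+ x. ennreal \<bar>T f x\<bar> \<partial>I01) \<le> ennreal K * (\<integral>\<^sup>+ x. ennreal \<bar>f x\<bar> \<partial>I01)) \<and>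
     (\<exists>K. \<forall>f c. f \<in> borel_measurable I01 \<longrightarrow> (AE x in I01. \<bar>f x\<bar> \<le> c) \<longrightarrow>
        (AE x in I01. \<bar>T f x\<bar> \<le> K * c))"

definition interpolation_L1_Linf :: "((real \<Rightarrow> real) \<Rightarrow> ennreal) \<Rightarrow> bool" where
  "interpolation_L1_Linf N \<longleftrightarrow>
     (\<exists>C. \<forall>f c. f \<in> borel_measurable I01 \<longrightarrow> (AE x in I01. \<bar>f x\<bar> \<le> c) \<longrightarrow>
         N f \<le> ennreal (C * c)) \<and>
     (\<exists>C. \<forall>f. inX N f \<longrightarrow> (\<integral>\<^sup>+ x. ennreal \<bar>f x\<bar> \<partial>I01) \<le> ennreal C * N f) \<and>
     (\<forall>T. bounded_L1_Linf_op T \<longrightarrow>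
         (\<exists>K. \<forall>f. inX N f \<longrightarrow> N (T f) \<le> ennreal K * N f))"

text \<open>Orlicz norm for M_2(t) = exp(t^2) - 1 (Inf of empty set = \<infinity>).\<close>
definition LM2_norm :: "(real \<Rightarrow> real) \<Rightarrow> ennreal" where
  "LM2_norm f = Inf {ennreal l | l. l > 0 \<and>
      (\<integral>\<^sup>+ x. ennreal (exp ((\<bar>f x\<bar> / l)\<^sup>2) - 1) \<partial>I01) \<le> 1}"

definition rademacher :: "nat \<Rightarrow> real \<Rightarrow> real" where
  "rademacher k t = sgn (sin (2 ^ k * pi * t))"

text \<open>Walsh functions, Paley numbering: w_n = prod of r_{i+1} over the set bits i of n.\<close>
definition walsh :: "nat \<Rightarrow> real \<Rightarrow> real" where
  "walsh n t = (\<Prod>i<n. if odd (n div 2 ^ i) then rademacher (Suc i) t else 1)"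

definition lacunary :: "real \<Rightarrow> (nat \<Rightarrow> nat) \<Rightarrow> bool" where
  "lacunary q n \<longleftrightarrow> (\<forall>k. n k > 0 \<and> real (n (Suc k)) / real (n k) \<ge> q)"

definition walsh_span_X :: "((real \<Rightarrow> real) \<Rightarrow> ennreal) \<Rightarrow> (nat \<Rightarrow> nat) \<Rightarrow> (real \<Rightarrow> real) set" where
  "walsh_span_X N n = {g. inX N g \<and> (\<forall>e>0. \<exists>F c. finite F \<and>
       N (\<lambda>x. g x - (\<Sum>k\<in>F. c k * walsh (n k) x)) < ennreal e)}"

definition complemented_in :: "((real \<Rightarrow> real) \<Rightarrow> ennreal) \<Rightarrow> (real \<Rightarrow> real) set \<Rightarrow> bool" where
  "complemented_in N S \<longleftrightarrow> (\<exists>P. 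
     (\<forall>f. inX N f \<longrightarrow> P f \<in> S) \<and>
     (\<forall>f g a b. inX N f \<longrightarrow> inX N g \<longrightarrow>
        (AE x in I01. P (\<lambda>t. a * f t + b * g t) x = a * P f x + b * P g x)) \<and>
     (\<exists>K. \<forall>f. inX N f \<longrightarrow> N (P f) \<le> ennreal K * N f) \<and>
     (\<forall>f\<in>S. AE x in I01. P f x = f x))"

end

(*
  (i) \<Longrightarrow> (ii). A lacunary Walsh sequence splits into finitely many subsequences with ratios at
  least 2, each of which is distributed like the Rademacher functions; hence the L^{M_2} norm of
  \<Sum> c_k w_{n_k} is at most a constant times the l^2 norm of c. The embedding into X' and duality
  turn this into a Bessel inequality for f \<in> X, and the embedding into X makes the orthogonal
  projection converge and bounded.

  (iii) \<Longrightarrow> (i). Averaging a given projection over the maps flipping one binary digit makes it act on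
  dyadic step functions like the orthogonal projection. Along a sparse subsequence \<nu> of the given
  sequence, the imaginary part F of the Riesz product \<Prod> (1 + i b w_{\<nu> k}) with M b^2 \<le> 1, k < M, is bounded
  by 2, has coefficient b at each w_{\<nu> k}, and vanishing coefficient at every other w_{n_j}. Applying
  the averaged projection to F bounds S = \<Sum> b w_{\<nu> k} in X, and pairing with F bounds it in X'.
  Taking b = M^{-1/2}, the distribution of S has a Gaussian lower tail, so
  that a bounded f with L^{M_2} norm at most 1 is dominated in distribution by 18 |S| + 6 for large
  M. Rearrangement invariance transfers the bounds from S to f, in the case of X' through the
  Hardy--Littlewood inequality.
*)

theory Submission
  imports Defs
begin

section \<open>Walsh functions and digit flips\<close>

text \<open>The given projection maps into the span of the whole sequence, while the test functions
  are built on a sparse subsequence. They must have controlled coefficients at every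
  \<open>n j\<close>, and the extra sparseness of \<open>\<nu>\<close> is what secures this. With b
  of order M^{-1/2} the real Riesz product \<Prod>(1 + b w) is not uniformly bounded, whereas |1 + i
  b w|^2 = 1 + b^2 keeps the complex one bounded; its imaginary part drops the constant term and
  keeps the linear one.

  No Fatou property of the norm is at hand, so averages over flips are not taken to the limit: each
  L has its own averaged operator, tested on step functions of level L, and what is kept is an
  estimate whose constant does not depend on L. Likewise products are estimated for bounded
  functions first, and limits are taken inside integrals.

  Independence is never formalised. Flipping the top digit of the last frequency reverses the last
  sign and fixes the earlier ones; this symmetry yields the exponential moments used in both
  directions.\<close>

definition dig :: "nat \<Rightarrow> real \<Rightarrow> real" where
  "dig i t = (if even \<lfloor>2 ^ Suc i * t\<rfloor> then 1 else -1)"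

text \<open>Agrees with \<open>walsh\<close> off the dyadic rationals, where Rademacher functions
  can vanish. As \<open>dig\<close> is 1 or -1 everywhere, the algebra of Walsh functions holds
  pointwise for \<open>wal\<close>.\<close>

definition wal :: "nat \<Rightarrow> real \<Rightarrow> real" where
  "wal n t = (\<Prod>i<n. if bit n i then dig i t else 1)"

text \<open>Exchanges the two halves of each dyadic cell of length 2^(-i), that is, complements one
  binary digit. The point 1 stays fixed, so that the closed interval is mapped to itself.\<close>

definition flip :: "nat \<Rightarrow> real \<Rightarrow> real" where
  "flip i t = (if 0 \<le> t \<and> t < 1 then
      (if even \<lfloor>2 ^ Suc i * t\<rfloor> then t + 1 / 2 ^ Suc i else t - 1 / 2 ^ Suc i) else t)"

lemma dig_square [simp]: "dig i t * dig i t = 1"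
  by (simp add: dig_def)

lemma not_bit_ge:
  fixes n i L :: nat
  assumes "n < 2 ^ L" "L \<le> i"
  shows "\<not> bit n i"
proof -
  have "n < 2 ^ i"
    using assms by (meson less_le_trans one_le_numeral power_increasing)
  then show ?thesis
    by (simp add: bit_iff_odd)
qed

text \<open>Since n < 2^n, all set bits lie below n, and unset bits contribute the factor 1. So the
  range of the product is flexible and several Walsh functions can be written over a common
  range.\<close>

lemma wal_level:
  assumes "n < 2 ^ L"
  shows "wal n t = (\<Prod>i<L. if bit n i then dig i t else 1)"
proof -
  have "(\<Prod>i<n. if bit n i then dig i t else 1) = (\<Prod>i<max n L. if bit n i then dig i t else 1)"
    by (rule prod.mono_neutral_left) (auto dest: not_bit_ge[OF less_exp])
  moreover have "(\<Prod>i<L. if bit n i then dig i t else 1) = (\<Prod>i<max n L. if bit n i then dig i t else 1)"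
    by (rule prod.mono_neutral_left) (auto dest: not_bit_ge[OF assms])
  ultimately show ?thesis
    by (simp add: wal_def)
qed

lemma xor_less: "m < 2 ^ L \<Longrightarrow> n < 2 ^ L \<Longrightarrow> xor m n < 2 ^ L" for m n L :: nat
  by (metis take_bit_nat_eq_self_iff take_bit_xor)

text \<open>Squares of digits are 1, so a bit set in both indices cancels: Walsh functions multiply
  as bit vectors add modulo 2.\<close>

lemma wal_xor: "wal (xor m n) t = wal m t * wal n t"
proof -
  define L where "L = max m n"
  have m: "m < 2 ^ L" and n: "n < 2 ^ L"
    unfolding L_def by (meson less_exp max.cobounded1 max.cobounded2 less_le_trans one_le_numeral power_increasing)+
  show ?thesis
    unfolding wal_level[OF m] wal_level[OF n] wal_level[OF xor_less[OF m n]] prod.distrib[symmetric]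
    by (rule prod.cong) (auto simp: bit_xor_iff)
qed

lemma wal_0 [simp]: "wal 0 t = 1"
  by (simp add: wal_def)

lemma wal_square [simp]: "wal n t * wal n t = 1"
  using wal_xor[of n n t] by simp

lemma abs_wal [simp]: "\<bar>wal n t\<bar> = 1"
  using wal_square[of n t] by (metis abs_mult_self_eq abs_ge_zero abs_1 real_sqrt_abs2 real_sqrt_one)

lemma wal_cases: "wal n t = 1 \<or> wal n t = -1"
  using abs_wal[of n t] by linarith

lemma wal_pow2: "wal (2 ^ L) t = dig L t"
proof -
  have "wal (2 ^ L) t = (\<Prod>i<Suc L. if bit (2 ^ L :: nat) i then dig i t else 1)"
    by (rule wal_level) simp
  also have "\<dots> = (\<Prod>i<Suc L. if i = L then dig i t else 1)"
    by (intro prod.cong) (auto simp: bit_exp_iff)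
  also have "\<dots> = dig L t"
    by (subst prod.delta) auto
  finally show ?thesis .
qed

lemma floor_dig_div:
  fixes t :: real
  assumes "j \<le> i"
  shows "\<lfloor>2 ^ j * t\<rfloor> = \<lfloor>2 ^ i * t\<rfloor> div 2 ^ (i - j)"
proof -
  have "(2::real) ^ i = 2 ^ j * 2 ^ (i - j)"
    using assms by (metis le_add_diff_inverse power_add)
  then have "2 ^ j * t = (2 ^ i * t) / of_int (2 ^ (i - j))"
    by simp
  then show ?thesis
    by (metis floor_divide_real_eq_div zero_le_numeral zero_le_power)
qed

lemma flip_floor:
  assumes "0 \<le> t" "t < 1"
  shows "\<lfloor>2 ^ Suc i * flip i t\<rfloor> =
    (if even \<lfloor>2 ^ Suc i * t\<rfloor> then \<lfloor>2 ^ Suc i * t\<rfloor> + 1 else \<lfloor>2 ^ Suc i * t\<rfloor> - 1)"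
proof -
  have e: "2 ^ Suc i * (t + 1 / 2 ^ Suc i) = 2 ^ Suc i * t + 1"
    "2 ^ Suc i * (t - 1 / 2 ^ Suc i) = 2 ^ Suc i * t - 1"
    by (simp_all add: field_simps)
  show ?thesis
    using assms unfolding flip_def by (simp only: e if_True simp_thms split: if_splits) simp
qed

lemma flip_in:
  assumes "0 \<le> t" "t < 1"
  shows "0 \<le> flip i t" "flip i t < 1"
proof -
  define m where "m = \<lfloor>2 ^ Suc i * t\<rfloor>"
  have m0: "0 \<le> m"
    using assms by (simp add: m_def)
  have m1: "m < 2 ^ Suc i"
  proof -
    have "2 ^ Suc i * t < 2 ^ Suc i * 1"
      using assms by (intro mult_strict_left_mono) auto
    then show ?thesis
      unfolding m_def by (simp add: floor_less_iff)
  qed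
  have F: "\<lfloor>2 ^ Suc i * flip i t\<rfloor> = (if even m then m + 1 else m - 1)"
    using flip_floor[OF assms] by (simp add: m_def)
  have "0 \<le> \<lfloor>2 ^ Suc i * flip i t\<rfloor>"
    unfolding F using m0 by (auto elim: oddE)
  then have "0 \<le> 2 ^ Suc i * flip i t"
    by (simp only: zero_le_floor)
  then show "0 \<le> flip i t"
    by (metis zero_le_mult_iff zero_less_numeral zero_less_power not_less)
  \<comment> \<open>An even index below the even number 2^(i+1) is at most 2^(i+1) - 2, so its right
    neighbour is still admissible.\<close>
  have "even (2 ^ Suc i :: int)"
    by simp
  then have "\<lfloor>2 ^ Suc i * flip i t\<rfloor> < 2 ^ Suc i"
    unfolding F using m1 by (smt (verit, best) even_plus_one_iff)
  then have "2 ^ Suc i * flip i t < 2 ^ Suc i * 1"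
    by (simp only: floor_less_iff) simp
  then show "flip i t < 1"
    by (simp only: mult_less_cancel_left) simp
qed

lemma dig_flip:
  assumes t: "0 \<le> t" "t < 1"
  shows "dig j (flip i t) = (if j = i then -1 else 1) * dig j t"
proof -
  consider "j = i" | "j < i" | "j > i"
    by linarith
  then show ?thesis
  proof cases
    case 1
    then show ?thesis
      using flip_floor[OF t, of i] by (auto simp: dig_def simp del: power_Suc)
  next
    case 2
    \<comment> \<open>A coarser digit depends only on half of the floor, and exchanging 2k and 2k +
      1 leaves that half unchanged.\<close>
    have d: "\<lfloor>2 ^ Suc j * s\<rfloor> = \<lfloor>2 ^ Suc i * s\<rfloor> div 2 div 2 ^ (i - Suc j)" for s :: real
    proof -
      have "(2::int) ^ (Suc i - Suc j) = 2 * 2 ^ (i - Suc j)"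
        using 2 by (metis Suc_diff_le Suc_leI diff_Suc_Suc power_Suc Suc_diff_Suc)
      moreover have "\<lfloor>2 ^ Suc j * s\<rfloor> = \<lfloor>2 ^ Suc i * s\<rfloor> div 2 ^ (Suc i - Suc j)"
        using 2 by (intro floor_dig_div) simp
      ultimately show ?thesis
        by (simp add: zdiv_zmult2_eq del: power_Suc)
    qed
    have "\<lfloor>2 ^ Suc i * flip i t\<rfloor> div 2 = \<lfloor>2 ^ Suc i * t\<rfloor> div 2"
      unfolding flip_floor[OF t] by (auto elim!: oddE simp del: power_Suc)
    then have "\<lfloor>2 ^ Suc j * flip i t\<rfloor> = \<lfloor>2 ^ Suc j * t\<rfloor>"
      by (simp only: d)
    then show ?thesis
      using 2 by (simp add: dig_def del: power_Suc)
  next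
    case 3
    \<comment> \<open>At a finer scale the translation is by an even integer, so the parity of the
      floor is kept.\<close>
    have p: "(2::real) ^ Suc j = 2 * 2 ^ (j - Suc i) * 2 ^ Suc i"
      using 3 by (simp add: power_diff)
    have "2 ^ Suc j * flip i t = 2 ^ Suc j * t + of_int (2 * 2 ^ (j - Suc i)) \<or>
        2 ^ Suc j * flip i t = 2 ^ Suc j * t - of_int (2 * 2 ^ (j - Suc i))"
      using t unfolding flip_def p by (auto simp: algebra_simps)
    then have "\<lfloor>2 ^ Suc j * flip i t\<rfloor> = \<lfloor>2 ^ Suc j * t\<rfloor> + 2 * 2 ^ (j - Suc i) \<or>
        \<lfloor>2 ^ Suc j * flip i t\<rfloor> = \<lfloor>2 ^ Suc j * t\<rfloor> - 2 * 2 ^ (j - Suc i)"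
      by (metis floor_add_int floor_diff_of_int)
    then have "even \<lfloor>2 ^ Suc j * flip i t\<rfloor> = even \<lfloor>2 ^ Suc j * t\<rfloor>"
      by auto
    then show ?thesis
      using 3 by (simp add: dig_def del: power_Suc)
  qed
qed

lemma wal_flip:
  assumes "0 \<le> t" "t < 1"
  shows "wal n (flip i t) = (if bit n i then -1 else 1) * wal n t"
proof -
  define L where "L = max n (Suc i)"
  have n: "n < 2 ^ L"
    unfolding L_def by (meson less_exp max.cobounded1 less_le_trans one_le_numeral power_increasing)
  have i: "i < L"
    by (simp add: L_def)
  have "wal n (flip i t) = (\<Prod>j<L. (if j = i then (if bit n i then -1 else 1) else 1) * (if bit n j then dig j t else 1))"
    unfolding wal_level[OF n] by (intro prod.cong) (auto simp: dig_flip[OF assms])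
  also have "\<dots> = (if bit n i then -1 else 1) * wal n t"
    using i by (subst prod.distrib) (simp add: prod.delta wal_level[OF n])
  finally show ?thesis .
qed

lemma flip_flip [simp]: "flip i (flip i t) = t"
proof (cases "0 \<le> t \<and> t < 1")
  case True
  then have r: "0 \<le> flip i t" "flip i t < 1"
    using flip_in by auto
  have "even \<lfloor>2 ^ Suc i * flip i t\<rfloor> \<longleftrightarrow> odd \<lfloor>2 ^ Suc i * t\<rfloor>"
    using flip_floor[of t i] True by auto
  then have "flip i (flip i t) = (if odd \<lfloor>2 ^ Suc i * t\<rfloor> then flip i t + 1 / 2 ^ Suc i else flip i t - 1 / 2 ^ Suc i)"
    using r by (subst flip_def) (simp del: power_Suc)
  also have "\<dots> = t"
    using True unfolding flip_def by (simp del: power_Suc)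
  finally show ?thesis .
next
  case False
  then have "flip i t = t"
    unfolding flip_def by simp
  then show ?thesis
    by simp
qed

section \<open>Flips preserve Lebesgue measure; orthonormality of the Walsh functions\<close>

lemma space_I01 [simp]: "space I01 = {0..1}"
  by simp

interpretation I01: finite_measure I01
  by (rule finite_measureI) (simp add: emeasure_restrict_space)

lemma emeasure_I01_space: "emeasure I01 {0..1} = 1"
  by (simp add: emeasure_restrict_space)

lemma measure_I01_space [simp]: "measure I01 {0..1} = 1"
  by (simp add: measure_def emeasure_I01_space)

lemma AE_I01_halfopen: "AE x in I01. 0 \<le> x \<and> x < 1"
proof -
  have "AE x in lebesgue. x \<noteq> (1::real)"
    by (rule AE_I'[of "{1}"]) (auto simp: negligible_iff_null_sets[symmetric])
  then show ?thesis
    by (auto simp: AE_restrict_space_iff elim!: eventually_mono)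
qed

lemma borel_measurable_I01: "f \<in> borel_measurable borel \<Longrightarrow> f \<in> borel_measurable I01"
  by (intro measurable_restrict_space1 measurable_completion) simp

lemma dig_measurable [measurable]: "dig i \<in> borel_measurable I01"
proof (rule borel_measurable_I01)
  show "dig i \<in> borel_measurable borel"
    unfolding dig_def by measurable
qed

lemma wal_measurable [measurable]: "wal n \<in> borel_measurable I01"
  unfolding wal_def by measurable

lemma flip_in_closed: "x \<in> {0..1} \<Longrightarrow> flip i x \<in> {0..1}"
  using flip_in[of x i] by (cases "x = 1") (auto simp: flip_def[of i 1] less_eq_real_def)

text \<open>On each of \<open>E\<close> and \<open>U\<close> the flip is a translation, and 1 is
  fixed. Translation invariance is available for images; as a flip is an involution,
  \<open>flip_vimage\<close> turns this into the statement on preimages that \<open>distr\<close>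
  needs.\<close>

lemma flip_image_lebesgue:
  assumes A: "A \<in> sets lebesgue" "A \<subseteq> {0..1}"
  shows "flip i ` A \<in> sets lebesgue" "emeasure lebesgue (flip i ` A) = emeasure lebesgue A"
    "flip i ` A \<subseteq> {0..1}"
proof -
  define E where "E = {t::real. 0 \<le> t \<and> t < 1 \<and> even \<lfloor>2 ^ Suc i * t\<rfloor>}"
  define U where "U = {t::real. 0 \<le> t \<and> t < 1 \<and> odd \<lfloor>2 ^ Suc i * t\<rfloor>}"
  have E_borel: "E \<in> sets borel" "U \<in> sets borel"
    unfolding E_def U_def by measurable
  then have E: "E \<in> sets lebesgue" "U \<in> sets lebesgue"
    by (simp_all add: sets_completionI_sets)
  have one: "{1::real} \<in> sets lebesgue"
    by simp
  have flip_E: "flip i ` (A \<inter> E) = (\<lambda>x. 1 / 2 ^ Suc i + x) ` (A \<inter> E)"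
    by (intro image_cong) (auto simp: flip_def E_def)
  have flip_U: "flip i ` (A \<inter> U) = (\<lambda>x. - (1 / 2 ^ Suc i) + x) ` (A \<inter> U)"
    by (intro image_cong) (auto simp: flip_def U_def)
  have flip_1: "flip i ` (A \<inter> {1}) = A \<inter> {1}"
    by (auto simp: flip_def)
  have tr: "emeasure lebesgue ((\<lambda>x. c + x) ` S) = emeasure lebesgue S" for c :: real and S
    using emeasure_lebesgue_affine[of 1 c S] by (simp add: add.commute)
  have A_eq: "A = (A \<inter> E) \<union> (A \<inter> U) \<union> (A \<inter> {1})"
  proof -
    have "x \<in> E \<or> x \<in> U \<or> x = 1" if "x \<in> A" for x
    proof -
      have "0 \<le> x" "x \<le> 1"
        using A(2) that by auto
      then show ?thesis
        by (cases "even \<lfloor>2 ^ Suc i * x\<rfloor>") (auto simp: E_def U_def)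
    qed
    then show ?thesis
      by blast
  qed
  have im: "flip i ` A = flip i ` (A \<inter> E) \<union> flip i ` (A \<inter> U) \<union> flip i ` (A \<inter> {1})"
    using A_eq by (simp only: image_Un[symmetric])
  have AE: "A \<inter> E \<in> sets lebesgue" "A \<inter> U \<in> sets lebesgue" "A \<inter> {1} \<in> sets lebesgue"
    by (intro sets.Int A E one)+
  have sets: "flip i ` (A \<inter> E) \<in> sets lebesgue" "flip i ` (A \<inter> U) \<in> sets lebesgue"
    "flip i ` (A \<inter> {1}) \<in> sets lebesgue"
    unfolding flip_E flip_U flip_1 by (intro lebesgue_sets_translation AE)+
  then show "flip i ` A \<in> sets lebesgue"
    unfolding im by blast
  have inj: "inj (flip i)"
    by (rule inj_on_inverseI[of _ "flip i"]) (rule flip_flip)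
  have disj: "E \<inter> U = {}" "E \<inter> {1} = {}" "U \<inter> {1} = {}"
    by (auto simp: E_def U_def)
  have d1: "flip i ` (A \<inter> E) \<inter> flip i ` (A \<inter> U) = {}"
    "(flip i ` (A \<inter> E) \<union> flip i ` (A \<inter> U)) \<inter> flip i ` (A \<inter> {1}) = {}"
    unfolding image_Un[symmetric] image_Int[OF inj, symmetric] using disj by auto
  have d2: "(A \<inter> E) \<inter> (A \<inter> U) = {}" "(A \<inter> E \<union> A \<inter> U) \<inter> (A \<inter> {1}) = {}"
    using disj by auto
  have "emeasure lebesgue (flip i ` A) =
      emeasure lebesgue (flip i ` (A \<inter> E)) + emeasure lebesgue (flip i ` (A \<inter> U)) + emeasure lebesgue (flip i ` (A \<inter> {1}))"
    unfolding im using sets d1 by (simp add: plus_emeasure[symmetric])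
  also have "\<dots> = emeasure lebesgue (A \<inter> E) + emeasure lebesgue (A \<inter> U) + emeasure lebesgue (A \<inter> {1})"
    unfolding flip_E flip_U flip_1 tr ..
  also have "\<dots> = emeasure lebesgue ((A \<inter> E) \<union> (A \<inter> U) \<union> (A \<inter> {1}))"
    by (simp only: plus_emeasure[OF AE(1) AE(2) d2(1)] plus_emeasure[OF sets.Un[OF AE(1,2)] AE(3) d2(2)])
  also have "\<dots> = emeasure lebesgue A"
    by (simp only: A_eq[symmetric])
  finally show "emeasure lebesgue (flip i ` A) = emeasure lebesgue A" .
  show "flip i ` A \<subseteq> {0..1}"
    using A(2) flip_in_closed by blast
qed

lemma flip_vimage: "flip i -` A \<inter> {0..1} = flip i ` (A \<inter> {0..1})"
proof -
  have "flip i x \<in> {0..1}" if "x \<in> {0..1}" for x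
    using that by (rule flip_in_closed)
  moreover have "\<exists>y \<in> A \<inter> {0..1}. x = flip i y" if "flip i x \<in> A" "x \<in> {0..1}" for x
    using that by (intro bexI[of _ "flip i x"]) (auto intro: flip_in_closed simp del: atLeastAtMost_iff)
  ultimately show ?thesis
    by (auto simp: image_iff simp del: atLeastAtMost_iff)
qed

lemma flip_measurable [measurable]: "flip i \<in> measurable I01 I01"
proof (rule measurableI)
  fix x assume "x \<in> space I01"
  then show "flip i x \<in> space I01"
    using flip_in_closed by (simp only: space_I01)
next
  fix A assume "A \<in> sets I01"
  then have "A \<in> sets lebesgue" "A \<subseteq> {0..1}"
    by (auto simp: sets_restrict_space_iff)
  then show "flip i -` A \<inter> space I01 \<in> sets I01"
    using flip_image_lebesgue[of A i]
    by (simp add: flip_vimage sets_restrict_space_iff Int_absorb2)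
qed

lemma distr_flip: "distr I01 I01 (flip i) = I01"
proof (rule measure_eqI)
  fix A assume "A \<in> sets (distr I01 I01 (flip i))"
  then have A: "A \<in> sets I01" by simp
  then have A': "A \<in> sets lebesgue" "A \<subseteq> {0..1}"
    by (auto simp: sets_restrict_space_iff)
  have "emeasure (distr I01 I01 (flip i)) A = emeasure I01 (flip i -` A \<inter> space I01)"
    using A by (intro emeasure_distr) auto
  also have "\<dots> = emeasure I01 A"
    using flip_image_lebesgue[OF A', of i] A'
    by (simp add: flip_vimage emeasure_restrict_space Int_absorb2)
  finally show "emeasure (distr I01 I01 (flip i)) A = emeasure I01 A" .
qed simp

lemma measurable_comp_flip:
  "f \<in> borel_measurable I01 \<Longrightarrow> (\<lambda>x. f (flip i x)) \<in> borel_measurable I01"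
  by (rule measurable_compose[OF flip_measurable])

lemma integral_flip:
  fixes f :: "real \<Rightarrow> real"
  assumes "f \<in> borel_measurable I01"
  shows "(\<integral>x. f (flip i x) \<partial>I01) = (\<integral>x. f x \<partial>I01)"
  using integral_distr[OF flip_measurable[of i] assms] by (simp only: distr_flip)

lemma AE_flip:
  assumes "AE x in I01. P x"
  shows "AE x in I01. P (flip i x)"
proof -
  have "AE x in distr I01 I01 (flip i). P x"
    using assms by (simp only: distr_flip)
  then show ?thesis
    by (rule AE_distrD[OF flip_measurable])
qed

lemma equimeasurable_flip:
  assumes f: "f \<in> borel_measurable I01"
  shows "equimeasurable (\<lambda>x. f (flip i x)) f"
  unfolding equimeasurable_def
proof
  fix t
  have "emeasure I01 {x \<in> space I01. t < \<bar>f x\<bar>} = emeasure (distr I01 I01 (flip i)) {x \<in> space I01. t < \<bar>f x\<bar>}"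
    by (simp only: distr_flip)
  also have "\<dots> = emeasure I01 (flip i -` {x \<in> space I01. t < \<bar>f x\<bar>} \<inter> space I01)"
    using f by (intro emeasure_distr flip_measurable) measurable
  also have "flip i -` {x \<in> space I01. t < \<bar>f x\<bar>} \<inter> space I01 = {x \<in> space I01. t < \<bar>f (flip i x)\<bar>}"
    using flip_in_closed by (simp only: space_I01) blast
  finally show "emeasure I01 {x \<in> space I01. t < \<bar>f (flip i x)\<bar>} = emeasure I01 {x \<in> space I01. t < \<bar>f x\<bar>}" ..
qed

lemma integrable_I01:
  fixes f :: "real \<Rightarrow> real"
  assumes "f \<in> borel_measurable I01" "\<And>x. x \<in> {0..1} \<Longrightarrow> \<bar>f x\<bar> \<le> c"
  shows "integrable I01 f"
proof (rule I01.integrable_const_bound[where B = c])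
  show "AE x in I01. norm (f x) \<le> c"
    by (rule AE_I2) (simp add: assms(2))
qed (rule assms(1))

lemma integral_zero_by_flip:
  fixes f :: "real \<Rightarrow> real"
  assumes f: "f \<in> borel_measurable I01"
    and neg: "\<And>x. 0 \<le> x \<Longrightarrow> x < 1 \<Longrightarrow> f (flip i x) = - f x"
  shows "(\<integral>x. f x \<partial>I01) = 0"
proof -
  have "(\<integral>x. f x \<partial>I01) = (\<integral>x. f (flip i x) \<partial>I01)"
    using integral_flip[OF f] by simp
  also have "\<dots> = (\<integral>x. - f x \<partial>I01)"
    using f AE_I01_halfopen by (intro integral_cong_AE) (auto intro: eventually_mono neg)
  finally show ?thesis
    by simp
qed

lemma integral_wal: "(\<integral>x. wal n x \<partial>I01) = (if n = 0 then 1 else 0)"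
proof (cases "n = 0")
  case False
  then obtain i where "bit n i"
    using bit_eq_iff[of n 0] by auto
  then show ?thesis
    using False by (simp add: integral_zero_by_flip[of _ i] wal_flip)
qed simp

lemma xor_eq_0_nat: "xor l m = 0 \<longleftrightarrow> l = m" for l m :: nat
  by (metis xor_self_eq xor.right_neutral xor.assoc)

lemma integral_wal_wal: "(\<integral>x. wal l x * wal m x \<partial>I01) = (if l = m then 1 else 0)"
  using integral_wal[of "xor l m"] by (simp add: wal_xor xor_eq_0_nat)

text \<open>Off the dyadic rationals y = 2^(i+1) t lies strictly between its floor m and m + 1,
  where the sign of sin (pi y) is (-1)^m. One null set \<open>D\<close> serves all levels at
  once.\<close>

lemma walsh_eq_wal: "AE t in I01. walsh n t = wal n t"
proof -
  define D where "D = (\<Union>i. (\<lambda>k::int. of_int k / 2 ^ Suc i :: real) ` UNIV)"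
  have "countable D"
    unfolding D_def by (intro countable_UN countable_image) auto
  then have "D \<in> null_sets lebesgue"
    by (intro null_sets_completionI countable_imp_null_set_lborel)
  then have "AE t in lebesgue. t \<notin> D"
    by (rule AE_not_in)
  then have "AE t in I01. t \<notin> D"
    by (simp add: AE_restrict_space_iff eventually_mono)
  then show ?thesis
  proof (rule eventually_mono)
    fix t assume t: "t \<notin> D"
    have "rademacher (Suc i) t = dig i t" for i
    proof -
      define y where "y = 2 ^ Suc i * t"
      define m where "m = \<lfloor>y\<rfloor>"
      have "y \<noteq> of_int m"
      proof
        assume "y = of_int m"
        then have "t = of_int m / 2 ^ Suc i"
          by (simp add: y_def field_simps)
        then show False
          using t unfolding D_def by blast
      qed
      then have y: "of_int m < y" "y < of_int m + 1"
        unfolding m_def by linarith+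
      have pos: "0 < sin (pi * (y - of_int m))"
        using y by (intro sin_gt_zero) auto
      have sin0: "sin (of_int m * pi) = 0"
        by (simp add: sin_zero_iff_int2)
      have "sin (pi * y) = sin (pi * (y - of_int m) + pi * of_int m)"
        by (simp add: algebra_simps)
      also have "\<dots> = sin (pi * (y - of_int m)) * cos (pi * of_int m)"
        by (simp add: sin_add mult.commute[of pi "of_int m"] sin0)
      also have "cos (pi * of_int m) = (if even m then 1 else -1)"
      proof (cases "even m")
        case True
        then obtain k where "m = 2 * k"
          by blast
        then show ?thesis
          using cos_int_2pin[of k] by (simp add: mult_ac)
      next
        case False
        then obtain k where k: "m = 2 * k + 1"
          by (rule oddE)
        have "cos (2 * pi * of_int k + pi) = -1"
          by (simp del: cos_int_2pin add: cos_add sin_int_2pin cos_int_2pin)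
        then show ?thesis
          using False by (simp add: k algebra_simps)
      qed
      finally have "sgn (sin (pi * y)) = (if even m then 1 else -1)"
        using pos by (simp add: sgn_mult)
      then show ?thesis
        by (simp add: rademacher_def dig_def m_def y_def mult_ac)
    qed
    then show "walsh n t = wal n t"
      unfolding walsh_def wal_def bit_iff_odd by (intro prod.cong if_cong) auto
  qed
qed

section \<open>Rearrangement invariant spaces\<close>

locale ri_space =
  fixes N :: "(real \<Rightarrow> real) \<Rightarrow> ennreal"
  assumes banach: "banach_function_space N"
    and ri: "rearrangement_invariant N"
    and interp: "interpolation_L1_Linf N"
begin

text \<open>Meaningful on X only: \<open>enn2real\<close> sends \<infinity> to 0, which is why
  estimates for \<open>nrm\<close> come with membership in X.\<close>

definition nrm :: "(real \<Rightarrow> real) \<Rightarrow> real" where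
  "nrm f = enn2real (N f)"

lemma N_add:
  "f \<in> borel_measurable I01 \<Longrightarrow> g \<in> borel_measurable I01 \<Longrightarrow> N (\<lambda>x. f x + g x) \<le> N f + N g"
  using banach unfolding banach_function_space_def by blast

lemma N_scale: "f \<in> borel_measurable I01 \<Longrightarrow> N (\<lambda>x. c * f x) = ennreal \<bar>c\<bar> * N f"
  using banach unfolding banach_function_space_def by blast

lemma N_zero_iff: "f \<in> borel_measurable I01 \<Longrightarrow> N f = 0 \<longleftrightarrow> (AE x in I01. f x = 0)"
  using banach unfolding banach_function_space_def by blast

lemma N_mono:
  "f \<in> borel_measurable I01 \<Longrightarrow> g \<in> borel_measurable I01 \<Longrightarrow> (AE x in I01. \<bar>f x\<bar> \<le> \<bar>g x\<bar>) \<Longrightarrow> N f \<le> N g"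
  using banach unfolding banach_function_space_def by blast

lemma N_complete:
  assumes "\<And>k. inX N (F k)" "\<And>e. e > 0 \<Longrightarrow> \<exists>m. \<forall>i\<ge>m. \<forall>j\<ge>m. N (\<lambda>x. F i x - F j x) < ennreal e"
  obtains g where "inX N g" "(\<lambda>k. N (\<lambda>x. F k x - g x)) \<longlonglongrightarrow> 0"
proof -
  have "(\<forall>k. inX N (F k)) \<longrightarrow> (\<forall>e>0. \<exists>m. \<forall>i\<ge>m. \<forall>j\<ge>m. N (\<lambda>x. F i x - F j x) < ennreal e) \<longrightarrow>
      (\<exists>g. inX N g \<and> ((\<lambda>k. N (\<lambda>x. F k x - g x)) \<longlonglongrightarrow> 0))"
    using banach unfolding banach_function_space_def by blast
  then show ?thesis
    using assms that by blast
qed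

lemma N_equimeasurable:
  "f \<in> borel_measurable I01 \<Longrightarrow> g \<in> borel_measurable I01 \<Longrightarrow> equimeasurable f g \<Longrightarrow> N f = N g"
  using ri unfolding rearrangement_invariant_def by blast

lemma N_cong_AE:
  assumes "f \<in> borel_measurable I01" "g \<in> borel_measurable I01" "AE x in I01. f x = g x"
  shows "N f = N g"
proof (rule antisym)
  show "N f \<le> N g"
    using assms by (intro N_mono) (auto elim: eventually_mono)
  show "N g \<le> N f"
    using assms by (intro N_mono) (auto elim: eventually_mono)
qed

lemma inX_measurable [dest]: "inX N f \<Longrightarrow> f \<in> borel_measurable I01"
  by (simp add: inX_def)

lemma N_eq_nrm: "inX N f \<Longrightarrow> N f = ennreal (nrm f)"
  by (simp add: inX_def nrm_def ennreal_enn2real less_top)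

lemma nrm_nonneg [simp]: "0 \<le> nrm f"
  by (simp add: nrm_def)

lemma inX_mono:
  assumes "f \<in> borel_measurable I01" "inX N g" "AE x in I01. \<bar>f x\<bar> \<le> \<bar>g x\<bar>"
  shows "inX N f" "nrm f \<le> nrm g"
proof -
  have le: "N f \<le> N g"
    using assms by (intro N_mono) auto
  then show "inX N f"
    using assms by (auto simp: inX_def)
  show "nrm f \<le> nrm g"
    using le assms(2) unfolding nrm_def by (intro enn2real_mono) (auto simp: inX_def)
qed

lemma inX_cong_AE:
  assumes "f \<in> borel_measurable I01" "inX N g" "AE x in I01. f x = g x"
  shows "inX N f" "nrm f = nrm g"
proof -
  have "N f = N g"
    using assms by (intro N_cong_AE) auto
  then show "inX N f" "nrm f = nrm g"
    using assms by (auto simp: inX_def nrm_def)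
qed

lemma inX_add:
  assumes "inX N f" "inX N g"
  shows "inX N (\<lambda>x. f x + g x)" "nrm (\<lambda>x. f x + g x) \<le> nrm f + nrm g"
proof -
  have "N (\<lambda>x. f x + g x) \<le> N f + N g"
    using assms by (intro N_add) auto
  then have le: "N (\<lambda>x. f x + g x) \<le> ennreal (nrm f + nrm g)"
    using assms by (simp add: N_eq_nrm)
  have "(\<lambda>x. f x + g x) \<in> borel_measurable I01"
    using assms by (intro borel_measurable_add) auto
  then show "inX N (\<lambda>x. f x + g x)"
    using le by (auto simp: inX_def intro: le_less_trans)
  then show "nrm (\<lambda>x. f x + g x) \<le> nrm f + nrm g"
    using le by (simp add: N_eq_nrm del: ennreal_plus)
qed

lemma inX_scale:
  assumes "inX N f"
  shows "inX N (\<lambda>x. c * f x)" "nrm (\<lambda>x. c * f x) = \<bar>c\<bar> * nrm f"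
proof -
  have "N (\<lambda>x. c * f x) = ennreal \<bar>c\<bar> * N f"
    using assms by (intro N_scale) auto
  also have "\<dots> = ennreal (\<bar>c\<bar> * nrm f)"
    using assms by (simp add: N_eq_nrm ennreal_mult)
  finally have eq: "N (\<lambda>x. c * f x) = ennreal (\<bar>c\<bar> * nrm f)" .
  have "(\<lambda>x. c * f x) \<in> borel_measurable I01"
    using assms by (intro borel_measurable_times) auto
  then show "inX N (\<lambda>x. c * f x)"
    using eq by (simp add: inX_def)
  show "nrm (\<lambda>x. c * f x) = \<bar>c\<bar> * nrm f"
    using eq by (simp add: nrm_def)
qed

lemma inX_diff:
  assumes "inX N f" "inX N g"
  shows "inX N (\<lambda>x. f x - g x)" "nrm (\<lambda>x. f x - g x) \<le> nrm f + nrm g"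
  using inX_add[OF assms(1) inX_scale(1)[OF assms(2), of "-1"]] inX_scale(2)[OF assms(2), of "-1"]
  by simp_all

lemma inX_lin:
  assumes "inX N f" "inX N g"
  shows "inX N (\<lambda>x. a * f x + b * g x)"
  by (intro inX_add inX_scale assms)

lemma nrm_diff_commute: "inX N f \<Longrightarrow> inX N g \<Longrightarrow> nrm (\<lambda>x. f x - g x) = nrm (\<lambda>x. g x - f x)"
  using inX_scale(2)[OF inX_diff(1), of f g "-1"] by simp

lemma nrm_zero_iff: "inX N f \<Longrightarrow> nrm f = 0 \<longleftrightarrow> (AE x in I01. f x = 0)"
  using N_zero_iff[of f] N_eq_nrm[of f] by auto

text \<open>The two embedding constants are fixed once, in a nonnegative version, so that later
  estimates can be multiplied by them.\<close>

definition Cinf :: real where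
  "Cinf = (SOME C. 0 \<le> C \<and> (\<forall>f c. 0 \<le> c \<longrightarrow> f \<in> borel_measurable I01 \<longrightarrow> (AE x in I01. \<bar>f x\<bar> \<le> c) \<longrightarrow>
         N f \<le> ennreal (C * c)))"

definition Cone :: real where
  "Cone = (SOME C. 0 \<le> C \<and> (\<forall>f. inX N f \<longrightarrow> (\<integral>\<^sup>+ x. ennreal \<bar>f x\<bar> \<partial>I01) \<le> ennreal C * N f))"

lemma Cinf: "0 \<le> Cinf"
    "0 \<le> c \<Longrightarrow> f \<in> borel_measurable I01 \<Longrightarrow> (AE x in I01. \<bar>f x\<bar> \<le> c) \<Longrightarrow> N f \<le> ennreal (Cinf * c)"
proof -
  obtain C where C: "\<And>f c. f \<in> borel_measurable I01 \<Longrightarrow> (AE x in I01. \<bar>f x\<bar> \<le> c) \<Longrightarrow> N f \<le> ennreal (C * c)"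
    using interp unfolding interpolation_L1_Linf_def by blast
  have "N f \<le> ennreal (max 0 C * c)"
    if "0 \<le> c" "f \<in> borel_measurable I01" "AE x in I01. \<bar>f x\<bar> \<le> c" for f c
    using C[OF that(2,3)] by (rule order_trans) (intro ennreal_leI mult_right_mono that, simp)
  then have "\<exists>C. 0 \<le> C \<and> (\<forall>f c. 0 \<le> c \<longrightarrow> f \<in> borel_measurable I01 \<longrightarrow> (AE x in I01. \<bar>f x\<bar> \<le> c) \<longrightarrow>
         N f \<le> ennreal (C * c))"
    by (intro exI[of _ "max 0 C"]) simp
  from someI_ex[OF this, folded Cinf_def] show "0 \<le> Cinf"
    "0 \<le> c \<Longrightarrow> f \<in> borel_measurable I01 \<Longrightarrow> (AE x in I01. \<bar>f x\<bar> \<le> c) \<Longrightarrow> N f \<le> ennreal (Cinf * c)"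
    by blast+
qed

lemma Cone: "0 \<le> Cone" "inX N f \<Longrightarrow> (\<integral>\<^sup>+ x. ennreal \<bar>f x\<bar> \<partial>I01) \<le> ennreal Cone * N f"
proof -
  obtain C where C: "\<And>f. inX N f \<Longrightarrow> (\<integral>\<^sup>+ x. ennreal \<bar>f x\<bar> \<partial>I01) \<le> ennreal C * N f"
    using interp unfolding interpolation_L1_Linf_def by blast
  have "(\<integral>\<^sup>+ x. ennreal \<bar>f x\<bar> \<partial>I01) \<le> ennreal (max 0 C) * N f" if "inX N f" for f
    using C[OF that] by (rule order_trans) (intro mult_right_mono ennreal_leI, simp_all)
  then have "\<exists>C. 0 \<le> C \<and> (\<forall>f. inX N f \<longrightarrow> (\<integral>\<^sup>+ x. ennreal \<bar>f x\<bar> \<partial>I01) \<le> ennreal C * N f)"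
    by (intro exI[of _ "max 0 C"]) simp
  from someI_ex[OF this, folded Cone_def]
  show "0 \<le> Cone" "inX N f \<Longrightarrow> (\<integral>\<^sup>+ x. ennreal \<bar>f x\<bar> \<partial>I01) \<le> ennreal Cone * N f"
    by blast+
qed

lemma inX_bounded_AE:
  assumes "f \<in> borel_measurable I01" "0 \<le> c" "AE x in I01. \<bar>f x\<bar> \<le> c"
  shows "inX N f" "nrm f \<le> Cinf * c"
proof -
  have le: "N f \<le> ennreal (Cinf * c)"
    using assms by (intro Cinf)
  then show "inX N f"
    using assms(1) by (auto simp: inX_def intro: le_less_trans)
  then show "nrm f \<le> Cinf * c"
    using le assms Cinf(1) by (simp add: N_eq_nrm)
qed

lemma inX_bounded:
  assumes "f \<in> borel_measurable I01" "0 \<le> c" "\<And>x. x \<in> {0..1} \<Longrightarrow> \<bar>f x\<bar> \<le> c"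
  shows "inX N f" "nrm f \<le> Cinf * c"
proof -
  have "AE x in I01. \<bar>f x\<bar> \<le> c"
    by (rule AE_I2) (simp add: assms(3))
  then show "inX N f" "nrm f \<le> Cinf * c"
    using inX_bounded_AE assms by blast+
qed

lemma inX_wal [simp]: "inX N (wal n)"
  by (rule inX_bounded[where c = 1]) auto

lemma nrm_wal: "nrm (wal n) \<le> Cinf"
  using inX_bounded(2)[of "wal n" 1] by auto

lemma inX_const [simp]: "inX N (\<lambda>x. c)"
  by (rule inX_bounded[where c = "\<bar>c\<bar>"]) auto

lemma inX_flip:
  assumes "inX N f"
  shows "inX N (\<lambda>x. f (flip i x))" "nrm (\<lambda>x. f (flip i x)) = nrm f"
proof -
  have m: "f \<in> borel_measurable I01" "(\<lambda>x. f (flip i x)) \<in> borel_measurable I01"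
    using assms by (auto intro: measurable_comp_flip)
  have "N (\<lambda>x. f (flip i x)) = N f"
    using m by (intro N_equimeasurable equimeasurable_flip)
  then show "inX N (\<lambda>x. f (flip i x))" "nrm (\<lambda>x. f (flip i x)) = nrm f"
    using m assms by (auto simp: inX_def nrm_def)
qed

text \<open>As X embeds into L^1, bounded functions act on X by integration. In particular Walsh
  coefficients are continuous functionals on X.\<close>

lemma pairing:
  assumes f: "inX N f" and h: "h \<in> borel_measurable I01" "\<And>x. x \<in> {0..1} \<Longrightarrow> \<bar>h x\<bar> \<le> M"
  shows "integrable I01 (\<lambda>x. f x * h x)" "\<bar>\<integral>x. f x * h x \<partial>I01\<bar> \<le> M * Cone * nrm f"
proof -
  have M: "0 \<le> M"
    using h(2)[of 0] by auto
  have m: "f \<in> borel_measurable I01" "(\<lambda>x. f x * h x) \<in> borel_measurable I01"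
    using f h by (auto intro!: borel_measurable_times)
  have "(\<integral>\<^sup>+ x. ennreal \<bar>f x\<bar> \<partial>I01) \<le> ennreal (Cone * nrm f)"
    using Cone(2)[OF f] Cone(1) by (simp add: N_eq_nrm[OF f] ennreal_mult)
  moreover have "(\<integral>\<^sup>+ x. ennreal (norm (f x * h x)) \<partial>I01) \<le> (\<integral>\<^sup>+ x. ennreal M * ennreal \<bar>f x\<bar> \<partial>I01)"
  proof (rule nn_integral_mono)
    fix x assume "x \<in> space I01"
    then have "\<bar>f x\<bar> * \<bar>h x\<bar> \<le> \<bar>f x\<bar> * M"
      using h(2)[of x] by (intro mult_left_mono) auto
    then show "ennreal (norm (f x * h x)) \<le> ennreal M * ennreal \<bar>f x\<bar>"
      using M by (auto simp: abs_mult mult.commute ennreal_mult[symmetric] intro!: ennreal_leI)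
  qed
  moreover have "(\<integral>\<^sup>+ x. ennreal M * ennreal \<bar>f x\<bar> \<partial>I01) = ennreal M * (\<integral>\<^sup>+ x. ennreal \<bar>f x\<bar> \<partial>I01)"
    using m by (intro nn_integral_cmult) simp
  ultimately have "(\<integral>\<^sup>+ x. ennreal (norm (f x * h x)) \<partial>I01) \<le> ennreal M * ennreal (Cone * nrm f)"
    by (metis (no_types, lifting) mult_left_mono order_trans zero_le)
  then have le: "(\<integral>\<^sup>+ x. ennreal (norm (f x * h x)) \<partial>I01) \<le> ennreal (M * Cone * nrm f)"
    using M Cone(1) by (simp add: ennreal_mult[symmetric] mult.assoc)
  then show int: "integrable I01 (\<lambda>x. f x * h x)"
    using m(2) by (intro integrableI_bounded) (auto intro: le_less_trans)
  have "norm (\<integral>x. f x * h x \<partial>I01) \<le> (\<integral>x. norm (f x * h x) \<partial>I01)"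
    by (rule integral_norm_bound)
  also have "\<dots> = enn2real (\<integral>\<^sup>+ x. ennreal (norm (f x * h x)) \<partial>I01)"
    using m(2) by (intro integral_eq_nn_integral) (auto intro!: borel_measurable_norm)
  also have "\<dots> \<le> M * Cone * nrm f"
    using le M Cone(1) by (intro enn2real_leI) auto
  finally show "\<bar>\<integral>x. f x * h x \<partial>I01\<bar> \<le> M * Cone * nrm f"
    by simp
qed

lemma pairing_wal:
  assumes "inX N f"
  shows "integrable I01 (\<lambda>x. f x * wal n x)" "\<bar>\<integral>x. f x * wal n x \<partial>I01\<bar> \<le> Cone * nrm f"
  using pairing[OF assms, of "wal n" 1] by auto

definition wcomb :: "(nat \<Rightarrow> nat) \<Rightarrow> nat \<Rightarrow> (nat \<Rightarrow> real) \<Rightarrow> real \<Rightarrow> real" where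
  "wcomb n K c x = (\<Sum>k<K. c k * wal (n k) x)"

lemma wcomb_measurable [measurable]: "wcomb n K c \<in> borel_measurable I01"
  unfolding wcomb_def by measurable

lemma abs_wcomb_le: "\<bar>wcomb n K c x\<bar> \<le> (\<Sum>k<K. \<bar>c k\<bar>)"
  unfolding wcomb_def by (rule order_trans[OF sum_abs]) (simp add: abs_mult)

lemma inX_wcomb [simp]: "inX N (wcomb n K c)"
  and nrm_wcomb: "nrm (wcomb n K c) \<le> Cinf * (\<Sum>k<K. \<bar>c k\<bar>)"
  using inX_bounded[of "wcomb n K c" "\<Sum>k<K. \<bar>c k\<bar>"] by (auto simp: abs_wcomb_le sum_nonneg)

lemma integral_mult_wcomb:
  assumes f: "inX N f"
  shows "(\<integral>x. f x * wcomb n K c x \<partial>I01) = (\<Sum>k<K. c k * (\<integral>x. f x * wal (n k) x \<partial>I01))"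
proof -
  have "(\<integral>x. f x * wcomb n K c x \<partial>I01) = (\<integral>x. (\<Sum>k<K. c k * (f x * wal (n k) x)) \<partial>I01)"
    by (simp add: wcomb_def sum_distrib_left mult_ac)
  then show ?thesis
    using pairing_wal(1)[OF f] by (subst (asm) Bochner_Integration.integral_sum) auto
qed

lemma wcomb_extend: "K \<le> K' \<Longrightarrow> wcomb n K c x = wcomb n K' (\<lambda>k. if k < K then c k else 0) x"
  unfolding wcomb_def by (rule sum.mono_neutral_cong_left) auto

definition wspan :: "(nat \<Rightarrow> nat) \<Rightarrow> (real \<Rightarrow> real) set" where
  "wspan n = {g. inX N g \<and> (\<forall>e>0. \<exists>K c. nrm (\<lambda>x. g x - wcomb n K c x) < e)}"

text \<open>\<open>walsh\<close> is replaced by \<open>wal\<close> up to a null set, and finite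
  index sets by initial segments, padding with zero coefficients.\<close>

lemma walsh_span_X_eq: "walsh_span_X N n = wspan n"
proof -
  have ae: "AE x in I01. \<forall>n. walsh n x = wal n x"
    using walsh_eq_wal by (simp add: AE_all_countable)
  have walsh_meas: "walsh k \<in> borel_measurable I01" for k
  proof -
    have "rademacher i \<in> borel_measurable borel" for i
      unfolding rademacher_def by measurable
    then have [measurable]: "rademacher i \<in> borel_measurable I01" for i
      by (rule borel_measurable_I01)
    show ?thesis
      unfolding walsh_def by measurable
  qed
  have N_eq: "N (\<lambda>x. g x - (\<Sum>k\<in>F. c k * walsh (n k) x)) = N (\<lambda>x. g x - (\<Sum>k\<in>F. c k * wal (n k) x))"
    if "inX N g" for g F and c :: "nat \<Rightarrow> real"
  proof (rule N_cong_AE)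
    show "AE x in I01. g x - (\<Sum>k\<in>F. c k * walsh (n k) x) = g x - (\<Sum>k\<in>F. c k * wal (n k) x)"
      using ae by (rule eventually_mono) simp
  qed (use that walsh_meas in \<open>auto intro!: borel_measurable_diff borel_measurable_sum borel_measurable_times\<close>)
  have "(\<exists>F c. finite F \<and> N (\<lambda>x. g x - (\<Sum>k\<in>F. c k * wal (n k) x)) < ennreal e) \<longleftrightarrow>
      (\<exists>K c. nrm (\<lambda>x. g x - wcomb n K c x) < e)" (is "?l = ?r") if g: "inX N g" for g e
  proof
    assume ?l
    then obtain F c where F: "finite F" "N (\<lambda>x. g x - (\<Sum>k\<in>F. c k * wal (n k) x)) < ennreal e"
      by blast
    obtain K where K: "F \<subseteq> {..<K}"
      using F(1) finite_nat_iff_bounded by blast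
    have "(\<Sum>k\<in>F. c k * wal (n k) x) = wcomb n K (\<lambda>k. if k \<in> F then c k else 0) x" for x
      unfolding wcomb_def using K by (intro sum.mono_neutral_cong_left) auto
    then have "N (\<lambda>x. g x - wcomb n K (\<lambda>k. if k \<in> F then c k else 0) x) < ennreal e"
      using F(2) by simp
    then have "nrm (\<lambda>x. g x - wcomb n K (\<lambda>k. if k \<in> F then c k else 0) x) < e"
      using N_eq_nrm[OF inX_diff(1)[OF g inX_wcomb]] by (simp add: ennreal_less_iff)
    then show ?r
      by blast
  next
    assume ?r
    then obtain K c where "nrm (\<lambda>x. g x - wcomb n K c x) < e"
      by blast
    then have "N (\<lambda>x. g x - wcomb n K c x) < ennreal e"
      using N_eq_nrm[OF inX_diff(1)[OF g inX_wcomb]] by (simp add: ennreal_less_iff)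
    then show ?l
      unfolding wcomb_def by blast
  qed
  then show ?thesis
    unfolding walsh_span_X_def wspan_def using N_eq by (intro Collect_cong conj_cong) auto
qed

lemma wspan_inX [dest]: "g \<in> wspan n \<Longrightarrow> inX N g"
  by (simp add: wspan_def)

lemma wspan_approx:
  assumes "g \<in> wspan n" "e > 0"
  obtains K c where "nrm (\<lambda>x. g x - wcomb n K c x) < e"
  using assms by (auto simp: wspan_def)

lemma wspan_lin:
  assumes g: "g \<in> wspan n" and h: "h \<in> wspan n"
  shows "(\<lambda>x. a * g x + b * h x) \<in> wspan n"
  unfolding wspan_def
proof (intro CollectI conjI allI impI)
  show "inX N (\<lambda>x. a * g x + b * h x)"
    using g h by (intro inX_lin) auto
  fix e :: real assume "e > 0"
  \<comment> \<open>The summand 1 keeps the divisor positive when a = b = 0 and makes the final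
    inequality strict.\<close>
  define d where "d = e / (\<bar>a\<bar> + \<bar>b\<bar> + 1)"
  have d: "d > 0"
    using \<open>e > 0\<close> by (simp add: d_def)
  obtain K c where c: "nrm (\<lambda>x. g x - wcomb n K c x) < d"
    using wspan_approx[OF g d] .
  obtain K' c' where c': "nrm (\<lambda>x. h x - wcomb n K' c' x) < d"
    using wspan_approx[OF h d] .
  define M where "M = max K K'"
  define c2 where "c2 k = a * (if k < K then c k else 0) + b * (if k < K' then c' k else 0)" for k
  have eq: "a * g x + b * h x - wcomb n M c2 x = a * (g x - wcomb n K c x) + b * (h x - wcomb n K' c' x)" for x
  proof -
    have "wcomb n K c x = wcomb n M (\<lambda>k. if k < K then c k else 0) x"
      "wcomb n K' c' x = wcomb n M (\<lambda>k. if k < K' then c' k else 0) x"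
      by (intro wcomb_extend, simp add: M_def)+
    moreover have "wcomb n M c2 x = a * wcomb n M (\<lambda>k. if k < K then c k else 0) x + b * wcomb n M (\<lambda>k. if k < K' then c' k else 0) x"
      unfolding wcomb_def c2_def by (simp add: sum.distrib sum_distrib_left algebra_simps)
    ultimately show ?thesis
      by (simp add: algebra_simps)
  qed
  have X: "inX N (\<lambda>x. g x - wcomb n K c x)" "inX N (\<lambda>x. h x - wcomb n K' c' x)"
    using g h by (auto intro!: inX_diff)
  have "nrm (\<lambda>x. a * g x + b * h x - wcomb n M c2 x) \<le>
      nrm (\<lambda>x. a * (g x - wcomb n K c x)) + nrm (\<lambda>x. b * (h x - wcomb n K' c' x))"
    unfolding eq by (intro inX_add inX_scale X)
  also have "\<dots> = \<bar>a\<bar> * nrm (\<lambda>x. g x - wcomb n K c x) + \<bar>b\<bar> * nrm (\<lambda>x. h x - wcomb n K' c' x)"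
    using X by (simp add: inX_scale)
  also have "\<dots> \<le> \<bar>a\<bar> * d + \<bar>b\<bar> * d"
    using c c' by (intro add_mono mult_left_mono) auto
  also have "\<dots> < (\<bar>a\<bar> + \<bar>b\<bar> + 1) * d"
    using d by (simp add: algebra_simps)
  also have "\<dots> = e"
    unfolding d_def by (simp add: add_nonneg_eq_0_iff)
  finally show "\<exists>K c. nrm (\<lambda>x. a * g x + b * h x - wcomb n K c x) < e"
    by blast
qed

lemma wcomb_flip:
  assumes "0 \<le> x" "x < 1"
  shows "wcomb n K c (flip i x) = wcomb n K (\<lambda>k. (if bit (n k) i then -1 else 1) * c k) x"
  unfolding wcomb_def using assms by (intro sum.cong) (auto simp: wal_flip)

text \<open>A flip only changes signs of coefficients and preserves the norm. This keeps averaged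
  operators inside the span.\<close>

lemma wspan_flip:
  assumes g: "g \<in> wspan n"
  shows "(\<lambda>x. g (flip i x)) \<in> wspan n"
  unfolding wspan_def
proof (intro CollectI conjI allI impI)
  show X: "inX N (\<lambda>x. g (flip i x))"
    using g by (intro inX_flip) auto
  fix e :: real assume "e > 0"
  obtain K c where c: "nrm (\<lambda>x. g x - wcomb n K c x) < e"
    using wspan_approx[OF g \<open>e > 0\<close>] .
  have Xd: "inX N (\<lambda>x. g x - wcomb n K c x)"
    using g by (auto intro!: inX_diff)
  define c' where "c' = (\<lambda>k. (if bit (n k) i then -1 else 1) * c k)"
  have "nrm (\<lambda>x. g (flip i x) - wcomb n K c' x) = nrm (\<lambda>x. g (flip i x) - wcomb n K c (flip i x))"
  proof (rule inX_cong_AE(2))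
    show "inX N (\<lambda>x. g (flip i x) - wcomb n K c (flip i x))"
      using inX_flip(1)[OF Xd, of i] .
    show "(\<lambda>x. g (flip i x) - wcomb n K c' x) \<in> borel_measurable I01"
      using X by (intro borel_measurable_diff) auto
    show "AE x in I01. g (flip i x) - wcomb n K c' x = g (flip i x) - wcomb n K c (flip i x)"
      using AE_I01_halfopen by (rule eventually_mono) (simp add: wcomb_flip c'_def)
  qed
  also have "\<dots> < e"
    using c inX_flip(2)[OF Xd, of i] by simp
  finally show "\<exists>K c. nrm (\<lambda>x. g (flip i x) - wcomb n K c x) < e"
    by blast
qed

end

section \<open>Averaged projections\<close>

context ri_space
begin

text \<open>The properties that survive averaging: range in the span, linearity almost everywhere
  and the bound K. The identity on the span is kept apart and re-enters through the matrix entries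
  with respect to the Walsh functions.\<close>

definition bounded_into :: "(nat \<Rightarrow> nat) \<Rightarrow> real \<Rightarrow> ((real \<Rightarrow> real) \<Rightarrow> real \<Rightarrow> real) \<Rightarrow> bool" where
  "bounded_into n K P \<longleftrightarrow>
     (\<forall>f. inX N f \<longrightarrow> P f \<in> wspan n) \<and>
     (\<forall>f g a b. inX N f \<longrightarrow> inX N g \<longrightarrow>
        (AE x in I01. P (\<lambda>t. a * f t + b * g t) x = a * P f x + b * P g x)) \<and>
     (\<forall>f. inX N f \<longrightarrow> nrm (P f) \<le> K * nrm f)"

lemma bounded_intoD:
  assumes "bounded_into n K P"
  shows "inX N f \<Longrightarrow> P f \<in> wspan n"
    and "inX N f \<Longrightarrow> inX N (P f)"
    and "inX N f \<Longrightarrow> inX N g \<Longrightarrow> AE x in I01. P (\<lambda>t. a * f t + b * g t) x = a * P f x + b * P g x"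
    and "inX N f \<Longrightarrow> nrm (P f) \<le> K * nrm f"
  using assms unfolding bounded_into_def by (blast, blast, blast, blast)

text \<open>An operator acting on functions need not respect equality almost everywhere by itself;
  the bound, applied to a difference of norm 0, forces it.\<close>

lemma bounded_into_cong:
  assumes P: "bounded_into n K P" and "inX N f" "inX N g" "AE x in I01. f x = g x"
  shows "AE x in I01. P f x = P g x"
proof -
  have X: "inX N (\<lambda>t. 1 * f t + (-1) * g t)"
    using assms by (intro inX_lin)
  have "nrm (\<lambda>t. 1 * f t + (-1) * g t) = 0"
    unfolding nrm_zero_iff[OF X] using assms(4) by (rule eventually_mono) simp
  then have "nrm (P (\<lambda>t. 1 * f t + (-1) * g t)) = 0"
    using bounded_intoD(4)[OF P X] by (simp add: antisym)
  then have "AE x in I01. P (\<lambda>t. 1 * f t + (-1) * g t) x = 0"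
    using nrm_zero_iff[OF bounded_intoD(2)[OF P X]] by simp
  moreover have "AE x in I01. P (\<lambda>t. 1 * f t + (-1) * g t) x = 1 * P f x + (-1) * P g x"
    using assms by (intro bounded_intoD(3)[OF P])
  ultimately show ?thesis
    by eventually_elim simp
qed

lemma bounded_into_scale:
  assumes P: "bounded_into n K P" and "inX N f"
  shows "AE x in I01. P (\<lambda>t. a * f t) x = a * P f x"
  using bounded_intoD(3)[OF P assms(2) assms(2), of a 0] by simp

lemma bounded_into_sum:
  fixes M :: nat
  assumes P: "bounded_into n K P" and "\<And>l. inX N (f l)"
  shows "AE x in I01. P (\<lambda>t. \<Sum>l<M. c l * f l t) x = (\<Sum>l<M. c l * P (f l) x)"
proof (induction M)
  case 0
  then show ?case
    using bounded_into_scale[OF P assms(2)[of 0], of 0] by simp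
next
  case (Suc M)
  have X: "inX N (\<lambda>t. \<Sum>l<M. c l * f l t)" for M
    by (induction M) (auto intro!: inX_add inX_scale assms)
  have "AE x in I01. P (\<lambda>t. 1 * (\<Sum>l<M. c l * f l t) + c M * f M t) x =
      1 * P (\<lambda>t. \<Sum>l<M. c l * f l t) x + c M * P (f M) x"
    by (intro bounded_intoD(3)[OF P] X assms)
  with Suc show ?case
    by eventually_elim simp
qed

definition flip_avg :: "nat \<Rightarrow> ((real \<Rightarrow> real) \<Rightarrow> real \<Rightarrow> real) \<Rightarrow> (real \<Rightarrow> real) \<Rightarrow> real \<Rightarrow> real" where
  "flip_avg i P f x = (P f x + P (\<lambda>y. f (flip i y)) (flip i x)) / 2"

lemma bounded_into_flip_avg:
  assumes P: "bounded_into n K P"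
  shows "bounded_into n K (flip_avg i P)"
  unfolding bounded_into_def
proof (intro conjI allI impI)
  fix f assume f: "inX N f"
  have f': "inX N (\<lambda>y. f (flip i y))"
    using f by (rule inX_flip)
  have eq: "flip_avg i P f = (\<lambda>x. (1/2) * P f x + (1/2) * P (\<lambda>y. f (flip i y)) (flip i x))"
    by (auto simp: flip_avg_def)
  have S: "P f \<in> wspan n" "(\<lambda>x. P (\<lambda>y. f (flip i y)) (flip i x)) \<in> wspan n"
    using bounded_intoD(1)[OF P] f f' by (auto intro: wspan_flip)
  then show "flip_avg i P f \<in> wspan n"
    unfolding eq by (intro wspan_lin)
  have X: "inX N (P f)" "inX N (\<lambda>x. P (\<lambda>y. f (flip i y)) (flip i x))"
    using S by auto
  have "nrm (flip_avg i P f) \<le> nrm (\<lambda>x. (1/2) * P f x) + nrm (\<lambda>x. (1/2) * P (\<lambda>y. f (flip i y)) (flip i x))"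
    unfolding eq using X by (intro inX_add inX_scale)
  also have "\<dots> = 1/2 * nrm (P f) + 1/2 * nrm (\<lambda>x. P (\<lambda>y. f (flip i y)) (flip i x))"
    by (subst (1 2) inX_scale(2)) (use X in auto)
  also have "nrm (\<lambda>x. P (\<lambda>y. f (flip i y)) (flip i x)) = nrm (P (\<lambda>y. f (flip i y)))"
    by (rule inX_flip(2)[OF bounded_intoD(2)[OF P f']])
  also have "1/2 * nrm (P f) + 1/2 * nrm (P (\<lambda>y. f (flip i y))) \<le> 1/2 * (K * nrm f) + 1/2 * (K * nrm (\<lambda>y. f (flip i y)))"
    using f f' by (intro add_mono mult_left_mono bounded_intoD(4)[OF P]) auto
  also have "nrm (\<lambda>y. f (flip i y)) = nrm f"
    using f by (rule inX_flip)
  finally show "nrm (flip_avg i P f) \<le> K * nrm f"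
    by simp
next
  fix f g a b assume f: "inX N f" and g: "inX N g"
  have "AE x in I01. P (\<lambda>t. a * f t + b * g t) x = a * P f x + b * P g x"
    using f g by (intro bounded_intoD(3)[OF P])
  moreover have "AE x in I01. P (\<lambda>t. a * f (flip i t) + b * g (flip i t)) (flip i x) =
      a * P (\<lambda>t. f (flip i t)) (flip i x) + b * P (\<lambda>t. g (flip i t)) (flip i x)"
    by (rule AE_flip) (intro bounded_intoD(3)[OF P] inX_flip f g)
  ultimately show "AE x in I01. flip_avg i P (\<lambda>t. a * f t + b * g t) x = a * flip_avg i P f x + b * flip_avg i P g x"
    by eventually_elim (simp add: flip_avg_def field_simps)
qed

text \<open>Conjugation by the flip multiplies the entry (l, m) by the signs that
  \<open>wal l\<close> and \<open>wal m\<close> acquire under the flip. The average keeps the entry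
  if these signs agree and cancels it otherwise.\<close>

lemma flip_avg_coeff:
  assumes P: "bounded_into n K P"
  shows "(\<integral>x. flip_avg i P (wal l) x * wal m x \<partial>I01) =
    (if bit l i = bit m i then \<integral>x. P (wal l) x * wal m x \<partial>I01 else 0)"
proof -
  define s where "s = (\<lambda>k::nat. if bit k i then -1 else 1 :: real)"
  have s: "s k * s k = 1" for k
    by (simp add: s_def)
  have Pl: "inX N (P (wal l))"
    using P by (intro bounded_intoD(2)[OF P]) simp
  have fl: "AE x in I01. wal k (flip i x) = s k * wal k x" for k
    using AE_I01_halfopen by (rule eventually_mono) (simp add: wal_flip s_def)
  have "AE x in I01. P (\<lambda>y. wal l (flip i y)) x = P (\<lambda>y. s l * wal l y) x"
    by (intro bounded_into_cong[OF P] fl inX_flip inX_scale inX_wal)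
  then have 1: "AE x in I01. P (\<lambda>y. wal l (flip i y)) x = s l * P (wal l) x"
    using bounded_into_scale[OF P inX_wal, of "s l" l] by eventually_elim simp
  have 2: "AE x in I01. wal m x = s m * wal m (flip i x)"
    using fl[of m]
  proof eventually_elim
    case (elim x)
    then show ?case
      using s[of m] by (simp add: mult.assoc[symmetric])
  qed
  have meas: "P (wal l) \<in> borel_measurable I01" "P (\<lambda>y. wal l (flip i y)) \<in> borel_measurable I01"
    using Pl bounded_intoD(2)[OF P inX_flip(1)[OF inX_wal]] by auto
  have "(\<integral>x. P (\<lambda>y. wal l (flip i y)) (flip i x) * wal m x \<partial>I01) =
      (\<integral>x. s l * s m * (P (wal l) (flip i x) * wal m (flip i x)) \<partial>I01)"
  proof (rule integral_cong_AE)
    show "AE x in I01. P (\<lambda>y. wal l (flip i y)) (flip i x) * wal m x =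
        s l * s m * (P (wal l) (flip i x) * wal m (flip i x))"
      using AE_flip[OF 1, of i] 2 by eventually_elim simp
  qed (intro borel_measurable_times meas wal_measurable borel_measurable_const
      measurable_comp_flip[of "P (wal l)"] measurable_comp_flip[of "wal m"]
      measurable_comp_flip[of "P (\<lambda>y. wal l (flip i y))"])+
  also have "\<dots> = s l * s m * (\<integral>x. P (wal l) (flip i x) * wal m (flip i x) \<partial>I01)"
    by (rule integral_mult_right_zero)
  also have "(\<integral>x. P (wal l) (flip i x) * wal m (flip i x) \<partial>I01) = (\<integral>x. P (wal l) x * wal m x \<partial>I01)"
    by (rule integral_flip[of "\<lambda>x. P (wal l) x * wal m x"]) (intro borel_measurable_times meas wal_measurable)
  finally have 3: "(\<integral>x. P (\<lambda>y. wal l (flip i y)) (flip i x) * wal m x \<partial>I01) = s l * s m * (\<integral>x. P (wal l) x * wal m x \<partial>I01)" .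
  have int: "integrable I01 (\<lambda>x. P (wal l) x * wal m x)"
      "integrable I01 (\<lambda>x. P (\<lambda>y. wal l (flip i y)) (flip i x) * wal m x)"
    by (rule pairing_wal(1)[OF Pl],
        rule pairing_wal(1)[OF inX_flip(1)[OF bounded_intoD(2)[OF P inX_flip(1)[OF inX_wal]]]])
  have "(\<integral>x. flip_avg i P (wal l) x * wal m x \<partial>I01) =
      (\<integral>x. (P (wal l) x * wal m x + P (\<lambda>y. wal l (flip i y)) (flip i x) * wal m x) / 2 \<partial>I01)"
    unfolding flip_avg_def by (intro Bochner_Integration.integral_cong) (auto simp: field_simps)
  also have "\<dots> = ((\<integral>x. P (wal l) x * wal m x \<partial>I01) + s l * s m * (\<integral>x. P (wal l) x * wal m x \<partial>I01)) / 2"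
    using int by (simp add: 3)
  finally show ?thesis
    by (auto simp: s_def)
qed

lemma iterated_flip_avg:
  assumes P: "bounded_into n K P"
  shows "\<exists>T. bounded_into n K T \<and> (\<forall>l m. (\<integral>x. T (wal l) x * wal m x \<partial>I01) =
    (if \<forall>i<L. bit l i = bit m i then \<integral>x. P (wal l) x * wal m x \<partial>I01 else 0))"
proof (induction L)
  case 0
  then show ?case
    using P by auto
next
  case (Suc L)
  then obtain T where T: "bounded_into n K T" "\<And>l m. (\<integral>x. T (wal l) x * wal m x \<partial>I01) =
    (if \<forall>i<L. bit l i = bit m i then \<integral>x. P (wal l) x * wal m x \<partial>I01 else 0)"
    by blast
  show ?case
    by (rule exI[of _ "flip_avg L T"])
      (auto simp: bounded_into_flip_avg T(1) flip_avg_coeff[OF T(1)] T(2) less_Suc_eq)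
qed

end

section \<open>Dyadic step functions as Walsh polynomials\<close>

definition step :: "nat \<Rightarrow> (real \<Rightarrow> real) \<Rightarrow> bool" where
  "step L u \<longleftrightarrow> (\<exists>v. \<forall>t. 0 \<le> t \<longrightarrow> t < 1 \<longrightarrow> u t = v (nat \<lfloor>2 ^ L * t\<rfloor>))"

lemma wal_add_pow2:
  assumes "l < 2 ^ L"
  shows "wal (l + 2 ^ L) t = wal l t * dig L t"
proof -
  have "xor l (2 ^ L) = l + 2 ^ L"
  proof (rule disjunctive_add_eq_xor[symmetric], rule bit_eqI)
    fix i
    show "bit (and l (2 ^ L)) i = bit (0 :: nat) i"
      using not_bit_ge[OF assms order_refl] by (auto simp: bit_and_iff bit_exp_iff)
  qed
  then show ?thesis
    using wal_xor[of l "2 ^ L" t] by (simp add: wal_pow2)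
qed

text \<open>Induction on the level: on a pair of adjacent cells the values are their mean plus or
  minus half their difference, with sign \<open>dig L\<close>. The half-differences supply the Walsh
  functions with indices from 2^L on.\<close>

lemma step_wal_sum:
  assumes "\<And>t. 0 \<le> t \<Longrightarrow> t < 1 \<Longrightarrow> u t = v (nat \<lfloor>2 ^ L * t\<rfloor>)"
  shows "\<exists>c. \<forall>t. 0 \<le> t \<longrightarrow> t < 1 \<longrightarrow> u t = (\<Sum>l<2 ^ L. c l * wal l t)"
  using assms
proof (induction L arbitrary: u v)
  case 0
  have "u t = v 0 * wal 0 t" if "0 \<le> t" "t < 1" for t
  proof -
    have "\<lfloor>t\<rfloor> = 0"
      using that by linarith
    then show ?thesis
      using 0[OF that] by simp
  qed
  then show ?case
    by (intro exI[of _ "\<lambda>_. v 0"]) simp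
next
  case (Suc L)
  define v1 where "v1 j = (v (2 * j) + v (2 * j + 1)) / 2" for j
  define v2 where "v2 j = (v (2 * j) - v (2 * j + 1)) / 2" for j
  obtain c1 where c1: "\<And>t. 0 \<le> t \<Longrightarrow> t < 1 \<Longrightarrow> v1 (nat \<lfloor>2 ^ L * t\<rfloor>) = (\<Sum>l<2 ^ L. c1 l * wal l t)"
    using Suc.IH[of "\<lambda>t. v1 (nat \<lfloor>2 ^ L * t\<rfloor>)" v1] by blast
  obtain c2 where c2: "\<And>t. 0 \<le> t \<Longrightarrow> t < 1 \<Longrightarrow> v2 (nat \<lfloor>2 ^ L * t\<rfloor>) = (\<Sum>l<2 ^ L. c2 l * wal l t)"
    using Suc.IH[of "\<lambda>t. v2 (nat \<lfloor>2 ^ L * t\<rfloor>)" v2] by blast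
  define c where "c l = (if l < 2 ^ L then c1 l else c2 (l - 2 ^ L))" for l
  have "u t = (\<Sum>l<2 ^ Suc L. c l * wal l t)" if t: "0 \<le> t" "t < 1" for t
  proof -
    define m where "m = nat \<lfloor>2 ^ Suc L * t\<rfloor>"
    have "\<lfloor>2 ^ L * t\<rfloor> = \<lfloor>2 ^ Suc L * t\<rfloor> div 2"
      using floor_dig_div[of L "Suc L" t] by simp
    then have m: "nat \<lfloor>2 ^ L * t\<rfloor> = m div 2"
      using t by (simp add: m_def nat_div_distrib del: power_Suc)
    have "even \<lfloor>2 ^ Suc L * t\<rfloor> \<longleftrightarrow> even m"
      using t by (simp add: m_def even_nat_iff del: power_Suc)
    then have d: "dig L t = (if even m then 1 else -1)"
      by (simp add: dig_def)
    have "u t = v m"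
      using Suc.prems[OF t] by (simp add: m_def)
    also have "\<dots> = v1 (m div 2) + v2 (m div 2) * dig L t"
      unfolding d v1_def v2_def by (cases "even m") (auto elim!: evenE oddE simp: field_simps)
    also have "\<dots> = (\<Sum>l<2 ^ L. c1 l * wal l t) + (\<Sum>l<2 ^ L. c2 l * wal l t) * dig L t"
      using c1[OF t] c2[OF t] by (simp add: m)
    also have "(\<Sum>l<2 ^ L. c2 l * wal l t) * dig L t = (\<Sum>l<2 ^ L. c2 l * wal (l + 2 ^ L) t)"
      by (simp add: sum_distrib_right wal_add_pow2 mult.assoc)
    also have "\<dots> = (\<Sum>l = 0 + 2 ^ L..<2 ^ L + 2 ^ L. c2 (l - 2 ^ L) * wal l t)"
      by (subst sum.shift_bounds_nat_ivl) (simp add: atLeast0LessThan)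
    also have "(\<Sum>l<2 ^ L. c1 l * wal l t) + \<dots> = (\<Sum>l<2 ^ Suc L. c l * wal l t)"
    proof -
      have "(\<Sum>l<2 ^ Suc L. c l * wal l t) = (\<Sum>l = 0..<2 ^ L. c l * wal l t) + (\<Sum>l = 2 ^ L..<2 ^ L + 2 ^ L. c l * wal l t)"
        by (subst sum.atLeastLessThan_concat) (simp_all add: lessThan_atLeast0 mult_2)
      then show ?thesis
        by (simp add: c_def lessThan_atLeast0)
    qed
    finally show ?thesis .
  qed
  then show ?case
    by blast
qed

lemma step_wal:
  assumes "n < 2 ^ L"
  shows "step L (wal n)"
proof -
  have "dig i t = (if even (nat \<lfloor>2 ^ L * t\<rfloor> div 2 ^ (L - Suc i)) then 1 else -1)"
    if "i < L" "0 \<le> t" for i t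
  proof -
    have "\<lfloor>2 ^ Suc i * t\<rfloor> = \<lfloor>2 ^ L * t\<rfloor> div 2 ^ (L - Suc i)"
      using that by (intro floor_dig_div) simp
    also have "\<dots> = int (nat \<lfloor>2 ^ L * t\<rfloor> div 2 ^ (L - Suc i))"
      using that by (simp add: zdiv_int)
    finally show ?thesis
      unfolding dig_def by (simp only: even_of_nat)
  qed
  then show ?thesis
    unfolding step_def wal_level[OF assms]
    by (intro exI[of _ "\<lambda>j. \<Prod>i<L. if bit n i then (if even (j div 2 ^ (L - Suc i)) then 1 else -1) else 1"])
      (auto intro!: prod.cong)
qed

lemma step_const [simp]: "step L (\<lambda>_. c)"
  unfolding step_def by auto

lemma step_compose2:
  assumes "step L u" "step L v"
  shows "step L (\<lambda>x. h (u x) (v x))"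
proof -
  obtain a b where "\<And>t. 0 \<le> t \<Longrightarrow> t < 1 \<Longrightarrow> u t = a (nat \<lfloor>2 ^ L * t\<rfloor>)"
    "\<And>t. 0 \<le> t \<Longrightarrow> t < 1 \<Longrightarrow> v t = b (nat \<lfloor>2 ^ L * t\<rfloor>)"
    using assms unfolding step_def by blast
  then show ?thesis
    unfolding step_def by (intro exI[of _ "\<lambda>j. h (a j) (b j)"]) auto
qed

lemma step_compose: "step L u \<Longrightarrow> step L (\<lambda>x. h (u x))"
  using step_compose2[of L u u "\<lambda>a b. h a"] by simp

lemma step_sum: "(\<And>k. k < K \<Longrightarrow> step L (f k)) \<Longrightarrow> step L (\<lambda>x. \<Sum>k<K. f k x)" for K :: nat
  by (induction K) (auto intro: step_compose2[where h = "(+)"])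

context ri_space
begin

text \<open>The operator \<open>T\<close> is the average of \<open>P\<close> over conjugation by the flips of the first \<open>L\<close> digits; the
  averaging removes the matrix entries between different Walsh functions of level \<open>L\<close>.\<close>

lemma averaged_projection:
  assumes P: "bounded_into n K P" and id: "\<And>f. f \<in> wspan n \<Longrightarrow> AE x in I01. P f x = f x"
  obtains T where "bounded_into n K T"
    "\<And>u k. step L u \<Longrightarrow> u \<in> borel_measurable I01 \<Longrightarrow> n k < 2 ^ L \<Longrightarrow>
      (\<integral>x. T u x * wal (n k) x \<partial>I01) = (\<integral>x. u x * wal (n k) x \<partial>I01)"
proof -
  obtain T where T: "bounded_into n K T" and co: "\<And>l m. (\<integral>x. T (wal l) x * wal m x \<partial>I01) =
    (if \<forall>i<L. bit l i = bit m i then \<integral>x. P (wal l) x * wal m x \<partial>I01 else 0)"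
    using iterated_flip_avg[OF P] by blast
  have S: "wal (n k) \<in> wspan n" for k
    unfolding wspan_def
  proof (intro CollectI conjI allI impI)
    fix e :: real assume "e > 0"
    have "wcomb n (Suc k) (\<lambda>j. if j = k then 1 else 0) x = wal (n k) x" for x
      by (simp add: wcomb_def if_distrib[of "\<lambda>a. a * _"] sum.delta cong: if_cong)
    then show "\<exists>K c. nrm (\<lambda>x. wal (n k) x - wcomb n K c x) < e"
      using \<open>e > 0\<close> nrm_zero_iff[OF inX_const[of 0]]
      by (intro exI[of _ "Suc k"] exI[of _ "\<lambda>j. if j = k then 1 else 0"]) simp
  qed simp
  \<comment> \<open>Diagonal entries are 1 because \<open>P\<close> fixes \<open>wal (n k)\<close>.
    Distinct indices below 2^L differ in a bit below L, and there the averaging has erased the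
    entry.\<close>
  have base: "(\<integral>x. T (wal l) x * wal (n k) x \<partial>I01) = (\<integral>x. wal l x * wal (n k) x \<partial>I01)"
    if l: "l < 2 ^ L" and k: "n k < 2 ^ L" for l k
  proof (cases "l = n k")
    case True
    have "(\<integral>x. P (wal l) x * wal (n k) x \<partial>I01) = (\<integral>x. wal l x * wal (n k) x \<partial>I01)"
    proof (rule integral_cong_AE)
      show "AE x in I01. P (wal l) x * wal (n k) x = wal l x * wal (n k) x"
        using id[OF S[of k]] by (simp add: True eventually_mono)
      show "(\<lambda>x. P (wal l) x * wal (n k) x) \<in> borel_measurable I01"
        using bounded_intoD(2)[OF P inX_wal[of l]] by (intro borel_measurable_times) auto
    qed auto
    then show ?thesis
      by (simp add: co True)
  next
    case False
    then obtain i where i: "bit l i \<noteq> bit (n k) i"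
      by (meson bit_eq_iff)
    then have "i < L"
      using not_bit_ge[OF l] not_bit_ge[OF k] by (meson not_le)
    then show ?thesis
      using i False by (auto simp: co integral_wal_wal)
  qed
  show ?thesis
  proof (rule that[OF T])
    fix u k assume u: "step L u" "u \<in> borel_measurable I01" and k: "n k < 2 ^ L"
    obtain v where "\<And>t. 0 \<le> t \<Longrightarrow> t < 1 \<Longrightarrow> u t = v (nat \<lfloor>2 ^ L * t\<rfloor>)"
      using u unfolding step_def by blast
    then obtain c where c: "\<And>t. 0 \<le> t \<Longrightarrow> t < 1 \<Longrightarrow> u t = (\<Sum>l<2 ^ L. c l * wal l t)"
      using step_wal_sum by blast
    define w where "w = (\<lambda>t. \<Sum>l<2 ^ L. c l * wal l t)"
    have uw: "AE x in I01. u x = w x"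
      using AE_I01_halfopen by (rule eventually_mono) (simp add: c w_def)
    have wX: "inX N w"
      using inX_wcomb[of id "2 ^ L" c] by (simp add: w_def wcomb_def[abs_def])
    have uX: "inX N u"
      by (rule inX_cong_AE(1)[OF u(2) wX uw])
    have Tw: "AE x in I01. T w x = (\<Sum>l<2 ^ L. c l * T (wal l) x)"
      unfolding w_def by (rule bounded_into_sum[OF T]) simp
    have Tu: "AE x in I01. T u x = (\<Sum>l<2 ^ L. c l * T (wal l) x)"
      using bounded_into_cong[OF T uX wX uw] Tw by eventually_elim simp
    have TX: "inX N (T u)" "\<And>l. inX N (T (wal l))"
      using bounded_intoD(2)[OF T] uX by auto
    have "(\<integral>x. T u x * wal (n k) x \<partial>I01) = (\<integral>x. (\<Sum>l<2 ^ L. c l * (T (wal l) x * wal (n k) x)) \<partial>I01)"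
    proof (rule integral_cong_AE)
      show "AE x in I01. T u x * wal (n k) x = (\<Sum>l<2 ^ L. c l * (T (wal l) x * wal (n k) x))"
        using Tu by eventually_elim (simp add: sum_distrib_right mult.assoc)
    qed (use TX in \<open>auto intro!: borel_measurable_times borel_measurable_sum\<close>)
    also have "\<dots> = (\<Sum>l<2 ^ L. c l * (\<integral>x. T (wal l) x * wal (n k) x \<partial>I01))"
      using pairing_wal(1)[OF TX(2)] by (subst Bochner_Integration.integral_sum) auto
    also have "\<dots> = (\<Sum>l<2 ^ L. c l * (\<integral>x. wal l x * wal (n k) x \<partial>I01))"
      using base k by (intro sum.cong) auto
    also have "\<dots> = (\<integral>x. (\<Sum>l<2 ^ L. c l * (wal l x * wal (n k) x)) \<partial>I01)"
      using pairing_wal(1)[OF inX_wal] by (subst Bochner_Integration.integral_sum) auto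
    also have "\<dots> = (\<integral>x. u x * wal (n k) x \<partial>I01)"
    proof (rule integral_cong_AE)
      show "AE x in I01. (\<Sum>l<2 ^ L. c l * (wal l x * wal (n k) x)) = u x * wal (n k) x"
        using uw by eventually_elim (simp add: w_def sum_distrib_right mult.assoc)
    qed (use u in \<open>auto intro!: borel_measurable_times borel_measurable_sum\<close>)
    finally show "(\<integral>x. T u x * wal (n k) x \<partial>I01) = (\<integral>x. u x * wal (n k) x \<partial>I01)" .
  qed
qed

end

section \<open>Riesz products\<close>

lemma less_pow2_iff_bits: "m < 2 ^ L \<longleftrightarrow> (\<forall>i\<ge>L. \<not> bit m i)" for m L :: nat
proof
  assume "\<forall>i\<ge>L. \<not> bit m i"
  then have "bit (take_bit L m) i = bit m i" for i
    by (cases "i < L") (simp_all add: bit_take_bit_iff)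
  then have "take_bit L m = m"
    by (intro bit_eqI)
  then show "m < 2 ^ L"
    by (simp add: take_bit_nat_eq_self_iff)
qed (auto dest: not_bit_ge)

text \<open>Addition is xor together with carries, and carries only increase the result.\<close>

lemma xor_le_add: "xor m n \<le> m + n" for m n :: nat
proof (induction m arbitrary: n rule: less_induct)
  case (less m)
  show ?case
  proof (cases "m = 0 \<or> n = 0")
    case False
    then have "xor (m div 2) (n div 2) \<le> m div 2 + n div 2"
      by (intro less.IH) auto
    moreover have "xor m n = (m mod 2 + n mod 2) mod 2 + 2 * xor (m div 2) (n div 2)"
      using False by (subst xor_nat_unfold) simp
    moreover have "(m mod 2 + n mod 2) mod 2 \<le> m mod 2 + n mod 2"
      by simp
    moreover have "m = m mod 2 + 2 * (m div 2)" "n = n mod 2 + 2 * (n div 2)"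
      by simp_all
    ultimately show ?thesis
      by linarith
  qed auto
qed

text \<open>Multiplying \<open>wal l\<close> by \<open>wal m\<close> lowers the index by at most m.
  This is the frequency estimate behind the spectrum of the Riesz product.\<close>

lemma le_xor_add: "l \<le> xor l m + m" for l m :: nat
  using xor_le_add[of "xor l m" m] by (simp add: xor.assoc)

context ri_space
begin

lemma wcomb_coeff:
  assumes "inj n"
  shows "(\<integral>x. wcomb n K c x * wal (n k) x \<partial>I01) = (if k < K then c k else 0)"
proof -
  have "(\<integral>x. wcomb n K c x * wal (n k) x \<partial>I01) = (\<Sum>j<K. c j * (\<integral>x. wal (n k) x * wal (n j) x \<partial>I01))"
    using integral_mult_wcomb[OF inX_wal, of "n k" n K c] by (simp add: mult.commute)
  also have "\<dots> = (\<Sum>j<K. if j = k then c j else 0)"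
    using assms by (intro sum.cong) (auto simp: integral_wal_wal dest: injD)
  finally show ?thesis
    by simp
qed

text \<open>Averaging a sum with its flip in one digit removes the frequencies containing that bit
  and, by rearrangement invariance, does not increase the norm. Doing so for all bits from L on
  realises the conditional expectation on level L for Walsh polynomials.\<close>

lemma nrm_wcomb_kill_bits:
  "nrm (wcomb n K (\<lambda>k. if \<exists>i. L \<le> i \<and> i < L + d \<and> bit (n k) i then 0 else c k)) \<le> nrm (wcomb n K c)"
proof (induction d)
  case 0
  have "(\<lambda>k. if \<exists>i. L \<le> i \<and> i < L + 0 \<and> bit (n k) i then 0 else c k) = c"
    by (intro ext) (simp add: not_le[symmetric] cong: conj_cong)
  then show ?case
    by simp
next
  case (Suc d)
  define c1 where "c1 = (\<lambda>k. if \<exists>i. L \<le> i \<and> i < L + d \<and> bit (n k) i then 0 else c k)"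
  define c2 where "c2 = (\<lambda>k. if \<exists>i. L \<le> i \<and> i < L + Suc d \<and> bit (n k) i then 0 else c k)"
  have X: "inX N (\<lambda>x. wcomb n K c1 (flip (L + d) x))"
    by (rule inX_flip(1)[OF inX_wcomb])
  have "wcomb n K c2 x = 1/2 * wcomb n K c1 x + 1/2 * wcomb n K c1 (flip (L + d) x)" if x: "0 \<le> x" "x < 1" for x
  proof -
    have "c2 k = 1/2 * c1 k + 1/2 * ((if bit (n k) (L + d) then -1 else 1) * c1 k)" for k
    proof -
      have "(\<exists>i. L \<le> i \<and> i < L + Suc d \<and> bit (n k) i) \<longleftrightarrow>
          (\<exists>i. L \<le> i \<and> i < L + d \<and> bit (n k) i) \<or> bit (n k) (L + d)"
        by (metis add_Suc_right le_add1 less_Suc_eq)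
      moreover have "(if A \<or> B then 0 else y) = 1/2 * (if A then 0 else y) + 1/2 * ((if B then -1 else 1) * (if A then 0 else y))"
        for A B and y :: real
        by auto
      ultimately show ?thesis
        unfolding c1_def c2_def by (simp only:)
    qed
    then show ?thesis
      unfolding wcomb_flip[OF x] by (simp add: wcomb_def sum.distrib[symmetric] sum_distrib_left algebra_simps)
  qed
  then have "nrm (wcomb n K c2) = nrm (\<lambda>x. 1/2 * wcomb n K c1 x + 1/2 * wcomb n K c1 (flip (L + d) x))"
    by (intro inX_cong_AE(2)[OF wcomb_measurable inX_lin[OF inX_wcomb X]] eventually_mono[OF AE_I01_halfopen]) auto
  also have "\<dots> \<le> nrm (\<lambda>x. 1/2 * wcomb n K c1 x) + nrm (\<lambda>x. 1/2 * wcomb n K c1 (flip (L + d) x))"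
    by (intro inX_add(2) inX_scale(1) X inX_wcomb)
  also have "\<dots> = 1/2 * nrm (wcomb n K c1) + 1/2 * nrm (\<lambda>x. wcomb n K c1 (flip (L + d) x))"
    by (simp only: inX_scale(2)[OF X] inX_scale(2)[OF inX_wcomb])
  also have "nrm (\<lambda>x. wcomb n K c1 (flip (L + d) x)) = nrm (wcomb n K c1)"
    by (rule inX_flip(2)[OF inX_wcomb])
  finally show ?case
    using Suc.IH unfolding c1_def[symmetric] c2_def[symmetric] by simp
qed

lemma nrm_wcomb_low:
  "nrm (wcomb n K (\<lambda>k. if n k < 2 ^ L then c k else 0)) \<le> nrm (wcomb n K c)"
proof -
  \<comment> \<open>Each n k with k < K is at most d, and d < 2^d, so the window from L to L + d
    contains every bit at or above L that occurs.\<close>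
  define d where "d = sum n {..<K}"
  have "n k < 2 ^ (L + d)" if "k < K" for k
  proof -
    have "n k \<le> d"
      unfolding d_def using that by (intro member_le_sum) auto
    also have "d < 2 ^ d"
      by (rule less_exp)
    also have "(2::nat) ^ d \<le> 2 ^ (L + d)"
      by (intro power_increasing) auto
    finally show ?thesis .
  qed
  then have "(\<exists>i. L \<le> i \<and> i < L + d \<and> bit (n k) i) \<longleftrightarrow> \<not> n k < 2 ^ L" if "k < K" for k
    using that not_bit_ge unfolding less_pow2_iff_bits[of "n k" L] by (meson not_le)
  then have "wcomb n K (\<lambda>k. if n k < 2 ^ L then c k else 0) =
      wcomb n K (\<lambda>k. if \<exists>i. L \<le> i \<and> i < L + d \<and> bit (n k) i then 0 else c k)"
    unfolding wcomb_def by (intro ext sum.cong) auto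
  then show ?thesis
    using nrm_wcomb_kill_bits[of n K L d c] by simp
qed

lemma inX_sum:
  assumes "finite A" "\<And>k. k \<in> A \<Longrightarrow> inX N (f k)"
  shows "inX N (\<lambda>x. \<Sum>k\<in>A. f k x) \<and> nrm (\<lambda>x. \<Sum>k\<in>A. f k x) \<le> (\<Sum>k\<in>A. nrm (f k))"
  using assms
proof (induction A rule: finite_induct)
  case empty
  have "nrm (\<lambda>x. 0) = 0"
    using nrm_zero_iff[OF inX_const[of 0]] by simp
  then show ?case
    by simp
next
  case (insert a A)
  have 1: "inX N (\<lambda>x. \<Sum>k\<in>A. f k x)" "nrm (\<lambda>x. \<Sum>k\<in>A. f k x) \<le> (\<Sum>k\<in>A. nrm (f k))" "inX N (f a)"
    using insert by auto
  show ?case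
    using inX_add[OF 1(3,1)] 1(2) insert(1,2) by simp
qed

text \<open>Passes from Walsh polynomials to the closed span: finitely many indices lie below 2^L
  and each coefficient is a continuous functional, so approximating g perturbs the low part only
  slightly.\<close>

lemma nrm_low_part:
  assumes n: "inj n" and g: "g \<in> wspan n"
  shows "nrm (\<lambda>x. \<Sum>k | n k < 2 ^ L. (\<integral>y. g y * wal (n k) y \<partial>I01) * wal (n k) x) \<le> nrm g"
proof -
  define A where "A = {k. n k < 2 ^ L}"
  have "finite (n -` {..<2 ^ L})"
    using n by (intro finite_vimageI) auto
  then have A: "finite A"
    by (simp add: A_def vimage_def)
  define B where "B k = (\<integral>y. g y * wal (n k) y \<partial>I01)" for k
  have gX: "inX N g"
    using g by auto
  \<comment> \<open>An approximation error e changes g by e and each of the \<open>card A\<close>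
    low coefficients by at most \<open>Cone * e\<close>, carried by a Walsh function of norm at most
    \<open>Cinf\<close>.\<close>
  define M where "M = 1 + card A * (Cone * Cinf)"
  have M: "M > 0"
    unfolding M_def using Cone(1) Cinf(1) by (intro add_pos_nonneg mult_nonneg_nonneg) auto
  have main: "nrm (\<lambda>x. \<Sum>k\<in>A. B k * wal (n k) x) \<le> nrm g + e * M" if "e > 0" for e
  proof -
    obtain K c where c: "nrm (\<lambda>x. g x - wcomb n K c x) < e"
      using wspan_approx[OF g \<open>e > 0\<close>] .
    have dX: "inX N (\<lambda>x. g x - wcomb n K c x)"
      by (intro inX_diff gX inX_wcomb)
    define c' where "c' k = (if k < K then c k else 0)" for k
    have coeff: "\<bar>B k - c' k\<bar> \<le> Cone * e" for k
    proof -
      have "(\<integral>x. (g x - wcomb n K c x) * wal (n k) x \<partial>I01) = B k - c' k"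
        using pairing_wal(1)[OF gX] pairing_wal(1)[OF inX_wcomb]
        by (simp add: left_diff_distrib B_def c'_def wcomb_coeff[OF n])
      then have "\<bar>B k - c' k\<bar> \<le> Cone * nrm (\<lambda>x. g x - wcomb n K c x)"
        using pairing_wal(2)[OF dX, of "n k"] by simp
      also have "\<dots> \<le> Cone * e"
        using c Cone(1) by (intro mult_left_mono) auto
      finally show ?thesis .
    qed
    define D where "D = (\<lambda>x. \<Sum>k\<in>A. (B k - c' k) * wal (n k) x)"
    have DX: "inX N D" "nrm D \<le> (\<Sum>k\<in>A. nrm (\<lambda>x. (B k - c' k) * wal (n k) x))"
      unfolding D_def using inX_sum[OF A, of "\<lambda>k x. (B k - c' k) * wal (n k) x"] inX_scale(1)[OF inX_wal] by blast+
    have "nrm D \<le> (\<Sum>k\<in>A. Cone * e * Cinf)"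
    proof (rule order_trans[OF DX(2)], rule sum_mono)
      fix k
      have "\<bar>B k - c' k\<bar> * nrm (wal (n k)) \<le> Cone * e * Cinf"
        using coeff[of k] nrm_wal[of "n k"] by (intro mult_mono) auto
      then show "nrm (\<lambda>x. (B k - c' k) * wal (n k) x) \<le> Cone * e * Cinf"
        by (simp add: inX_scale)
    qed
    then have D: "nrm D \<le> card A * (Cone * e * Cinf)"
      by simp
    define W where "W = wcomb n K (\<lambda>k. if n k < 2 ^ L then c k else 0)"
    have W_eq: "W x = (\<Sum>k\<in>A. c' k * wal (n k) x)" for x
    proof -
      have "W x = (\<Sum>k\<in>A \<inter> {..<K}. c k * wal (n k) x)"
        unfolding W_def wcomb_def by (rule sum.mono_neutral_cong_right) (auto simp: A_def)
      also have "\<dots> = (\<Sum>k\<in>A. c' k * wal (n k) x)"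
        by (rule sum.mono_neutral_cong_left) (auto simp: A c'_def)
      finally show ?thesis .
    qed
    have "nrm W \<le> nrm (wcomb n K c)"
      unfolding W_def by (rule nrm_wcomb_low)
    also have "wcomb n K c = (\<lambda>x. g x - (g x - wcomb n K c x))"
      by simp
    also have "nrm \<dots> \<le> nrm g + nrm (\<lambda>x. g x - wcomb n K c x)"
      by (intro inX_diff gX dX)
    finally have W: "nrm W \<le> nrm g + e"
      using c by linarith
    have "(\<lambda>x. \<Sum>k\<in>A. B k * wal (n k) x) = (\<lambda>x. W x + D x)"
      unfolding W_eq D_def by (simp add: sum.distrib[symmetric] algebra_simps)
    then have "nrm (\<lambda>x. \<Sum>k\<in>A. B k * wal (n k) x) \<le> nrm W + nrm D"
      using inX_add(2)[of W D] DX(1) by (simp add: W_def)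
    then show ?thesis
      using W D by (simp add: M_def algebra_simps)
  qed
  have "nrm (\<lambda>x. \<Sum>k\<in>A. B k * wal (n k) x) \<le> nrm g"
  proof (rule field_le_epsilon)
    fix e :: real assume "e > 0"
    then show "nrm (\<lambda>x. \<Sum>k\<in>A. B k * wal (n k) x) \<le> nrm g + e"
      using main[of "e / M"] M by simp
  qed
  then show ?thesis
    by (simp add: A_def B_def)
qed

end

text \<open>Real and imaginary part of the Riesz product \<open>\<Prod>k<K. 1 + \<i> b w\<close> with \<open>w = wal (\<nu> k)\<close>.\<close>

primrec riesz :: "(nat \<Rightarrow> nat) \<Rightarrow> real \<Rightarrow> nat \<Rightarrow> (real \<Rightarrow> real) \<times> (real \<Rightarrow> real)" where
  "riesz \<nu> b 0 = ((\<lambda>_. 1), (\<lambda>_. 0))"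
| "riesz \<nu> b (Suc k) =
    ((\<lambda>x. fst (riesz \<nu> b k) x - b * (wal (\<nu> k) x * snd (riesz \<nu> b k) x)),
     (\<lambda>x. snd (riesz \<nu> b k) x + b * (wal (\<nu> k) x * fst (riesz \<nu> b k) x)))"

text \<open>|1 + i b w|^2 = 1 + b^2, because w is 1 or -1.\<close>

lemma riesz_modulus: "(fst (riesz \<nu> b K) x)\<^sup>2 + (snd (riesz \<nu> b K) x)\<^sup>2 = (1 + b\<^sup>2) ^ K"
proof (induction K)
  case (Suc K)
  define R F w where "R = fst (riesz \<nu> b K) x" and "F = snd (riesz \<nu> b K) x" and "w = wal (\<nu> K) x"
  have w: "w\<^sup>2 = 1"
    by (simp add: w_def power2_eq_square)
  have "(R - b * (w * F))\<^sup>2 + (F + b * (w * R))\<^sup>2 = R\<^sup>2 + F\<^sup>2 + b\<^sup>2 * w\<^sup>2 * (R\<^sup>2 + F\<^sup>2)"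
    by (simp add: power2_eq_square algebra_simps)
  also have "\<dots> = (1 + b\<^sup>2) * (R\<^sup>2 + F\<^sup>2)"
    by (simp add: w algebra_simps)
  finally show ?case
    using Suc.IH by (simp add: R_def F_def w_def)
qed simp

lemma riesz_measurable [measurable]:
  "fst (riesz \<nu> b K) \<in> borel_measurable I01" "snd (riesz \<nu> b K) \<in> borel_measurable I01"
proof (induction K)
  case (Suc K)
  {
    case 1
    show ?case
      using Suc by simp
  next
    case 2
    show ?case
      using Suc by simp
  }
qed auto

lemma riesz_step:
  assumes "\<And>k. k < K \<Longrightarrow> \<nu> k < 2 ^ L"
  shows "step L (fst (riesz \<nu> b K)) \<and> step L (snd (riesz \<nu> b K))"
  using assms
proof (induction K)
  case (Suc K)
  then have IH: "step L (fst (riesz \<nu> b K))" "step L (snd (riesz \<nu> b K))" "step L (wal (\<nu> K))"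
    by (auto intro: step_wal)
  have "step L (\<lambda>x. wal (\<nu> K) x * snd (riesz \<nu> b K) x)" "step L (\<lambda>x. wal (\<nu> K) x * fst (riesz \<nu> b K) x)"
    by (rule step_compose2[where h = "(*)"], rule IH, rule IH)+
  then show ?case
    using step_compose2[OF IH(1), of _ "\<lambda>u v. u - b * v"] step_compose2[OF IH(2), of _ "\<lambda>u v. u + b * v"]
    by simp
qed simp

text \<open>The squared modulus (1 + b^2)^K is at most exp (K b^2), hence at most e; 4 is taken as a
  square above e.\<close>

lemma riesz_bound:
  assumes "real K * b\<^sup>2 \<le> 1"
  shows "\<bar>fst (riesz \<nu> b K) x\<bar> \<le> 2" "\<bar>snd (riesz \<nu> b K) x\<bar> \<le> 2"
proof -
  have "(1 + b\<^sup>2) ^ K \<le> exp (b\<^sup>2) ^ K"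
    by (intro power_mono) auto
  also have "\<dots> = exp (real K * b\<^sup>2)"
    by (simp add: exp_of_nat_mult)
  also have "\<dots> \<le> exp 1"
    using assms by simp
  also have "\<dots> \<le> 4"
    using exp_le by simp
  finally have "(fst (riesz \<nu> b K) x)\<^sup>2 + (snd (riesz \<nu> b K) x)\<^sup>2 \<le> 2\<^sup>2"
    by (simp add: riesz_modulus)
  then have "(fst (riesz \<nu> b K) x)\<^sup>2 \<le> 2\<^sup>2" "(snd (riesz \<nu> b K) x)\<^sup>2 \<le> 2\<^sup>2"
    using zero_le_power2[of "fst (riesz \<nu> b K) x"] zero_le_power2[of "snd (riesz \<nu> b K) x"] by linarith+
  then show "\<bar>fst (riesz \<nu> b K) x\<bar> \<le> 2" "\<bar>snd (riesz \<nu> b K) x\<bar> \<le> 2"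
    by (simp_all only: abs_le_square_iff[symmetric] abs_numeral)
qed

text \<open>From this index on, all Walsh coefficients of the product of the first k factors vanish
  (\<open>riesz_high_frequency\<close>). The empty product occupies index 0 only; after the factor
  with \<open>\<nu> j\<close> all indices are below \<open>2 * \<nu> j\<close>.\<close>

definition freq_bound :: "(nat \<Rightarrow> nat) \<Rightarrow> nat \<Rightarrow> nat" where
  "freq_bound \<nu> k = (case k of 0 \<Rightarrow> 1 | Suc j \<Rightarrow> 2 * \<nu> j)"

text \<open>Ratio at least 2 and a positive start, phrased so that each new frequency lies beyond
  the spectrum of the product before it.\<close>

definition dyadic_lacunary :: "(nat \<Rightarrow> nat) \<Rightarrow> bool" where
  "dyadic_lacunary \<nu> \<longleftrightarrow> (\<forall>k. freq_bound \<nu> k \<le> \<nu> k)"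

lemma riesz_integrable:
  assumes "real K * b\<^sup>2 \<le> 1"
  shows "integrable I01 (\<lambda>x. fst (riesz \<nu> b K) x * wal l x)" "integrable I01 (\<lambda>x. snd (riesz \<nu> b K) x * wal l x)"
  using riesz_bound[OF assms, of \<nu>] by (auto intro!: integrable_I01[where c = 2] simp: abs_mult)

lemma riesz_integral_Suc:
  assumes "real (Suc K) * b\<^sup>2 \<le> 1"
  shows "(\<integral>x. fst (riesz \<nu> b (Suc K)) x * wal l x \<partial>I01) =
      (\<integral>x. fst (riesz \<nu> b K) x * wal l x \<partial>I01) - b * (\<integral>x. snd (riesz \<nu> b K) x * wal (xor l (\<nu> K)) x \<partial>I01)"
    and "(\<integral>x. snd (riesz \<nu> b (Suc K)) x * wal l x \<partial>I01) =
      (\<integral>x. snd (riesz \<nu> b K) x * wal l x \<partial>I01) + b * (\<integral>x. fst (riesz \<nu> b K) x * wal (xor l (\<nu> K)) x \<partial>I01)"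
proof -
  have "real K * b\<^sup>2 \<le> 1"
    using assms by (rule order_trans[rotated]) (simp add: mult_right_mono)
  note int = riesz_integrable[OF this, of \<nu>]
  have "(\<integral>x. fst (riesz \<nu> b (Suc K)) x * wal l x \<partial>I01) =
      (\<integral>x. fst (riesz \<nu> b K) x * wal l x - b * (snd (riesz \<nu> b K) x * wal (xor l (\<nu> K)) x) \<partial>I01)"
    by (intro Bochner_Integration.integral_cong) (auto simp: wal_xor algebra_simps)
  then show "(\<integral>x. fst (riesz \<nu> b (Suc K)) x * wal l x \<partial>I01) =
      (\<integral>x. fst (riesz \<nu> b K) x * wal l x \<partial>I01) - b * (\<integral>x. snd (riesz \<nu> b K) x * wal (xor l (\<nu> K)) x \<partial>I01)"
    using int by simp
  have "(\<integral>x. snd (riesz \<nu> b (Suc K)) x * wal l x \<partial>I01) =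
      (\<integral>x. snd (riesz \<nu> b K) x * wal l x + b * (fst (riesz \<nu> b K) x * wal (xor l (\<nu> K)) x) \<partial>I01)"
    by (intro Bochner_Integration.integral_cong) (auto simp: wal_xor algebra_simps)
  then show "(\<integral>x. snd (riesz \<nu> b (Suc K)) x * wal l x \<partial>I01) =
      (\<integral>x. snd (riesz \<nu> b K) x * wal l x \<partial>I01) + b * (\<integral>x. fst (riesz \<nu> b K) x * wal (xor l (\<nu> K)) x \<partial>I01)"
    using int by simp
qed

text \<open>A new factor shifts indices by xor with \<open>\<nu> K\<close>. If l is at least twice
  \<open>\<nu> K\<close>, then l and the shifted index are both at least \<open>\<nu> K\<close>,
  hence beyond the spectrum of the preceding product.\<close>

lemma riesz_high_frequency:
  assumes \<nu>: "dyadic_lacunary \<nu>" and b: "real K * b\<^sup>2 \<le> 1" and l: "freq_bound \<nu> K \<le> l"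
  shows "(\<integral>x. fst (riesz \<nu> b K) x * wal l x \<partial>I01) = 0 \<and> (\<integral>x. snd (riesz \<nu> b K) x * wal l x \<partial>I01) = 0"
  using b l
proof (induction K arbitrary: l)
  case 0
  then show ?case
    by (simp add: freq_bound_def integral_wal)
next
  case (Suc K)
  have b: "real K * b\<^sup>2 \<le> 1"
    using Suc.prems(1) by (rule order_trans[rotated]) (simp add: mult_right_mono)
  have "2 * \<nu> K \<le> l"
    using Suc.prems(2) by (simp add: freq_bound_def)
  moreover have "freq_bound \<nu> K \<le> \<nu> K"
    using \<nu> by (simp add: dyadic_lacunary_def)
  ultimately have "freq_bound \<nu> K \<le> l" "freq_bound \<nu> K \<le> xor l (\<nu> K)"
    using le_xor_add[of l "\<nu> K"] by linarith+
  then show ?case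
    unfolding riesz_integral_Suc[OF Suc.prems(1)] using Suc.IH[OF b] by simp
qed

lemma riesz_mean:
  assumes \<nu>: "dyadic_lacunary \<nu>" and b: "real K * b\<^sup>2 \<le> 1"
  shows "(\<integral>x. fst (riesz \<nu> b K) x * wal 0 x \<partial>I01) = 1"
  using b
proof (induction K)
  case (Suc K)
  have b: "real K * b\<^sup>2 \<le> 1"
    using Suc.prems(1) by (rule order_trans[rotated]) (simp add: mult_right_mono)
  have "freq_bound \<nu> K \<le> \<nu> K"
    using \<nu> by (simp add: dyadic_lacunary_def)
  then have "(\<integral>x. snd (riesz \<nu> b K) x * wal (xor 0 (\<nu> K)) x \<partial>I01) = 0"
    using riesz_high_frequency[OF \<nu> b, of "\<nu> K"] by simp
  then show ?case
    unfolding riesz_integral_Suc[OF Suc.prems(1)] using Suc.IH[OF b] by simp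
qed simp

text \<open>Step k adds b times the coefficient of the real part at \<open>xor m (\<nu> k)\<close>.
  That is the mean 1 if m is \<open>\<nu> k\<close>; otherwise \<open>sep\<close> places the index
  beyond the spectrum. So no longer product of Walsh functions contributes at m.\<close>

lemma riesz_coeff:
  assumes \<nu>: "dyadic_lacunary \<nu>" and b: "real K * b\<^sup>2 \<le> 1"
    and sep: "\<And>k. k < K \<Longrightarrow> m \<noteq> \<nu> k \<Longrightarrow> freq_bound \<nu> k \<le> xor m (\<nu> k)"
  shows "(\<integral>x. snd (riesz \<nu> b K) x * wal m x \<partial>I01) = (\<Sum>k<K. if m = \<nu> k then b else 0)"
  using b sep
proof (induction K)
  case (Suc K)
  have b: "real K * b\<^sup>2 \<le> 1"
    using Suc.prems(1) by (rule order_trans[rotated]) (simp add: mult_right_mono)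
  have "(\<integral>x. fst (riesz \<nu> b K) x * wal (xor m (\<nu> K)) x \<partial>I01) = (if m = \<nu> K then 1 else 0)"
    using riesz_mean[OF \<nu> b] riesz_high_frequency[OF \<nu> b Suc.prems(2)[of K]] by auto
  then show ?case
    unfolding riesz_integral_Suc[OF Suc.prems(1)] using Suc.IH[OF b] Suc.prems(2) by simp
qed simp

lemma dyadic_lacunary_mono: "dyadic_lacunary \<nu> \<Longrightarrow> 2 * \<nu> k \<le> \<nu> (Suc k) \<and> 0 < \<nu> k"
proof (induction k)
  case 0
  then have "freq_bound \<nu> 0 \<le> \<nu> 0" "freq_bound \<nu> (Suc 0) \<le> \<nu> (Suc 0)"
    unfolding dyadic_lacunary_def by blast+
  then show ?case
    by (simp add: freq_bound_def)
next
  case (Suc k)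
  then have "freq_bound \<nu> (Suc (Suc k)) \<le> \<nu> (Suc (Suc k))"
    unfolding dyadic_lacunary_def by blast
  then show ?case
    using Suc by (simp add: freq_bound_def)
qed

lemma dyadic_lacunary_strict_mono:
  assumes "dyadic_lacunary \<nu>"
  shows "strict_mono \<nu>"
proof (rule strict_mono_Suc_iff[THEN iffD2], rule allI)
  fix k
  show "\<nu> k < \<nu> (Suc k)"
    using dyadic_lacunary_mono[OF assms, of k] by linarith
qed

lemma dyadic_lacunary_less_pow:
  assumes "dyadic_lacunary \<nu>" "k < M"
  shows "\<nu> k < 2 ^ \<nu> M"
proof -
  have "\<nu> k < \<nu> M"
    using dyadic_lacunary_strict_mono[OF assms(1)] assms(2) by (simp add: strict_mono_less)
  also have "\<dots> < 2 ^ \<nu> M"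
    by (rule less_exp)
  finally show ?thesis .
qed

context ri_space
begin

text \<open>\<open>F\<close> and \<open>S\<close> have the same coefficient at every
  \<open>n j\<close>, so F - S annihilates the closed span. On elements of the span the unbounded
  family of sums S may thus be replaced by the bounded F.\<close>

lemma wspan_pairing_riesz:
  assumes n: "inj n" and g: "g \<in> wspan n"
    and \<nu>: "dyadic_lacunary \<nu>" and b: "real M * b\<^sup>2 \<le> 1"
    and sep: "\<And>j k. n j \<noteq> \<nu> k \<Longrightarrow> freq_bound \<nu> k \<le> xor (n j) (\<nu> k)"
  shows "(\<integral>x. g x * snd (riesz \<nu> b M) x \<partial>I01) = (\<Sum>k<M. b * (\<integral>x. g x * wal (\<nu> k) x \<partial>I01))"
proof -
  define F where "F = snd (riesz \<nu> b M)"
  define S where "S = wcomb \<nu> M (\<lambda>_. b)"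
  have F: "F \<in> borel_measurable I01" "\<And>x. \<bar>F x\<bar> \<le> 2"
    unfolding F_def by (auto intro: riesz_bound(2)[OF b])
  have S: "S \<in> borel_measurable I01" "\<And>x. \<bar>S x\<bar> \<le> real M * \<bar>b\<bar>"
    using abs_wcomb_le[of \<nu> M "\<lambda>_. b"] by (auto simp: S_def)
  have FS: "\<bar>F x - S x\<bar> \<le> 2 + real M * \<bar>b\<bar>" for x
    using F(2)[of x] S(2)[of x] by linarith
  have FSm: "(\<lambda>x. F x - S x) \<in> borel_measurable I01"
    using F S by simp
  have gX: "inX N g"
    using g by auto
  have wF: "integrable I01 (\<lambda>x. wal l x * (F x - S x))" for l
    by (rule pairing(1)[OF inX_wal FSm FS])
  have zero: "(\<integral>x. wal (n j) x * (F x - S x) \<partial>I01) = 0" for j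
  proof -
    have "(\<integral>x. wal (n j) x * (F x - S x) \<partial>I01) = (\<integral>x. F x * wal (n j) x - S x * wal (n j) x \<partial>I01)"
      by (simp add: algebra_simps)
    also have "\<dots> = (\<integral>x. F x * wal (n j) x \<partial>I01) - (\<integral>x. S x * wal (n j) x \<partial>I01)"
      unfolding F_def S_def by (rule Bochner_Integration.integral_diff[OF riesz_integrable(2)[OF b] pairing_wal(1)[OF inX_wcomb]])
    also have "(\<integral>x. F x * wal (n j) x \<partial>I01) = (\<Sum>k<M. if n j = \<nu> k then b else 0)"
      unfolding F_def using sep by (intro riesz_coeff[OF \<nu> b])
    also have "(\<integral>x. S x * wal (n j) x \<partial>I01) = (\<Sum>k<M. b * (\<integral>x. wal (n j) x * wal (\<nu> k) x \<partial>I01))"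
      using integral_mult_wcomb[OF inX_wal, of "n j" \<nu> M "\<lambda>_. b"] by (simp add: S_def mult.commute)
    also have "\<dots> = (\<Sum>k<M. if n j = \<nu> k then b else 0)"
      by (intro sum.cong) (auto simp: integral_wal_wal)
    finally show ?thesis
      by simp
  qed
  have small: "\<bar>\<integral>x. g x * (F x - S x) \<partial>I01\<bar> \<le> e" if "e > 0" for e
  proof -
    \<comment> \<open>The sup bound of F - S times \<open>Cone\<close> bounds the functional given
      by F - S; the summand 1 makes Q positive.\<close>
    define Q where "Q = (2 + real M * \<bar>b\<bar>) * Cone + 1"
    have Q: "Q > 0"
      unfolding Q_def using Cone(1) by (intro add_nonneg_pos mult_nonneg_nonneg) auto
    obtain K c where c: "nrm (\<lambda>x. g x - wcomb n K c x) < e / Q"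
      using wspan_approx[OF g, of "e / Q"] Q \<open>e > 0\<close> by auto
    have dX: "inX N (\<lambda>x. g x - wcomb n K c x)"
      by (intro inX_diff gX inX_wcomb)
    have "(\<integral>x. wcomb n K c x * (F x - S x) \<partial>I01) = (\<integral>x. (\<Sum>k<K. c k * (wal (n k) x * (F x - S x))) \<partial>I01)"
      by (simp add: wcomb_def sum_distrib_right mult.assoc)
    also have "\<dots> = (\<Sum>k<K. c k * (\<integral>x. wal (n k) x * (F x - S x) \<partial>I01))"
      using wF by (subst Bochner_Integration.integral_sum) auto
    also have "\<dots> = 0"
      by (simp add: zero)
    finally have "(\<integral>x. g x * (F x - S x) \<partial>I01) = (\<integral>x. g x * (F x - S x) \<partial>I01) - (\<integral>x. wcomb n K c x * (F x - S x) \<partial>I01)"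
      by simp
    also have "\<dots> = (\<integral>x. g x * (F x - S x) - wcomb n K c x * (F x - S x) \<partial>I01)"
      by (rule Bochner_Integration.integral_diff[symmetric]) (rule pairing(1)[OF gX FSm FS], rule pairing(1)[OF inX_wcomb FSm FS])
    also have "\<dots> = (\<integral>x. (g x - wcomb n K c x) * (F x - S x) \<partial>I01)"
      by (simp only: left_diff_distrib)
    finally have "\<bar>\<integral>x. g x * (F x - S x) \<partial>I01\<bar> \<le> (2 + real M * \<bar>b\<bar>) * Cone * nrm (\<lambda>x. g x - wcomb n K c x)"
      using pairing(2)[OF dX FSm FS] by simp
    also have "\<dots> \<le> Q * (e / Q)"
      using c Q Cone(1) unfolding Q_def by (intro mult_mono) auto
    finally show ?thesis
      using Q by simp
  qed
  have "\<bar>\<integral>x. g x * (F x - S x) \<partial>I01\<bar> \<le> 0"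
    by (rule field_le_epsilon) (simp add: small)
  then have "0 = (\<integral>x. g x * F x - g x * S x \<partial>I01)"
    by (simp add: right_diff_distrib)
  also have "\<dots> = (\<integral>x. g x * F x \<partial>I01) - (\<integral>x. g x * S x \<partial>I01)"
    using pairing(1)[OF gX F] pairing(1)[OF gX S] by simp
  also have "(\<integral>x. g x * S x \<partial>I01) = (\<Sum>k<M. b * (\<integral>x. g x * wal (\<nu> k) x \<partial>I01))"
    unfolding S_def by (rule integral_mult_wcomb[OF gX])
  finally show ?thesis
    by (simp add: F_def)
qed

text \<open>Neither bound depends on M, on b or on L, although the averaged operator T does. For the
  first, the part of T F below 2^L is exactly the sum, and cutting off higher frequencies does not
  increase the norm. For the second, h and T h have the same coefficients along
  \<open>\<nu>\<close>, and on T h the sum may be replaced by F.\<close>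

lemma complemented_imp_bounds:
  assumes P: "bounded_into n K P" and id: "\<And>f. f \<in> wspan n \<Longrightarrow> AE x in I01. P f x = f x"
    and K: "0 \<le> K" and n: "inj n" and \<nu>: "dyadic_lacunary \<nu>" "range \<nu> \<subseteq> range n" and b: "real M * b\<^sup>2 \<le> 1"
    and sep: "\<And>j k. n j \<noteq> \<nu> k \<Longrightarrow> freq_bound \<nu> k \<le> xor (n j) (\<nu> k)"
  shows "nrm (wcomb \<nu> M (\<lambda>_. b)) \<le> K * Cinf * 2"
    and "\<And>h L. inX N h \<Longrightarrow> step L h \<Longrightarrow> (\<And>k. k < M \<Longrightarrow> \<nu> k < 2 ^ L) \<Longrightarrow>
      (\<integral>x. h x * wcomb \<nu> M (\<lambda>_. b) x \<partial>I01) \<le> 2 * Cone * K * nrm h"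
proof -
  define F where "F = snd (riesz \<nu> b M)"
  have F: "F \<in> borel_measurable I01" "\<And>x. \<bar>F x\<bar> \<le> 2"
    unfolding F_def by (auto intro: riesz_bound(2)[OF b])
  have FX: "inX N F" "nrm F \<le> Cinf * 2"
    using inX_bounded[OF F(1), of 2] F(2) by auto
  define \<iota> where "\<iota> k = (SOME j. n j = \<nu> k)" for k
  have \<iota>: "n (\<iota> k) = \<nu> k" for k
  proof -
    have "\<nu> k \<in> range n"
      using \<nu>(2) by blast
    then have "\<exists>j. n j = \<nu> k"
      by (simp add: image_iff eq_commute)
    then show ?thesis
      unfolding \<iota>_def by (rule someI_ex)
  qed
  have inj_\<nu>: "\<nu> j = \<nu> k \<longleftrightarrow> j = k" for j k
    using dyadic_lacunary_strict_mono[OF \<nu>(1)] by (simp add: strict_mono_eq)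
  have inj_n: "n j = n k \<longleftrightarrow> j = k" for j k
    using n by (auto dest: injD)
  {
    fix h L
    assume h: "inX N h" "step L h" and L: "\<And>k. k < M \<Longrightarrow> \<nu> k < 2 ^ L"
    obtain T where T: "bounded_into n K T" and coeff: "\<And>u k. step L u \<Longrightarrow> u \<in> borel_measurable I01 \<Longrightarrow> n k < 2 ^ L \<Longrightarrow>
      (\<integral>x. T u x * wal (n k) x \<partial>I01) = (\<integral>x. u x * wal (n k) x \<partial>I01)"
      using averaged_projection[OF P id] by blast
    have Th: "T h \<in> wspan n" "inX N (T h)"
      using bounded_intoD[OF T] h by auto
    have "(\<integral>x. h x * wcomb \<nu> M (\<lambda>_. b) x \<partial>I01) = (\<Sum>k<M. b * (\<integral>x. h x * wal (\<nu> k) x \<partial>I01))"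
      by (rule integral_mult_wcomb[OF h(1)])
    also have "\<dots> = (\<Sum>k<M. b * (\<integral>x. T h x * wal (\<nu> k) x \<partial>I01))"
    proof (intro sum.cong refl)
      fix k assume "k \<in> {..<M}"
      then show "b * (\<integral>x. h x * wal (\<nu> k) x \<partial>I01) = b * (\<integral>x. T h x * wal (\<nu> k) x \<partial>I01)"
        using coeff[of h "\<iota> k"] h L[of k] by (simp add: \<iota> inX_measurable)
    qed
    also have "\<dots> = (\<integral>x. T h x * F x \<partial>I01)"
      unfolding F_def by (rule wspan_pairing_riesz[OF n Th(1) \<nu>(1) b sep, symmetric])
    also have "\<dots> \<le> 2 * Cone * nrm (T h)"
      using pairing(2)[OF Th(2) F] by linarith
    also have "\<dots> \<le> 2 * Cone * (K * nrm h)"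
      using bounded_intoD(4)[OF T h(1)] Cone(1) by (intro mult_left_mono) auto
    finally show "(\<integral>x. h x * wcomb \<nu> M (\<lambda>_. b) x \<partial>I01) \<le> 2 * Cone * K * nrm h"
      by (simp add: mult_ac)
  }
  \<comment> \<open>A level that covers all frequencies in use, by
    \<open>\<nu> k < \<nu> M < 2 ^ \<nu> M\<close>.\<close>
  define L where "L = \<nu> M"
  have L: "\<nu> k < 2 ^ L" if "k < M" for k
    unfolding L_def by (rule dyadic_lacunary_less_pow[OF \<nu>(1) that])
  obtain T where T: "bounded_into n K T" and coeff: "\<And>u k. step L u \<Longrightarrow> u \<in> borel_measurable I01 \<Longrightarrow> n k < 2 ^ L \<Longrightarrow>
      (\<integral>x. T u x * wal (n k) x \<partial>I01) = (\<integral>x. u x * wal (n k) x \<partial>I01)"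
    using averaged_projection[OF P id] by blast
  have F_step: "step L F"
    unfolding F_def using riesz_step[of M \<nu> L b] L by simp
  define A where "A = {k. n k < 2 ^ L}"
  have "finite (n -` {..<2 ^ L})"
    using n by (intro finite_vimageI) auto
  then have A: "finite A"
    by (simp add: A_def vimage_def)
  have TF: "(\<integral>x. T F x * wal (n j) x \<partial>I01) = (\<Sum>k<M. if n j = \<nu> k then b else 0)" if "j \<in> A" for j
  proof -
    have "(\<integral>x. T F x * wal (n j) x \<partial>I01) = (\<integral>x. F x * wal (n j) x \<partial>I01)"
      using that F_step F(1) by (intro coeff) (auto simp: A_def)
    also have "\<dots> = (\<Sum>k<M. if n j = \<nu> k then b else 0)"
      unfolding F_def using sep by (intro riesz_coeff[OF \<nu>(1) b])
    finally show ?thesis .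
  qed
  have "(\<Sum>k | n k < 2 ^ L. (\<integral>y. T F y * wal (n k) y \<partial>I01) * wal (n k) x) = wcomb \<nu> M (\<lambda>_. b) x" for x
  proof -
    have "(\<Sum>j\<in>A. (\<integral>y. T F y * wal (n j) y \<partial>I01) * wal (n j) x) = (\<Sum>j\<in>A. \<Sum>k<M. if n j = \<nu> k then b * wal (\<nu> k) x else 0)"
      by (intro sum.cong) (auto simp: TF sum_distrib_right intro!: sum.cong)
    also have "\<dots> = (\<Sum>k<M. \<Sum>j\<in>A. if n j = \<nu> k then b * wal (\<nu> k) x else 0)"
      by (rule sum.swap)
    also have "\<dots> = (\<Sum>k<M. b * wal (\<nu> k) x)"
    proof (intro sum.cong refl)
      fix k assume "k \<in> {..<M}"
      then have "\<iota> k \<in> A"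
        using L by (simp add: A_def \<iota>)
      moreover have "n j = \<nu> k \<longleftrightarrow> j = \<iota> k" for j
        using inj_n[of j "\<iota> k"] by (simp add: \<iota>)
      ultimately show "(\<Sum>j\<in>A. if n j = \<nu> k then b * wal (\<nu> k) x else 0) = b * wal (\<nu> k) x"
        using A by simp
    qed
    finally show ?thesis
      by (simp add: A_def wcomb_def)
  qed
  then have "nrm (wcomb \<nu> M (\<lambda>_. b)) \<le> nrm (T F)"
    using nrm_low_part[OF n bounded_intoD(1)[OF T FX(1)], of L] by simp
  also have "\<dots> \<le> K * nrm F"
    by (rule bounded_intoD(4)[OF T FX(1)])
  also have "\<dots> \<le> K * (Cinf * 2)"
    using FX(2) K by (intro mult_left_mono)
  finally show "nrm (wcomb \<nu> M (\<lambda>_. b)) \<le> K * Cinf * 2"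
    by simp
qed

end

section \<open>Lacunary sequences and tails of Walsh sums\<close>

lemma lacunary_growth:
  assumes "q > 1" "lacunary q n"
  shows "q ^ d * real (n k) \<le> real (n (k + d))"
proof (induction d)
  case (Suc d)
  have "0 < n (k + d)" "q \<le> real (n (Suc (k + d))) / real (n (k + d))"
    using assms(2) by (simp_all add: lacunary_def)
  then have "q * real (n (k + d)) \<le> real (n (Suc (k + d)))"
    by (simp add: field_simps)
  moreover have "q * (q ^ d * real (n k)) \<le> q * real (n (k + d))"
    using Suc assms(1) by (intro mult_left_mono) auto
  ultimately show ?case
    by simp
qed simp

lemma lacunary_pos: "lacunary q n \<Longrightarrow> 0 < n k"
  by (simp add: lacunary_def)

lemma lacunary_less:
  assumes q: "q > 1" "lacunary q n" and "i < j"
  shows "q * real (n i) \<le> real (n j)"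
proof -
  have "q ^ 1 \<le> q ^ (j - i)"
    using q \<open>i < j\<close> by (intro power_increasing) auto
  then have "q * real (n i) \<le> q ^ (j - i) * real (n i)"
    by (intro mult_right_mono) auto
  also have "\<dots> \<le> real (n j)"
    using lacunary_growth[OF q, of "j - i" i] \<open>i < j\<close> by simp
  finally show ?thesis .
qed

lemma lacunary_inj:
  assumes "q > 1" "lacunary q n"
  shows "inj n"
proof -
  have "n i < n j" if "i < j" for i j
  proof -
    have "real (n i) < q * real (n i)"
      using assms lacunary_pos[OF assms(2), of i] by simp
    also have "\<dots> \<le> real (n j)"
      by (rule lacunary_less[OF assms that])
    finally show ?thesis
      by simp
  qed
  then show ?thesis
    by (metis injI less_irrefl linorder_neqE_nat)
qed

text \<open>Every other term differs from \<open>\<nu> k\<close> by at least \<theta> times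
  \<open>\<nu> k\<close>. Passing to every M-th term makes this gap at least twice the preceding
  \<open>\<nu> i\<close>, and xor is at least the difference.\<close>

lemma lacunary_subsequence:
  assumes q: "q > 1" "lacunary q n"
  obtains \<nu> where "dyadic_lacunary \<nu>" "range \<nu> \<subseteq> range n"
    "\<And>j k. n j \<noteq> \<nu> k \<Longrightarrow> freq_bound \<nu> k \<le> xor (n j) (\<nu> k)"
proof -
  \<comment> \<open>Terms below \<open>\<nu> k\<close> are at most \<open>\<nu> k / q\<close>, which
    leaves the relative gap 1 - 1/q; terms above leave q - 1, which is at least as large.\<close>
  define \<theta> where "\<theta> = 1 - 1 / q"
  have \<theta>: "0 < \<theta>" "\<theta> \<le> q - 1"
  proof -
    show "0 < \<theta>"
      using q by (simp add: \<theta>_def)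
    have "0 \<le> (q - 1)\<^sup>2 / q"
      using q by simp
    also have "\<dots> = (q - 1) - \<theta>"
      using q by (simp add: \<theta>_def field_simps power2_eq_square)
    finally show "\<theta> \<le> q - 1"
      by simp
  qed
  \<comment> \<open>The bound 2 gives ratio 2 along \<open>\<nu>\<close>; the bound 2 / \<theta>
    gives the required gap.\<close>
  obtain M where M: "max 2 (2 / \<theta>) < q ^ M"
    using real_arch_pow[OF q(1)] by blast
  define \<nu> where "\<nu> k = n (M * k)" for k
  have grow: "q ^ M * real (\<nu> k) \<le> real (\<nu> (Suc k))" for k
    using lacunary_growth[OF q, of M "M * k"] by (simp add: \<nu>_def add.commute)
  have "dyadic_lacunary \<nu>"
    unfolding dyadic_lacunary_def
  proof
    fix k show "freq_bound \<nu> k \<le> \<nu> k"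
    proof (cases k)
      case 0
      then show ?thesis
        using lacunary_pos[OF q(2), of 0] by (simp add: freq_bound_def \<nu>_def)
    next
      case (Suc i)
      have "2 * real (\<nu> i) \<le> q ^ M * real (\<nu> i)"
        using M by (intro mult_right_mono) auto
      then have "real (2 * \<nu> i) \<le> real (\<nu> (Suc i))"
        using grow[of i] by simp
      then show ?thesis
        by (simp only: Suc freq_bound_def nat.case of_nat_le_iff)
    qed
  qed
  moreover have "range \<nu> \<subseteq> range n"
    by (auto simp: \<nu>_def)
  moreover have "freq_bound \<nu> k \<le> xor (n j) (\<nu> k)" if ne: "n j \<noteq> \<nu> k" for j k
  proof (cases k)
    case 0
    then show ?thesis
      using ne xor_eq_0_nat[of "n j" "\<nu> k"] by (simp add: freq_bound_def)
  next
    case (Suc i)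
    have dist: "\<theta> * real (\<nu> k) \<le> \<bar>real (n j) - real (\<nu> k)\<bar>"
    proof (cases "j < M * k")
      case True
      then have "q * real (n j) \<le> real (\<nu> k)"
        using lacunary_less[OF q] by (simp add: \<nu>_def)
      then have "real (n j) \<le> real (\<nu> k) / q"
        using q by (simp add: field_simps)
      then have "\<theta> * real (\<nu> k) \<le> real (\<nu> k) - real (n j)"
        by (simp add: \<theta>_def field_simps)
      then show ?thesis
        by linarith
    next
      case False
      then have "M * k < j"
        using ne by (metis \<nu>_def linorder_neqE_nat)
      then have "q * real (\<nu> k) \<le> real (n j)"
        using lacunary_less[OF q] by (simp add: \<nu>_def)
      moreover have "\<theta> * real (\<nu> k) \<le> (q - 1) * real (\<nu> k)"
        using \<theta> by (intro mult_right_mono) auto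
      ultimately show ?thesis
        by (simp add: algebra_simps)
    qed
    have "2 * real (\<nu> i) \<le> \<theta> * q ^ M * real (\<nu> i)"
      using M \<theta>(1) by (intro mult_right_mono) (auto simp: field_simps)
    also have "\<dots> \<le> \<theta> * real (\<nu> k)"
      using grow[of i] \<theta>(1) by (simp add: Suc mult.assoc mult_left_mono)
    also note dist
    also have "\<bar>real (n j) - real (\<nu> k)\<bar> \<le> real (xor (n j) (\<nu> k))"
      using le_xor_add[of "n j" "\<nu> k"] le_xor_add[of "\<nu> k" "n j"] by (simp add: xor.commute)
    finally show ?thesis
      by (simp add: freq_bound_def Suc)
  qed
  ultimately show ?thesis
    using that by blast
qed

section \<open>Gaussian bounds for cosh and exponential moments of lacunary Walsh sums\<close>

lemma cosh_ge_one_plus: "1 + y\<^sup>2 / 2 \<le> cosh y" for y :: real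
proof -
  have *: "u \<le> sinh u" if "0 \<le> u" for u :: real
  proof -
    have "sinh 0 - 0 \<le> sinh u - u"
    proof (rule DERIV_nonneg_imp_nondecreasing[OF that])
      fix x :: real
      have "((\<lambda>x. sinh x - x) has_real_derivative cosh x - 1) (at x)"
        by (auto intro!: derivative_eq_intros)
      then show "\<exists>y. ((\<lambda>x. sinh x - x) has_real_derivative y) (at x) \<and> 0 \<le> y"
        using cosh_real_ge_1[of x] by (intro exI[of _ "cosh x - 1"]) auto
    qed
    then show ?thesis
      by simp
  qed
  have "\<bar>y / 2\<bar>\<^sup>2 \<le> (sinh \<bar>y / 2\<bar>)\<^sup>2"
    using *[of "\<bar>y / 2\<bar>"] by (intro power_mono) auto
  also have "(sinh \<bar>y / 2\<bar>)\<^sup>2 = (sinh (y / 2))\<^sup>2"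
    by (simp add: abs_if)
  finally show ?thesis
    using cosh_double[of "y / 2"] by (simp add: cosh_square_eq power_divide)
qed

text \<open>cosh grows only exponentially, so a Gaussian lower bound needs bounded y. The constant
  1/4 leaves room for the quadratic term of exp u \<le> 1 + u + u^2 at u = y^2/4.\<close>

lemma exp_le_cosh:
  fixes y :: real
  assumes "\<bar>y\<bar> \<le> 1"
  shows "exp (y\<^sup>2 / 4) \<le> cosh y"
proof -
  have y2: "y\<^sup>2 \<le> 1"
    using assms by (simp add: abs_square_le_1)
  then have "exp (y\<^sup>2 / 4) \<le> 1 + y\<^sup>2 / 4 + (y\<^sup>2 / 4)\<^sup>2"
    by (intro exp_bound) auto
  also have "(y\<^sup>2 / 4)\<^sup>2 \<le> y\<^sup>2 / 4 * 1"
    unfolding power2_eq_square[of "y\<^sup>2 / 4"] using y2 by (intro mult_left_mono) auto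
  also have "1 + y\<^sup>2 / 4 + y\<^sup>2 / 4 * 1 \<le> cosh y"
    using cosh_ge_one_plus[of y] by simp
  finally show ?thesis
    by simp
qed

lemma tanh_le_self:
  assumes "0 \<le> x"
  shows "tanh x \<le> (x :: real)"
proof -
  have "0 - tanh 0 \<le> x - tanh x"
  proof (rule DERIV_nonneg_imp_nondecreasing[OF assms])
    fix z :: real
    have "((\<lambda>x. x - tanh x) has_real_derivative 1 - (1 - tanh z ^ 2)) (at z)"
      by (auto intro!: derivative_eq_intros)
    then show "\<exists>y. ((\<lambda>x. x - tanh x) has_real_derivative y) (at z) \<and> 0 \<le> y"
      by (intro exI[of _ "1 - (1 - tanh z ^ 2)"]) auto
  qed
  then show ?thesis
    by simp
qed

text \<open>The difference y^2/2 - ln (cosh y) vanishes at 0 and has derivative y - tanh y, which is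
  nonnegative for y \<ge> 0.\<close>

lemma cosh_le_exp: "cosh y \<le> exp (y\<^sup>2 / 2)" for y :: real
proof -
  define x where "x = \<bar>y\<bar>"
  have "0 \<le> x"
    by (simp add: x_def)
  then have "0\<^sup>2 / 2 - ln (cosh 0) \<le> x\<^sup>2 / 2 - ln (cosh x)"
  proof (rule DERIV_nonneg_imp_nondecreasing)
    fix z :: real assume z: "0 \<le> z"
    have "((\<lambda>x. x\<^sup>2 / 2 - ln (cosh x)) has_real_derivative z - sinh z / cosh z) (at z)"
      by (auto intro!: derivative_eq_intros simp: cosh_real_pos)
    then show "\<exists>y. ((\<lambda>x. x\<^sup>2 / 2 - ln (cosh x)) has_real_derivative y) (at z) \<and> 0 \<le> y"
      using tanh_le_self[OF z] by (intro exI[of _ "z - sinh z / cosh z"]) (auto simp: tanh_def)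
  qed
  then have "ln (cosh x) \<le> x\<^sup>2 / 2"
    by simp
  then have "exp (ln (cosh x)) \<le> exp (x\<^sup>2 / 2)"
    by (simp only: exp_le_cancel_iff)
  then have "cosh x \<le> exp (x\<^sup>2 / 2)"
    by (simp add: cosh_real_pos)
  moreover have "cosh x = cosh y"
    by (simp add: x_def abs_if)
  ultimately show ?thesis
    by (simp add: x_def)
qed

lemma top_bit:
  fixes m :: nat
  assumes "0 < m"
  obtains a where "bit m a" "2 ^ a \<le> m" "m < 2 ^ Suc a"
proof -
  obtain a where a: "2 ^ a \<le> m" "m < 2 ^ Suc a"
    using ex_power_ivl1[of 2 m] assms by auto
  have "m div 2 ^ a = 1"
    using a by (intro div_nat_eqI) auto
  then have "bit m a"
    by (simp add: bit_iff_odd)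
  then show ?thesis
    using a that by blast
qed

context ri_space
begin

text \<open>The extra term covers a sum with its last sign reversed; d = 0 gives the plain sum and m
  = 0 a sum shifted by a constant.\<close>

lemma continuous_wcomb_integrable:
  fixes \<Phi> :: "real \<Rightarrow> real"
  assumes "continuous_on UNIV \<Phi>"
  shows "(\<lambda>x. \<Phi> (wcomb n K c x + d * wal m x)) \<in> borel_measurable I01"
    "integrable I01 (\<lambda>x. \<Phi> (wcomb n K c x + d * wal m x))"
proof -
  define B where "B = (\<Sum>k<K. \<bar>c k\<bar>) + \<bar>d\<bar>"
  have "bounded (\<Phi> ` {-B..B})"
    by (intro compact_imp_bounded compact_continuous_image) (auto intro: continuous_on_subset[OF assms])
  then obtain M where M: "\<And>y. y \<in> {-B..B} \<Longrightarrow> \<bar>\<Phi> y\<bar> \<le> M"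
    unfolding bounded_iff by (metis image_eqI real_norm_def)
  have "\<bar>wcomb n K c x + d * wal m x\<bar> \<le> B" for x
    using abs_wcomb_le[of n K c x] abs_triangle_ineq[of "wcomb n K c x" "d * wal m x"]
    by (simp add: B_def abs_mult)
  then have le: "\<bar>\<Phi> (wcomb n K c x + d * wal m x)\<bar> \<le> M" for x
    using M by (meson abs_le_D1 abs_le_D2 atLeastAtMost_iff minus_le_iff)
  have "\<Phi> \<in> borel_measurable borel"
    using assms by (rule borel_measurable_continuous_onI)
  then show m: "(\<lambda>x. \<Phi> (wcomb n K c x + d * wal m x)) \<in> borel_measurable I01"
    by (rule measurable_compose[rotated]) simp
  show "integrable I01 (\<lambda>x. \<Phi> (wcomb n K c x + d * wal m x))"
    using m le by (rule integrable_I01)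
qed

text \<open>Earlier frequencies are at most half of \<open>\<nu> K\<close>, hence below 2^a for its
  highest bit a. Flipping digit a preserves the measure, reverses the last term and fixes the
  others; this takes the place of conditioning on the earlier terms.\<close>

lemma integral_last_sign:
  fixes \<Phi> :: "real \<Rightarrow> real"
  assumes \<Phi>: "continuous_on UNIV \<Phi>" and \<nu>: "dyadic_lacunary \<nu>"
  shows "(\<integral>x. \<Phi> (wcomb \<nu> (Suc K) c x) \<partial>I01) =
    (\<integral>x. (\<Phi> (wcomb \<nu> K c x + c K) + \<Phi> (wcomb \<nu> K c x - c K)) / 2 \<partial>I01)"
proof -
  obtain a where a: "bit (\<nu> K) a" "2 ^ a \<le> \<nu> K" "\<nu> K < 2 ^ Suc a"
    using top_bit[of "\<nu> K"] dyadic_lacunary_mono[OF \<nu>, of K] by blast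
  have low: "\<not> bit (\<nu> k) a" if "k < K" for k
  proof -
    obtain K' where K': "K = Suc K'"
      using \<open>k < K\<close> by (cases K) auto
    have "\<nu> k \<le> \<nu> K'"
      using dyadic_lacunary_strict_mono[OF \<nu>] that by (simp add: strict_mono_less_eq K')
    then have "2 * \<nu> k < 2 * 2 ^ a"
      using dyadic_lacunary_mono[OF \<nu>, of K'] a(3) by (simp add: K')
    then show ?thesis
      by (intro not_bit_ge[of _ a]) auto
  qed
  define W where "W = wcomb \<nu> K c"
  define w where "w = wal (\<nu> K)"
  have split: "wcomb \<nu> (Suc K) c x = W x + c K * w x" for x
    by (simp add: wcomb_def W_def w_def)
  have fl: "W (flip a x) + c K * w (flip a x) = W x + (- c K) * w x" if x: "0 \<le> x" "x < 1" for x
  proof -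
    have "W (flip a x) = W x"
      unfolding W_def wcomb_flip[OF x] using low by (simp add: wcomb_def)
    then show ?thesis
      using a(1) by (simp add: w_def wal_flip[OF x])
  qed
  note cw = continuous_wcomb_integrable[OF \<Phi>, of \<nu> K c, folded W_def]
  note cw1 = cw[of "c K" "\<nu> K", folded w_def] and cw2 = cw[of "- c K" "\<nu> K", folded w_def]
  have "(\<integral>x. \<Phi> (W x + c K * w x) \<partial>I01) = (\<integral>x. \<Phi> (W (flip a x) + c K * w (flip a x)) \<partial>I01)"
    by (rule integral_flip[OF cw1(1), symmetric])
  also have "\<dots> = (\<integral>x. \<Phi> (W x + (- c K) * w x) \<partial>I01)"
  proof (rule integral_cong_AE)
    show "(\<lambda>x. \<Phi> (W (flip a x) + c K * w (flip a x))) \<in> borel_measurable I01"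
      by (rule measurable_comp_flip[OF cw1(1)])
    show "AE x in I01. \<Phi> (W (flip a x) + c K * w (flip a x)) = \<Phi> (W x + (- c K) * w x)"
      using AE_I01_halfopen by (rule eventually_mono) (simp only: fl)
  qed (rule cw2(1))
  finally have "(\<integral>x. \<Phi> (W x + c K * w x) \<partial>I01) =
      ((\<integral>x. \<Phi> (W x + c K * w x) \<partial>I01) + (\<integral>x. \<Phi> (W x + (- c K) * w x) \<partial>I01)) / 2"
    by simp
  also have "\<dots> = (\<integral>x. (\<Phi> (W x + c K * w x) + \<Phi> (W x + (- c K) * w x)) / 2 \<partial>I01)"
    using cw1(2) cw2(2) by simp
  also have "\<dots> = (\<integral>x. (\<Phi> (W x + c K) + \<Phi> (W x - c K)) / 2 \<partial>I01)"
  proof (intro Bochner_Integration.integral_cong refl)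
    fix x
    show "(\<Phi> (W x + c K * w x) + \<Phi> (W x + (- c K) * w x)) / 2 = (\<Phi> (W x + c K) + \<Phi> (W x - c K)) / 2"
      using wal_cases[of "\<nu> K" x] by (auto simp: w_def)
  qed
  finally show ?thesis
    by (simp only: split W_def)
qed

lemma wcomb_mgf:
  assumes \<nu>: "dyadic_lacunary \<nu>"
  shows "(\<integral>x. exp (s * wcomb \<nu> K (\<lambda>_. b) x) \<partial>I01) = cosh (s * b) ^ K"
proof (induction K)
  case 0
  then show ?case
    by (simp add: wcomb_def)
next
  case (Suc K)
  have "(\<integral>x. exp (s * wcomb \<nu> (Suc K) (\<lambda>_. b) x) \<partial>I01) =
      (\<integral>x. (exp (s * (wcomb \<nu> K (\<lambda>_. b) x + b)) + exp (s * (wcomb \<nu> K (\<lambda>_. b) x - b))) / 2 \<partial>I01)"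
    by (intro integral_last_sign[OF _ \<nu>, of "\<lambda>y. exp (s * y)"] continuous_intros)
  also have "\<dots> = (\<integral>x. cosh (s * b) * exp (s * wcomb \<nu> K (\<lambda>_. b) x) \<partial>I01)"
    by (intro Bochner_Integration.integral_cong refl)
      (simp add: cosh_field_def distrib_left right_diff_distrib exp_add exp_diff exp_minus field_simps)
  also have "\<dots> = cosh (s * b) * (\<integral>x. exp (s * wcomb \<nu> K (\<lambda>_. b) x) \<partial>I01)"
    by (rule integral_mult_right_zero)
  finally show ?case
    using Suc by simp
qed

text \<open>A Paley--Zygmund argument applied to the exponential moments.\<close>

lemma wcomb_tail_lower:
  assumes \<nu>: "dyadic_lacunary \<nu>" and M: "0 < M" and s: "3 \<le> s" "s \<le> sqrt (real M)"
  shows "exp (- (3 * s\<^sup>2 / 2)) / 4 \<le> measure I01 {x \<in> {0..1}. s / 8 \<le> wcomb \<nu> M (\<lambda>_. 1 / sqrt (real M)) x}"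
proof -
  define b where "b = 1 / sqrt (real M)"
  define S where "S = wcomb \<nu> M (\<lambda>_. b)"
  have S [measurable]: "S \<in> borel_measurable I01"
    by (simp add: S_def)
  have b: "real M * b\<^sup>2 = 1"
    using M by (simp add: b_def power_divide)
  define Z where "Z x = exp (s * S x)" for x
  define E where "E = (\<integral>x. Z x \<partial>I01)"
  have Z: "integrable I01 Z" "integrable I01 (\<lambda>x. (Z x)\<^sup>2)"
  proof -
    have "integrable I01 (\<lambda>x. exp (s * (wcomb \<nu> M (\<lambda>_. b) x + 0 * wal 0 x)))"
      by (rule continuous_wcomb_integrable(2)[of "\<lambda>y. exp (s * y)"]) (intro continuous_intros)
    then show "integrable I01 Z"
      by (simp add: Z_def[abs_def] S_def)
    have "integrable I01 (\<lambda>x. (exp (s * (wcomb \<nu> M (\<lambda>_. b) x + 0 * wal 0 x)))\<^sup>2)"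
      by (rule continuous_wcomb_integrable(2)[of "\<lambda>y. (exp (s * y))\<^sup>2"]) (intro continuous_intros)
    then show "integrable I01 (\<lambda>x. (Z x)\<^sup>2)"
      by (simp add: Z_def[abs_def] S_def)
  qed
  have E_eq: "E = cosh (s * b) ^ M"
    unfolding E_def Z_def S_def by (rule wcomb_mgf[OF \<nu>])
  \<comment> \<open>Here s \<le> sqrt M enters: it puts s b into the range where cosh has a Gaussian
    lower bound.\<close>
  have "s * b \<le> 1"
    using s M by (simp add: b_def field_simps)
  moreover have "0 \<le> s * b"
    using s by (simp add: b_def)
  ultimately have "exp ((s * b)\<^sup>2 / 4) ^ M \<le> E"
    unfolding E_eq by (intro power_mono exp_le_cosh) auto
  moreover have "exp ((s * b)\<^sup>2 / 4) ^ M = exp (s\<^sup>2 / 4 * (real M * b\<^sup>2))"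
    by (simp add: exp_of_nat_mult[symmetric] power_mult_distrib mult_ac)
  ultimately have E_ge: "exp (s\<^sup>2 / 4) \<le> E"
    by (simp add: b)
  have "(\<integral>x. (Z x)\<^sup>2 \<partial>I01) = (\<integral>x. exp ((2 * s) * wcomb \<nu> M (\<lambda>_. b) x) \<partial>I01)"
    by (intro Bochner_Integration.integral_cong refl) (simp add: Z_def S_def exp_double[symmetric] mult_ac)
  also have "\<dots> = cosh (2 * s * b) ^ M"
    by (rule wcomb_mgf[OF \<nu>])
  also have "\<dots> \<le> exp ((2 * s * b)\<^sup>2 / 2) ^ M"
    by (intro power_mono cosh_le_exp) auto
  also have "\<dots> = exp (2 * s\<^sup>2 * (real M * b\<^sup>2))"
    by (simp add: exp_of_nat_mult[symmetric] power_mult_distrib mult_ac)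
  finally have Z2: "(\<integral>x. (Z x)\<^sup>2 \<partial>I01) \<le> exp (2 * s\<^sup>2)"
    by (simp add: b)
  define A where "A = {x \<in> {0..1}. E / 2 \<le> Z x}"
  have A: "A \<in> sets I01"
  proof -
    have "{x \<in> space I01. E / 2 \<le> Z x} \<in> sets I01"
      unfolding Z_def by measurable
    then show ?thesis
      by (simp add: A_def)
  qed
  have A_int: "A \<inter> {0..1} = A"
    by (auto simp: A_def)
  have Epos: "0 < E"
    using E_ge by (rule less_le_trans[rotated]) simp
  \<comment> \<open>Young's inequality stands in for Cauchy-Schwarz: on A, Z is at most r/2 Z^2 +
    1/(2 r), and r is chosen so that the first term integrates to at most E/4. Off A, Z is at most
    E/2, so a quarter of E is left for the measure of A.\<close>
  define r where "r = E / (2 * exp (2 * s\<^sup>2))"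
  have r: "0 < r"
    using Epos by (simp add: r_def)
  have pt: "Z x \<le> E / 2 + (r / 2 * (Z x)\<^sup>2 + 1 / (2 * r) * indicat_real A x)" if "x \<in> space I01" for x
  proof (cases "x \<in> A")
    case True
    have "0 \<le> (r * Z x - 1)\<^sup>2 / (2 * r)"
      using r by simp
    also have "\<dots> = r / 2 * (Z x)\<^sup>2 + 1 / (2 * r) - Z x"
      using r by (simp add: power2_eq_square field_simps)
    finally show ?thesis
      using True Epos by simp
  next
    case False
    then have "Z x \<le> E / 2"
      using that by (simp add: A_def)
    then show ?thesis
      using False r by (simp add: add_increasing2)
  qed
  have iA: "integrable I01 (indicat_real A)"
    using A by (simp add: I01.emeasure_finite less_top[symmetric])
  have "E \<le> (\<integral>x. E / 2 + (r / 2 * (Z x)\<^sup>2 + 1 / (2 * r) * indicat_real A x) \<partial>I01)"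
    unfolding E_def[symmetric]
    by (subst E_def) (intro integral_mono Z(1) Bochner_Integration.integrable_add integrable_mult_right Z(2) iA pt I01.integrable_const)
  also have "\<dots> = E / 2 + (r / 2 * (\<integral>x. (Z x)\<^sup>2 \<partial>I01) + 1 / (2 * r) * measure I01 A)"
    using Z iA A A_int by simp
  also have "r / 2 * (\<integral>x. (Z x)\<^sup>2 \<partial>I01) \<le> r / 2 * exp (2 * s\<^sup>2)"
    using r by (intro mult_left_mono Z2) auto
  also have "r / 2 * exp (2 * s\<^sup>2) = E / 4"
    by (simp add: r_def)
  finally have "E / 4 \<le> 1 / (2 * r) * measure I01 A"
    by simp
  then have "E / 4 * (2 * r) \<le> measure I01 A"
    using r by (simp add: field_simps)
  moreover have "E / 4 * (2 * r) = E\<^sup>2 / (4 * exp (2 * s\<^sup>2))"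
    by (simp add: r_def power2_eq_square)
  moreover have "(exp (s\<^sup>2 / 4))\<^sup>2 / (4 * exp (2 * s\<^sup>2)) \<le> E\<^sup>2 / (4 * exp (2 * s\<^sup>2))"
    using E_ge by (intro divide_right_mono power_mono) auto
  moreover have "exp (- (3 * s\<^sup>2 / 2)) / 4 = (exp (s\<^sup>2 / 4))\<^sup>2 / (4 * exp (2 * s\<^sup>2))"
    by (simp add: exp_double[symmetric] exp_diff[symmetric] exp_minus field_simps flip: exp_add)
  ultimately have "exp (- (3 * s\<^sup>2 / 2)) / 4 \<le> measure I01 A"
    by linarith
  also have "measure I01 A \<le> measure I01 {x \<in> {0..1}. s / 8 \<le> S x}"
  proof (rule I01.finite_measure_mono)
    show "A \<subseteq> {x \<in> {0..1}. s / 8 \<le> S x}"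
    proof
      fix x assume x: "x \<in> A"
      then have "exp (s\<^sup>2 / 4) / 2 \<le> exp (s * S x)"
        using E_ge by (simp add: A_def Z_def)
      \<comment> \<open>For s \<ge> 3 the factor 1/2 is absorbed, since exp (s^2/8) is at least 1 +
        9/8.\<close>
      moreover have "exp (s\<^sup>2 / 8) \<le> exp (s\<^sup>2 / 4) / 2"
      proof -
        have "9 \<le> s\<^sup>2"
          using s(1) power_mono[of 3 s 2] by simp
        then have "2 \<le> exp (s\<^sup>2 / 8)"
          using exp_ge_add_one_self[of "s\<^sup>2 / 8"] by linarith
        then have "exp (s\<^sup>2 / 8) * 2 \<le> exp (s\<^sup>2 / 8) * exp (s\<^sup>2 / 8)"
          by (intro mult_left_mono) auto
        then show ?thesis
          by (simp flip: exp_add)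
      qed
      ultimately have "exp (s\<^sup>2 / 8) \<le> exp (s * S x)"
        by linarith
      then have "s * (s / 8) \<le> s * S x"
        by (simp add: power2_eq_square)
      then have "s / 8 \<le> S x"
        using s(1) by (simp only: mult_le_cancel_left_pos)
      then show "x \<in> {x \<in> {0..1}. s / 8 \<le> S x}"
        using x by (simp add: A_def)
    qed
    have "{x \<in> space I01. s / 8 \<le> S x} \<in> sets I01"
      by measurable
    then show "{x \<in> {0..1}. s / 8 \<le> S x} \<in> sets I01"
      by simp
  qed
  finally show ?thesis
    by (simp add: S_def b_def)
qed

end

section \<open>Decreasing rearrangements\<close>

definition dfun :: "(real \<Rightarrow> real) \<Rightarrow> real \<Rightarrow> real" where
  "dfun f t = measure I01 {x \<in> {0..1}. t < \<bar>f x\<bar>}"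

text \<open>The bound is named so that the supremum in \<open>rearr\<close> is a real number and the
  discretisation error in \<open>product_bound\<close> is explicit.\<close>

definition ess_bdd :: "real \<Rightarrow> (real \<Rightarrow> real) \<Rightarrow> bool" where
  "ess_bdd B f \<longleftrightarrow> f \<in> borel_measurable I01 \<and> 0 \<le> B \<and> (AE x in I01. \<bar>f x\<bar> \<le> B)"

text \<open>The decreasing rearrangement as generalised inverse of \<open>dfun\<close>. Inserting 0
  keeps the set nonempty where no level qualifies.\<close>

definition rearr :: "(real \<Rightarrow> real) \<Rightarrow> real \<Rightarrow> real" where
  "rearr f s = Sup (insert 0 {t. 0 \<le> t \<and> s < dfun f t})"

lemma superlevel_sets:
  fixes f :: "real \<Rightarrow> real"
  assumes "f \<in> borel_measurable I01"
  shows "{x \<in> {0..1}. t < \<bar>f x\<bar>} \<in> sets I01"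
proof -
  have "{x \<in> space I01. t < \<bar>f x\<bar>} \<in> sets I01"
    using borel_measurable_abs[OF assms] unfolding borel_measurable_iff_greater by blast
  then show ?thesis
    by simp
qed

lemma dfun_antimono: "f \<in> borel_measurable I01 \<Longrightarrow> s \<le> t \<Longrightarrow> dfun f t \<le> dfun f s"
  unfolding dfun_def by (intro I01.finite_measure_mono superlevel_sets) auto

lemma dfun_nonneg [simp]: "0 \<le> dfun f t"
  by (simp add: dfun_def)

lemma dfun_le_1: "dfun f t \<le> 1"
  using I01.bounded_measure[of "{x \<in> {0..1}. t < \<bar>f x\<bar>}"] by (simp add: dfun_def)

lemma dfun_zero:
  assumes "ess_bdd B f" "B \<le> t"
  shows "dfun f t = 0"
proof -
  have "AE x in I01. \<bar>f x\<bar> \<le> B"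
    using assms by (simp add: ess_bdd_def)
  then have "AE x in I01. x \<notin> {x \<in> {0..1}. t < \<bar>f x\<bar>}"
    by (rule eventually_mono) (use assms(2) in auto)
  then have "{x \<in> {0..1}. t < \<bar>f x\<bar>} \<in> null_sets I01"
    using assms(1) AE_iff_null_sets[OF superlevel_sets[of f t]] by (simp add: ess_bdd_def)
  then show ?thesis
    by (simp add: dfun_def measure_def null_setsD1 del: Collect_conj_eq)
qed

text \<open>The superlevel sets at t + 1/(n+1) increase to the one at t. This is what makes
  \<open>less_rearr_iff\<close> hold with strict inequalities.\<close>

lemma dfun_right_continuous:
  assumes f: "f \<in> borel_measurable I01" and s: "s < dfun f t"
  shows "\<exists>t'>t. s < dfun f t'"
proof -
  define A where "A n = {x \<in> {0..1}. t + 1 / real (Suc n) < \<bar>f x\<bar>}" for n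
  have "range A \<subseteq> sets I01"
    using superlevel_sets[OF f] by (auto simp: A_def)
  moreover have "incseq A"
  proof (rule incseq_SucI)
    fix n
    have "1 / real (Suc (Suc n)) \<le> 1 / real (Suc n)"
      by (intro divide_left_mono) auto
    then show "A n \<subseteq> A (Suc n)"
      by (auto simp: A_def)
  qed
  moreover have "(\<Union>n. A n) = {x \<in> {0..1}. t < \<bar>f x\<bar>}"
  proof -
    have "\<exists>n. t + 1 / real (Suc n) < \<bar>f x\<bar>" if "t < \<bar>f x\<bar>" for x
      using reals_Archimedean[of "\<bar>f x\<bar> - t"] that by (auto simp: inverse_eq_divide algebra_simps)
    moreover have "t < \<bar>f x\<bar>" if "t + 1 / real (Suc n) < \<bar>f x\<bar>" for n x
    proof -
      have "0 < 1 / real (Suc n)"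
        by simp
      then show ?thesis
        using that by linarith
    qed
    ultimately show ?thesis
      unfolding A_def by blast
  qed
  ultimately have "(\<lambda>n. measure I01 (A n)) \<longlonglongrightarrow> dfun f t"
    using I01.finite_Lim_measure_incseq[of A] by (simp add: dfun_def)
  then have "eventually (\<lambda>n. s < measure I01 (A n)) sequentially"
    using s by (rule order_tendstoD)
  then obtain n where "s < measure I01 (A n)"
    by (auto simp: eventually_sequentially)
  then show ?thesis
    by (intro exI[of _ "t + 1 / real (Suc n)"]) (simp add: A_def dfun_def)
qed

lemma rearr_bdd:
  assumes "ess_bdd B f" "0 \<le> s"
  shows "\<And>t. t \<in> insert 0 {t. 0 \<le> t \<and> s < dfun f t} \<Longrightarrow> t \<le> B"
proof -
  fix t assume "t \<in> insert 0 {t. 0 \<le> t \<and> s < dfun f t}"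
  then show "t \<le> B"
    using assms dfun_zero[OF assms(1), of t] by (cases "B \<le> t") (auto simp: ess_bdd_def)
qed

text \<open>With strict inequalities on both sides, the superlevel set of \<open>rearr f\<close> at
  t is the initial interval of length \<open>dfun f t\<close>; measurability and equimeasurability
  follow from this.\<close>

lemma less_rearr_iff:
  assumes "ess_bdd B f" "0 \<le> s" "0 \<le> t"
  shows "t < rearr f s \<longleftrightarrow> s < dfun f t"
proof -
  have f: "f \<in> borel_measurable I01"
    using assms by (simp add: ess_bdd_def)
  have "bdd_above (insert 0 {t. 0 \<le> t \<and> s < dfun f t})"
    using rearr_bdd[OF assms(1,2)] by (rule bdd_aboveI)
  then have "t < rearr f s \<longleftrightarrow> (\<exists>t'\<in>insert 0 {t. 0 \<le> t \<and> s < dfun f t}. t < t')"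
    unfolding rearr_def by (intro less_cSup_iff) auto
  also have "\<dots> \<longleftrightarrow> s < dfun f t"
  proof
    assume "\<exists>t'\<in>insert 0 {t. 0 \<le> t \<and> s < dfun f t}. t < t'"
    then obtain t' where "s < dfun f t'" "t < t'"
      using assms(3) by auto
    then show "s < dfun f t"
      using dfun_antimono[OF f, of t t'] by simp
  next
    assume "s < dfun f t"
    then obtain t' where "t' > t" "s < dfun f t'"
      using dfun_right_continuous[OF f] by blast
    then show "\<exists>t'\<in>insert 0 {t. 0 \<le> t \<and> s < dfun f t}. t < t'"
      using assms(3) by (intro bexI[of _ t']) auto
  qed
  finally show ?thesis .
qed

lemma rearr_range:
  assumes "ess_bdd B f" "0 \<le> s"
  shows "0 \<le> rearr f s" "rearr f s \<le> B"
proof -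
  have "bdd_above (insert 0 {t. 0 \<le> t \<and> s < dfun f t})"
    using rearr_bdd[OF assms] by (rule bdd_aboveI)
  then show "0 \<le> rearr f s"
    unfolding rearr_def by (intro cSup_upper) auto
  show "rearr f s \<le> B"
    unfolding rearr_def using rearr_bdd[OF assms] by (intro cSup_least) auto
qed

lemma le_by_less:
  fixes a b :: real
  assumes "0 \<le> b" "\<And>t. 0 \<le> t \<Longrightarrow> t < a \<Longrightarrow> t < b"
  shows "a \<le> b"
proof (rule ccontr)
  assume "\<not> a \<le> b"
  then show False
    using assms(2)[of b] assms(1) by simp
qed

lemma rearr_antimono:
  assumes "ess_bdd B f" "0 \<le> s" "s \<le> s'"
  shows "rearr f s' \<le> rearr f s"
proof (rule le_by_less)
  show "0 \<le> rearr f s"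
    using rearr_range[OF assms(1,2)] by simp
  fix t assume "0 \<le> t" "t < rearr f s'"
  then show "t < rearr f s"
    using assms less_rearr_iff[OF assms(1)] by auto
qed

lemma rearr_measurable:
  assumes "ess_bdd B f"
  shows "rearr f \<in> borel_measurable I01"
proof (rule borel_measurableI_greater)
  fix t
  show "{s \<in> space I01. t < rearr f s} \<in> sets I01"
  proof (cases "0 \<le> t")
    case True
    have "{s \<in> space I01. t < rearr f s} = {s \<in> space I01. s < dfun f t}"
      using True less_rearr_iff[OF assms] by auto
    also have "\<dots> \<in> sets I01"
    proof -
      have "(\<lambda>s. s) \<in> borel_measurable I01"
        by (rule borel_measurable_I01) simp
      then show ?thesis
        by measurable
    qed
    finally show ?thesis .
  next
    case False
    then have "{s \<in> space I01. t < rearr f s} = space I01"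
      using rearr_range(1)[OF assms] by (force simp del: space_lebesgue_on simp: space_I01)
    then show ?thesis
      by (simp only: sets.top)
  qed
qed

lemma measure_I01_initial:
  assumes "0 \<le> m" "m \<le> 1"
  shows "measure I01 {x \<in> {0..1}. x < m} = m"
proof -
  have "{x \<in> {0..1}. x < m} = {0..<m}"
    using assms by auto
  moreover have "measure I01 {0..<m} = measure lebesgue {0..<m}"
    using assms by (intro measure_restrict_space) auto
  moreover have "measure lebesgue {0..<m} = measure lborel {0..<m}"
    by (rule measure_completion) simp
  ultimately show ?thesis
    using assms by simp
qed

lemma dfun_rearr:
  assumes "ess_bdd B f" "0 \<le> t"
  shows "dfun (rearr f) t = dfun f t"
proof -
  have "{x \<in> {0..1}. t < \<bar>rearr f x\<bar>} = {x \<in> {0..1}. x < dfun f t}"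
  proof (rule Collect_cong, rule conj_cong[OF refl])
    fix x :: real assume "x \<in> {0..1}"
    then have x: "0 \<le> x"
      by simp
    then show "t < \<bar>rearr f x\<bar> \<longleftrightarrow> x < dfun f t"
      using rearr_range(1)[OF assms(1) x] less_rearr_iff[OF assms(1) x assms(2)] by simp
  qed
  then show ?thesis
    using measure_I01_initial[of "dfun f t"] dfun_le_1 by (simp add: dfun_def[of "rearr f"])
qed

lemma equimeasurableI:
  assumes "\<And>t. 0 \<le> t \<Longrightarrow> dfun f t = dfun g t"
  shows "equimeasurable f g"
  unfolding equimeasurable_def
proof
  fix t
  show "emeasure I01 {x \<in> space I01. t < \<bar>f x\<bar>} = emeasure I01 {x \<in> space I01. t < \<bar>g x\<bar>}"
  proof (cases "0 \<le> t")
    case True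
    then show ?thesis
      using assms[of t] by (simp add: I01.emeasure_eq_measure dfun_def)
  next
    case False
    then have "t < \<bar>f x\<bar>" "t < \<bar>g x\<bar>" for x
      using abs_ge_zero[of "f x"] abs_ge_zero[of "g x"] by linarith+
    then show ?thesis
      by simp
  qed
qed

text \<open>Each factor is the integral of its level indicators; after exchanging integrals, the
  product enters only through measures of intersections of level sets.\<close>

lemma layer_cake_product:
  assumes u [measurable]: "u \<in> borel_measurable I01" and v [measurable]: "v \<in> borel_measurable I01"
  shows "(\<integral>\<^sup>+x. ennreal \<bar>u x\<bar> * ennreal \<bar>v x\<bar> \<partial>I01) =
    (\<integral>\<^sup>+s. \<integral>\<^sup>+t. (if 0 \<le> s \<and> 0 \<le> t then ennreal (measure I01 {x \<in> {0..1}. s < \<bar>u x\<bar> \<and> t < \<bar>v x\<bar>}) else 0)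
      \<partial>lborel \<partial>lborel)"
proof -
  define lev where "lev s y = (if 0 \<le> s \<and> s < y then 1 else 0 :: ennreal)" for s y :: real
  interpret P: pair_sigma_finite I01 lborel
    by (intro pair_sigma_finite.intro I01.sigma_finite_measure_axioms sigma_finite_lborel)
  have lev: "(\<integral>\<^sup>+s. lev s y \<partial>lborel) = ennreal y" if "0 \<le> y" for y
  proof -
    have "(\<integral>\<^sup>+s. lev s y \<partial>lborel) = (\<integral>\<^sup>+s. indicator {0..<y} s \<partial>lborel)"
      by (intro nn_integral_cong) (auto simp: lev_def indicator_def)
    then show ?thesis
      using that by simp
  qed
  have [measurable]: "(\<lambda>s. lev s y) \<in> borel_measurable lborel" for y
    unfolding lev_def by measurable
  have [measurable]: "(\<lambda>x. lev s \<bar>u x\<bar>) \<in> borel_measurable I01" "(\<lambda>x. lev s \<bar>v x\<bar>) \<in> borel_measurable I01" for s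
    unfolding lev_def by measurable
  have m1: "(\<lambda>(x, s). lev s \<bar>u x\<bar> * ennreal \<bar>v x\<bar>) \<in> borel_measurable (I01 \<Otimes>\<^sub>M lborel)"
    unfolding lev_def by measurable
  have m2: "(\<lambda>(x, t). lev s \<bar>u x\<bar> * lev t \<bar>v x\<bar>) \<in> borel_measurable (I01 \<Otimes>\<^sub>M lborel)" for s
    unfolding lev_def by measurable
  have "(\<integral>\<^sup>+x. ennreal \<bar>u x\<bar> * ennreal \<bar>v x\<bar> \<partial>I01) = (\<integral>\<^sup>+x. \<integral>\<^sup>+s. lev s \<bar>u x\<bar> * ennreal \<bar>v x\<bar> \<partial>lborel \<partial>I01)"
    by (intro nn_integral_cong) (simp add: nn_integral_multc lev)
  also have "\<dots> = (\<integral>\<^sup>+s. \<integral>\<^sup>+x. lev s \<bar>u x\<bar> * ennreal \<bar>v x\<bar> \<partial>I01 \<partial>lborel)"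
    by (rule P.Fubini'[OF m1, symmetric])
  also have "\<dots> = (\<integral>\<^sup>+s. \<integral>\<^sup>+x. \<integral>\<^sup>+t. lev s \<bar>u x\<bar> * lev t \<bar>v x\<bar> \<partial>lborel \<partial>I01 \<partial>lborel)"
    by (intro nn_integral_cong) (simp add: nn_integral_cmult lev)
  also have "\<dots> = (\<integral>\<^sup>+s. \<integral>\<^sup>+t. \<integral>\<^sup>+x. lev s \<bar>u x\<bar> * lev t \<bar>v x\<bar> \<partial>I01 \<partial>lborel \<partial>lborel)"
    by (intro nn_integral_cong P.Fubini'[OF m2, symmetric])
  also have "\<dots> = (\<integral>\<^sup>+s. \<integral>\<^sup>+t. (if 0 \<le> s \<and> 0 \<le> t then ennreal (measure I01 {x \<in> {0..1}. s < \<bar>u x\<bar> \<and> t < \<bar>v x\<bar>}) else 0)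
      \<partial>lborel \<partial>lborel)"
  proof (intro nn_integral_cong)
    fix s t :: real
    show "(\<integral>\<^sup>+x. lev s \<bar>u x\<bar> * lev t \<bar>v x\<bar> \<partial>I01) =
      (if 0 \<le> s \<and> 0 \<le> t then ennreal (measure I01 {x \<in> {0..1}. s < \<bar>u x\<bar> \<and> t < \<bar>v x\<bar>}) else 0)"
    proof (cases "0 \<le> s \<and> 0 \<le> t")
      case True
      have S: "{x \<in> space I01. s < \<bar>u x\<bar> \<and> t < \<bar>v x\<bar>} \<in> sets I01"
        by measurable
      have "(\<integral>\<^sup>+x. lev s \<bar>u x\<bar> * lev t \<bar>v x\<bar> \<partial>I01) = (\<integral>\<^sup>+x. indicator {x \<in> space I01. s < \<bar>u x\<bar> \<and> t < \<bar>v x\<bar>} x \<partial>I01)"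
        using True by (intro nn_integral_cong) (auto simp: lev_def indicator_def)
      also have "\<dots> = emeasure I01 {x \<in> space I01. s < \<bar>u x\<bar> \<and> t < \<bar>v x\<bar>}"
        by (rule nn_integral_indicator[OF S])
      finally show ?thesis
        using True by (simp add: I01.emeasure_eq_measure)
    next
      case False
      then have "lev s \<bar>u x\<bar> * lev t \<bar>v x\<bar> = 0" for x
        by (auto simp: lev_def)
      then have "(\<integral>\<^sup>+x. lev s \<bar>u x\<bar> * lev t \<bar>v x\<bar> \<partial>I01) = 0"
        by (simp only: nn_integral_const mult_zero_left)
      then show ?thesis
        using False by auto
    qed
  qed
  finally show ?thesis .
qed

text \<open>An intersection has at most the smaller of the two measures. For rearrangements the
  level sets are nested initial intervals, and equality holds.\<close>

lemma Hardy_Littlewood: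
  assumes f: "ess_bdd B f" and h: "ess_bdd B' h"
  shows "(\<integral>\<^sup>+x. ennreal \<bar>f x\<bar> * ennreal \<bar>h x\<bar> \<partial>I01) \<le> (\<integral>\<^sup>+x. ennreal \<bar>rearr f x\<bar> * ennreal \<bar>rearr h x\<bar> \<partial>I01)"
proof -
  have m: "f \<in> borel_measurable I01" "h \<in> borel_measurable I01"
    using f h by (auto simp: ess_bdd_def)
  have "measure I01 {x \<in> {0..1}. s < \<bar>f x\<bar> \<and> t < \<bar>h x\<bar>} \<le>
      measure I01 {x \<in> {0..1}. s < \<bar>rearr f x\<bar> \<and> t < \<bar>rearr h x\<bar>}" if st: "0 \<le> s" "0 \<le> t" for s t
  proof -
    have "measure I01 {x \<in> {0..1}. s < \<bar>f x\<bar> \<and> t < \<bar>h x\<bar>} \<le> dfun f s"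
      unfolding dfun_def by (intro I01.finite_measure_mono superlevel_sets m) auto
    moreover have "measure I01 {x \<in> {0..1}. s < \<bar>f x\<bar> \<and> t < \<bar>h x\<bar>} \<le> dfun h t"
      unfolding dfun_def by (intro I01.finite_measure_mono superlevel_sets m) auto
    moreover have "{x \<in> {0..1}. s < \<bar>rearr f x\<bar> \<and> t < \<bar>rearr h x\<bar>} = {x \<in> {0..1}. x < min (dfun f s) (dfun h t)}"
      proof (rule Collect_cong, rule conj_cong[OF refl])
      fix x :: real assume "x \<in> {0..1}"
      then have x: "0 \<le> x"
        by simp
      then show "s < \<bar>rearr f x\<bar> \<and> t < \<bar>rearr h x\<bar> \<longleftrightarrow> x < min (dfun f s) (dfun h t)"
        using rearr_range(1)[OF f x] less_rearr_iff[OF f x st(1)] rearr_range(1)[OF h x] less_rearr_iff[OF h x st(2)]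
        by simp
    qed
    moreover have "measure I01 {x \<in> {0..1}. x < min (dfun f s) (dfun h t)} = min (dfun f s) (dfun h t)"
      by (intro measure_I01_initial) (auto simp: dfun_le_1 min_le_iff_disj)
    ultimately show ?thesis
      by simp
  qed
  then show ?thesis
    unfolding layer_cake_product[OF m] layer_cake_product[OF rearr_measurable[OF f] rearr_measurable[OF h]]
    by (intro nn_integral_mono) (auto intro!: ennreal_leI)
qed

context ri_space
begin

lemma N_rearr:
  assumes "ess_bdd B f"
  shows "N (rearr f) = N f"
proof (rule N_equimeasurable)
  show "equimeasurable (rearr f) f"
    by (intro equimeasurableI dfun_rearr[OF assms])
qed (use assms rearr_measurable in \<open>auto simp: ess_bdd_def\<close>)

text \<open>Domination of distributions becomes pointwise domination of the rearrangements, where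
  monotonicity of the norm applies.\<close>

lemma N_dominated:
  assumes f: "ess_bdd B f" and g: "ess_bdd B' g" and le: "\<And>t. 0 \<le> t \<Longrightarrow> dfun f t \<le> dfun g t"
  shows "N f \<le> N g"
proof -
  have "rearr f s \<le> rearr g s" if "0 \<le> s" for s
  proof (rule le_by_less)
    show "0 \<le> rearr g s"
      using rearr_range[OF g that] by simp
    fix t assume t: "0 \<le> t" "t < rearr f s"
    then have "s < dfun f t"
      using less_rearr_iff[OF f that] by simp
    also have "\<dots> \<le> dfun g t"
      using t by (intro le)
    finally show "t < rearr g s"
      using less_rearr_iff[OF g that] t by simp
  qed
  then have "AE x in I01. \<bar>rearr f x\<bar> \<le> \<bar>rearr g x\<bar>"
    using rearr_range(1)[OF f] by (intro AE_I2) force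
  then have "N (rearr f) \<le> N (rearr g)"
    by (intro N_mono rearr_measurable[OF f] rearr_measurable[OF g])
  then show ?thesis
    by (simp add: N_rearr[OF f] N_rearr[OF g])
qed

end

section \<open>Averages over dyadic cells and sorting\<close>

lemma integral_cells:
  fixes v :: "nat \<Rightarrow> real"
  shows "(\<lambda>x. v (nat \<lfloor>2 ^ L * x\<rfloor>)) \<in> borel_measurable I01"
    and "(\<integral>x. v (nat \<lfloor>2 ^ L * x\<rfloor>) \<partial>I01) = (\<Sum>i<2 ^ L. v i) / 2 ^ L"
proof -
  define c where "c i = {real i / 2 ^ L..<(real i + 1) / 2 ^ L}" for i
  show m: "(\<lambda>x. v (nat \<lfloor>2 ^ L * x\<rfloor>)) \<in> borel_measurable I01"
    by (rule borel_measurable_I01) measurable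
  have c: "i < 2 ^ L \<Longrightarrow> c i \<subseteq> {0..1}" for i
  proof -
    assume "i < 2 ^ L"
    then have "real i + 1 \<le> 2 ^ L"
      by (metis Suc_leI of_nat_Suc of_nat_le_iff of_nat_numeral of_nat_power add.commute)
    then have "(real i + 1) / 2 ^ L \<le> 1"
      by simp
    moreover have "0 \<le> real i / 2 ^ L"
      by simp
    ultimately show "c i \<subseteq> {0..1}"
      unfolding c_def by (intro subsetI) (unfold atLeastLessThan_iff atLeastAtMost_iff, linarith)
  qed
  have cs: "c i \<in> sets I01" "measure I01 (c i) = 1 / 2 ^ L" if "i < 2 ^ L" for i
  proof -
    have "c i \<in> sets lebesgue"
      by (simp add: c_def)
    then show "c i \<in> sets I01"
      using c[OF that] by (simp add: sets_restrict_space_iff)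
    have "measure I01 (c i) = measure lebesgue (c i)"
      using c[OF that] by (intro measure_restrict_space) auto
    also have "\<dots> = (real i + 1) / 2 ^ L - real i / 2 ^ L"
      unfolding c_def by (subst measure_completion) (auto simp: divide_right_mono)
    also have "\<dots> = 1 / 2 ^ L"
      by (simp add: diff_divide_distrib[symmetric])
    finally show "measure I01 (c i) = 1 / 2 ^ L" .
  qed
  have mem: "x \<in> c i \<longleftrightarrow> i = nat \<lfloor>2 ^ L * x\<rfloor>" if "0 \<le> x" for x i
  proof -
    have "x \<in> c i \<longleftrightarrow> real i \<le> 2 ^ L * x \<and> 2 ^ L * x < real i + 1"
      by (auto simp: c_def field_simps)
    also have "\<dots> \<longleftrightarrow> \<lfloor>2 ^ L * x\<rfloor> = int i"
      by (simp add: floor_eq_iff)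
    also have "\<dots> \<longleftrightarrow> i = nat \<lfloor>2 ^ L * x\<rfloor>"
      using that by auto
    finally show ?thesis .
  qed
  have "(\<integral>x. v (nat \<lfloor>2 ^ L * x\<rfloor>) \<partial>I01) = (\<integral>x. (\<Sum>i<2 ^ L. v i * indicat_real (c i) x) \<partial>I01)"
  proof (rule integral_cong_AE[OF m])
    show "AE x in I01. v (nat \<lfloor>2 ^ L * x\<rfloor>) = (\<Sum>i<2 ^ L. v i * indicat_real (c i) x)"
      using AE_I01_halfopen
    proof (rule eventually_mono)
      fix x :: real assume x: "0 \<le> x \<and> x < 1"
      then have "2 ^ L * x < 2 ^ L * 1"
        by (intro mult_strict_left_mono) auto
      then have i: "nat \<lfloor>2 ^ L * x\<rfloor> < 2 ^ L"
        using x by (simp add: nat_less_iff floor_less_iff)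
      have "(\<Sum>i<2 ^ L. v i * indicat_real (c i) x) = (\<Sum>i<2 ^ L. if i = nat \<lfloor>2 ^ L * x\<rfloor> then v i else 0)"
        using x by (intro sum.cong) (auto simp: mem indicator_def)
      then show "v (nat \<lfloor>2 ^ L * x\<rfloor>) = (\<Sum>i<2 ^ L. v i * indicat_real (c i) x)"
        using i by simp
    qed
    show "(\<lambda>x. \<Sum>i<2 ^ L. v i * indicat_real (c i) x) \<in> borel_measurable I01"
      using cs by (intro borel_measurable_sum borel_measurable_times) auto
  qed
  also have "\<dots> = (\<Sum>i<2 ^ L. v i * measure I01 (c i))"
  proof (subst Bochner_Integration.integral_sum)
    fix i :: nat assume "i \<in> {..<2 ^ L}"
    then show "integrable I01 (\<lambda>x. v i * indicat_real (c i) x)"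
      using cs(1)[of i] by (intro integrable_mult_right) (simp add: I01.emeasure_finite less_top[symmetric])
  next
    show "(\<Sum>i<2 ^ L. \<integral>x. v i * indicat_real (c i) x \<partial>I01) = (\<Sum>i<2 ^ L. v i * measure I01 (c i))"
      using c by (intro sum.cong) (auto simp: Int_absorb2)
  qed
  also have "\<dots> = (\<Sum>i<2 ^ L. v i) / 2 ^ L"
    by (simp add: cs sum_divide_distrib)
  finally show "(\<integral>x. v (nat \<lfloor>2 ^ L * x\<rfloor>) \<partial>I01) = (\<Sum>i<2 ^ L. v i) / 2 ^ L" .
qed

lemma dfun_cells: "dfun (\<lambda>x. v (nat \<lfloor>2 ^ L * x\<rfloor>)) t = real (card {i. i < 2 ^ L \<and> t < \<bar>v i\<bar>}) / 2 ^ L"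
proof -
  define A where "A = {x :: real. x \<in> {0..1} \<and> t < \<bar>v (nat \<lfloor>2 ^ L * x\<rfloor>)\<bar>}"
  have "A \<inter> space I01 = A"
    by (auto simp: A_def)
  then have "dfun (\<lambda>x. v (nat \<lfloor>2 ^ L * x\<rfloor>)) t = (\<integral>x. indicat_real A x \<partial>I01)"
    by (simp add: dfun_def A_def)
  also have "\<dots> = (\<integral>x. (\<lambda>i. if t < \<bar>v i\<bar> then 1 else 0 :: real) (nat \<lfloor>2 ^ L * x\<rfloor>) \<partial>I01)"
    by (intro Bochner_Integration.integral_cong) (auto simp: A_def)
  also have "\<dots> = (\<Sum>i<2 ^ L. if t < \<bar>v i\<bar> then 1 else 0) / 2 ^ L"
    by (rule integral_cells(2))
  also have "(\<Sum>i<2 ^ L. if t < \<bar>v i\<bar> then 1 else 0 :: real) = real (card {i. i < 2 ^ L \<and> t < \<bar>v i\<bar>})"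
    by (subst sum.If_cases) (auto simp: Int_def)
  finally show ?thesis .
qed

lemma sorting_permutation:
  fixes g :: "nat \<Rightarrow> real"
  obtains \<pi> where "bij_betw \<pi> {..<m} {..<m}" "\<And>i j. i \<le> j \<Longrightarrow> j < m \<Longrightarrow> g (\<pi> j) \<le> g (\<pi> i)"
proof -
  define xs where "xs = sort_key (\<lambda>i. - g i) [0..<m]"
  have xs: "length xs = m" "distinct xs" "set xs = {..<m}" "sorted (map (\<lambda>i. - g i) xs)"
    by (auto simp: xs_def)
  have "bij_betw (\<lambda>i. xs ! i) {..<m} {..<m}"
    using xs by (intro bij_betw_nth) auto
  moreover have "g (xs ! j) \<le> g (xs ! i)" if "i \<le> j" "j < m" for i j
    using sorted_nth_mono[OF xs(4), of i j] that xs(1) by simp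
  ultimately show ?thesis
    using that by blast
qed

section \<open>From complementation to the embeddings\<close>

lemma step_mono:
  assumes "step L u" "L \<le> L'"
  shows "step L' u"
proof -
  obtain v where v: "\<And>t. 0 \<le> t \<Longrightarrow> t < 1 \<Longrightarrow> u t = v (nat \<lfloor>2 ^ L * t\<rfloor>)"
    using assms(1) unfolding step_def by blast
  have "nat \<lfloor>2 ^ L * t\<rfloor> = nat \<lfloor>2 ^ L' * t\<rfloor> div 2 ^ (L' - L)" if "0 \<le> t" for t :: real
    using floor_dig_div[OF assms(2), of t] that by (simp add: nat_div_distrib nat_power_eq)
  then show ?thesis
    unfolding step_def using v by (intro exI[of _ "\<lambda>j. v (j div 2 ^ (L' - L))"]) simp
qed

lemma dfun_cong_AE:
  assumes "f \<in> borel_measurable I01" "g \<in> borel_measurable I01" "AE x in I01. f x = g x"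
  shows "dfun f t = dfun g t"
  unfolding dfun_def
proof (rule measure_eq_AE[OF _ superlevel_sets[OF assms(1)] superlevel_sets[OF assms(2)]])
  show "AE x in I01. x \<in> {x \<in> {0..1}. t < \<bar>f x\<bar>} \<longleftrightarrow> x \<in> {x \<in> {0..1}. t < \<bar>g x\<bar>}"
    using assms(3) by (rule eventually_mono) simp
qed

lemma cell_index:
  fixes t :: real
  assumes "0 \<le> t" "t < 1"
  shows "nat \<lfloor>2 ^ L * t\<rfloor> < 2 ^ L" "real (nat \<lfloor>2 ^ L * t\<rfloor>) / 2 ^ L \<le> t" "t < (real (nat \<lfloor>2 ^ L * t\<rfloor>) + 1) / 2 ^ L"
proof -
  have "2 ^ L * t < 2 ^ L * 1"
    using assms by (intro mult_strict_left_mono) auto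
  then show "nat \<lfloor>2 ^ L * t\<rfloor> < 2 ^ L"
    using assms by (simp add: nat_less_iff floor_less_iff)
  have r: "real (nat \<lfloor>2 ^ L * t\<rfloor>) = of_int \<lfloor>2 ^ L * t\<rfloor>"
    using assms by simp
  show "real (nat \<lfloor>2 ^ L * t\<rfloor>) / 2 ^ L \<le> t"
    unfolding r by (simp add: field_simps)
  have "2 ^ L * t < of_int \<lfloor>2 ^ L * t\<rfloor> + 1"
    by linarith
  then show "t < (real (nat \<lfloor>2 ^ L * t\<rfloor>) + 1) / 2 ^ L"
    unfolding r by (simp add: field_simps)
qed

context ri_space
begin

text \<open>The hypothesis controls integrals against g itself, not against its rearrangement. So
  after Hardy-Littlewood the values of the rearranged h are placed on cells in the order in which g
  decreases; the result is a step function whose distribution is below that of h. The discretisation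
  error vanishes as the level grows.\<close>

lemma product_bound:
  assumes f: "ess_bdd Bf f" and h: "ess_bdd Bh h"
    and g: "step L g" "g \<in> borel_measurable I01" "\<And>t. 0 \<le> g t"
    and dom: "\<And>t. 0 \<le> t \<Longrightarrow> dfun f t \<le> dfun g t"
    and A: "0 \<le> A" "\<And>L' u. L \<le> L' \<Longrightarrow> step L' u \<Longrightarrow> inX N u \<Longrightarrow> (\<integral>x. u x * g x \<partial>I01) \<le> A * nrm u"
  shows "(\<integral>\<^sup>+x. ennreal \<bar>f x\<bar> * ennreal \<bar>h x\<bar> \<partial>I01) \<le> ennreal (A * nrm h)"
proof -
  have B: "0 \<le> Bf" "0 \<le> Bh"
    using f h by (auto simp: ess_bdd_def)
  have hX: "inX N h"
    using h inX_bounded_AE(1)[of h Bh] by (auto simp: ess_bdd_def)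
  have fh: "(\<lambda>x. rearr f x * rearr h x) \<in> borel_measurable I01"
    by (intro borel_measurable_times rearr_measurable[OF f] rearr_measurable[OF h])
  have fh_int: "integrable I01 (\<lambda>x. rearr f x * rearr h x)"
  proof (rule integrable_I01[OF fh, of "Bf * Bh"])
    fix x :: real assume "x \<in> {0..1}"
    then have "0 \<le> x"
      by simp
    then show "\<bar>rearr f x * rearr h x\<bar> \<le> Bf * Bh"
      using rearr_range[OF f] rearr_range[OF h] B by (auto simp: abs_mult intro!: mult_mono)
  qed
  have main: "(\<integral>x. rearr f x * rearr h x \<partial>I01) \<le> A * nrm h + (Bf * Bh) / 2 ^ L'" if L': "L \<le> L'" for L'
  proof -
    define m :: nat where "m = 2 ^ L'"
    define k where "k t = nat \<lfloor>2 ^ L' * t\<rfloor>" for t :: real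
    have k: "k t < m" "real (k t) / 2 ^ L' \<le> t" "t < (real (k t) + 1) / 2 ^ L'" if "0 \<le> t" "t < 1" for t
      using cell_index[OF that, of L'] by (simp_all add: k_def m_def)
    obtain v where v: "\<And>t. 0 \<le> t \<Longrightarrow> t < 1 \<Longrightarrow> g t = v (k t)"
      using step_mono[OF g(1) L'] unfolding step_def k_def by blast
    have v0: "0 \<le> v i" if "i < m" for i
    proof -
      have i: "real i < 2 ^ L'"
        using that unfolding m_def by (metis of_nat_less_iff of_nat_numeral of_nat_power)
      have "k (real i / 2 ^ L') = i"
        by (simp add: k_def)
      then have "v i = g (real i / 2 ^ L')"
        using v[of "real i / 2 ^ L'"] i by simp
      then show ?thesis
        using g(3) by simp
    qed
    obtain \<pi> where \<pi>: "bij_betw \<pi> {..<m} {..<m}" "\<And>i j. i \<le> j \<Longrightarrow> j < m \<Longrightarrow> v (\<pi> j) \<le> v (\<pi> i)"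
      using sorting_permutation[of m v] by blast
    have \<pi>m: "\<pi> i < m" if "i < m" for i
      using bij_betwE[OF \<pi>(1)] that by auto
    have AEg: "AE x in I01. g x = v (k x)"
      using AE_I01_halfopen by (rule eventually_mono) (simp add: v)
    have cells: "(\<lambda>x. w (k x)) \<in> borel_measurable I01" "(\<integral>x. w (k x) \<partial>I01) = (\<Sum>i<m. w i) / 2 ^ L'"
        "dfun (\<lambda>x. w (k x)) t = real (card {i. i < m \<and> t < \<bar>w i\<bar>}) / 2 ^ L'" for w :: "nat \<Rightarrow> real" and t
      using integral_cells[of w L'] dfun_cells[of w L' t] by (simp_all add: k_def m_def)
    have dg: "dfun g y = real (card {i. i < m \<and> y < \<bar>v i\<bar>}) / 2 ^ L'" for y
      using dfun_cong_AE[OF g(2) cells(1) AEg, of y] by (simp only: cells(3))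
    \<comment> \<open>At the height y of the cell ranked i, g exceeds y on at most i cells, so f
      exceeds y on measure at most i / 2^L', which is at most t.\<close>
    have rf: "rearr f t \<le> v (\<pi> (k t))" if t: "0 \<le> t" "t < 1" for t
    proof (rule ccontr)
      define i where "i = k t"
      define y where "y = v (\<pi> i)"
      have i: "i < m" "real i / 2 ^ L' \<le> t"
        using k[OF t] by (simp_all add: i_def)
      assume "\<not> rearr f t \<le> v (\<pi> (k t))"
      then have "y < rearr f t"
        by (simp add: y_def i_def)
      moreover have y0: "0 \<le> y"
        unfolding y_def by (intro v0 \<pi>m i)
      ultimately have "t < dfun f y"
        using less_rearr_iff[OF f t(1)] by simp
      also have "\<dots> \<le> dfun g y"
        by (rule dom[OF y0])
      also have "\<dots> \<le> real i / 2 ^ L'"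
      proof -
        have "{j. j < m \<and> y < \<bar>v j\<bar>} \<subseteq> \<pi> ` {..<i}"
        proof
          fix j assume j: "j \<in> {j. j < m \<and> y < \<bar>v j\<bar>}"
          then have "j \<in> \<pi> ` {..<m}"
            using bij_betw_imp_surj_on[OF \<pi>(1)] by auto
          then obtain j' where j': "j' < m" "j = \<pi> j'"
            by auto
          have "\<not> i \<le> j'"
            using \<pi>(2)[of i j'] j' j v0[of j] by (auto simp: y_def)
          then show "j \<in> \<pi> ` {..<i}"
            using j' by auto
        qed
        then have "card {j. j < m \<and> y < \<bar>v j\<bar>} \<le> card (\<pi> ` {..<i})"
          by (intro card_mono) auto
        also have "\<dots> \<le> i"
          using card_image_le[of "{..<i}" \<pi>] by simp
        finally show ?thesis
          unfolding dg by (simp add: divide_right_mono)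
      qed
      also note i(2)
      finally show False
        by simp
    qed
    define hu where "hu i = rearr h (real i / 2 ^ L')" for i
    have hu0: "0 \<le> hu i" "hu i \<le> Bh" for i
      using rearr_range[OF h, of "real i / 2 ^ L'"] by (simp_all add: hu_def)
    have hu_anti: "hu (Suc i) \<le> hu i" for i
      unfolding hu_def by (intro rearr_antimono[OF h]) (auto simp: divide_right_mono)
    have rh: "rearr h t \<le> hu (k t)" if t: "0 \<le> t" "t < 1" for t
      unfolding hu_def using k(2)[OF t] by (intro rearr_antimono[OF h]) auto
    \<comment> \<open>The value of the rearranged h at the right endpoint is paired with the sorted
      g. The remaining drop across the cell gets the crude factor \<open>Bf\<close>, because these
      drops telescope to at most \<open>Bh\<close>.\<close>
    define w where "w i = v (\<pi> i) * hu (Suc i) + Bf * (hu i - hu (Suc i))" for i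
    have pt: "rearr f t * rearr h t \<le> w (k t)" if t: "0 \<le> t" "t < 1" for t
    proof -
      define i where "i = k t"
      have rf0: "0 \<le> rearr f t" "rearr f t \<le> Bf"
        using rearr_range[OF f t(1)] by auto
      have "rearr f t * rearr h t \<le> rearr f t * hu i"
        using rh[OF t] rf0 by (intro mult_left_mono) (auto simp: i_def)
      also have "\<dots> = rearr f t * hu (Suc i) + rearr f t * (hu i - hu (Suc i))"
        by (simp add: algebra_simps)
      also have "\<dots> \<le> v (\<pi> i) * hu (Suc i) + Bf * (hu i - hu (Suc i))"
        using rf[OF t] rf0 hu0[of "Suc i"] hu_anti[of i] by (intro add_mono mult_right_mono) (auto simp: i_def)
      finally show ?thesis
        by (simp add: w_def i_def)
    qed
    have cells_int: "integrable I01 (\<lambda>x. w' (k x))" for w' :: "nat \<Rightarrow> real"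
    proof -
      have "AE x in I01. norm (w' (k x)) \<le> (\<Sum>i<m. \<bar>w' i\<bar>)"
        using AE_I01_halfopen
      proof (rule eventually_mono)
        fix x :: real assume "0 \<le> x \<and> x < 1"
        then have "k x \<in> {..<m}"
          using k by simp
        then show "norm (w' (k x)) \<le> (\<Sum>i<m. \<bar>w' i\<bar>)"
          using member_le_sum[of "k x" "{..<m}" "\<lambda>i. \<bar>w' i\<bar>"] by simp
      qed
      then show ?thesis
        using cells(1)[of w'] by (rule I01.integrable_const_bound)
    qed
    have "(\<integral>x. rearr f x * rearr h x \<partial>I01) \<le> (\<integral>x. w (k x) \<partial>I01)"
      using pt by (intro integral_mono_AE fh_int cells_int eventually_mono[OF AE_I01_halfopen]) auto
    also have "\<dots> = (\<Sum>i<m. w i) / 2 ^ L'"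
      by (rule cells(2))
    also have "(\<Sum>i<m. w i) = (\<Sum>i<m. v (\<pi> i) * hu (Suc i)) + Bf * (\<Sum>i<m. hu i - hu (Suc i))"
      by (simp add: w_def sum.distrib sum_distrib_left)
    also have "(\<Sum>i<m. hu i - hu (Suc i)) = hu 0 - hu m"
      by (rule sum_lessThan_telescope')
    finally have 1: "(\<integral>x. rearr f x * rearr h x \<partial>I01) \<le>
        (\<Sum>i<m. v (\<pi> i) * hu (Suc i)) / 2 ^ L' + Bf * (hu 0 - hu m) / 2 ^ L'"
      by (simp add: add_divide_distrib)
    have "Bf * (hu 0 - hu m) \<le> Bf * Bh"
      using hu0[of 0] hu0[of m] B by (intro mult_left_mono) auto
    then have 2: "Bf * (hu 0 - hu m) / 2 ^ L' \<le> Bf * Bh / 2 ^ L'"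
      by (intro divide_right_mono) auto
    define \<sigma> where "\<sigma> = inv_into {..<m} \<pi>"
    have \<sigma>: "\<sigma> (\<pi> i) = i" if "i < m" for i
      unfolding \<sigma>_def using that bij_betw_imp_inj_on[OF \<pi>(1)] by (intro inv_into_f_f) auto
    \<comment> \<open>Cell \<open>\<pi> i\<close> receives the right-endpoint value. Right endpoints
      keep the distribution of h' below that of h; left endpoints could overshoot.\<close>
    define h' where "h' x = hu (Suc (\<sigma> (k x)))" for x
    have h'_eq: "h' = (\<lambda>x. (\<lambda>j. hu (Suc (\<sigma> j))) (k x))"
      by (simp add: h'_def[abs_def])
    have h'_m: "h' \<in> borel_measurable I01"
      unfolding h'_eq by (rule cells(1))
    have h'_b: "ess_bdd Bh h'"
      unfolding ess_bdd_def using h'_m B hu0 by (auto simp: h'_def)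
    have h'X: "inX N h'"
      using h'_b inX_bounded_AE(1)[of h' Bh] by (auto simp: ess_bdd_def)
    have h'_step: "step L' h'"
      unfolding step_def h'_def k_def by (intro exI[of _ "\<lambda>i. hu (Suc (\<sigma> i))"]) simp
    have "(\<Sum>i<m. v (\<pi> i) * hu (Suc i)) = (\<Sum>i<m. (\<lambda>j. v j * hu (Suc (\<sigma> j))) (\<pi> i))"
      by (intro sum.cong) (auto simp: \<sigma>)
    also have "\<dots> = (\<Sum>j<m. v j * hu (Suc (\<sigma> j)))"
      by (rule sum.reindex_bij_betw[OF \<pi>(1)])
    also have "\<dots> / 2 ^ L' = (\<integral>x. v (k x) * hu (Suc (\<sigma> (k x))) \<partial>I01)"
      by (rule cells(2)[symmetric])
    also have "\<dots> = (\<integral>x. h' x * g x \<partial>I01)"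
    proof (rule integral_cong_AE)
      show "AE x in I01. v (k x) * hu (Suc (\<sigma> (k x))) = h' x * g x"
        using AEg by (rule eventually_mono) (simp add: h'_def)
      show "(\<lambda>x. v (k x) * hu (Suc (\<sigma> (k x)))) \<in> borel_measurable I01"
        by (rule cells(1)[of "\<lambda>i. v i * hu (Suc (\<sigma> i))"])
    qed (intro borel_measurable_times h'_m g(2))
    also have "\<dots> \<le> A * nrm h'"
      by (rule A(2)[OF L' h'_step h'X])
    finally have 3: "(\<Sum>i<m. v (\<pi> i) * hu (Suc i)) / 2 ^ L' \<le> A * nrm h'" .
    have "N h' \<le> N h"
    proof (rule N_dominated[OF h'_b h])
      fix t :: real assume t: "0 \<le> t"
      define D where "D = 2 ^ L' * dfun h t"
      have D0: "0 \<le> D"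
        by (simp add: D_def)
      have "{i. i < m \<and> t < \<bar>hu (Suc (\<sigma> i))\<bar>} \<subseteq> \<pi> ` {..<nat \<lfloor>D\<rfloor>}"
      proof
        fix j assume j: "j \<in> {i. i < m \<and> t < \<bar>hu (Suc (\<sigma> i))\<bar>}"
        then have "j \<in> \<pi> ` {..<m}"
          using bij_betw_imp_surj_on[OF \<pi>(1)] by auto
        then obtain i where i: "i < m" "j = \<pi> i"
          by auto
        then have "t < hu (Suc i)"
          using j hu0(1)[of "Suc i"] by (simp add: \<sigma>)
        then have "real (Suc i) / 2 ^ L' < dfun h t"
          unfolding hu_def using less_rearr_iff[OF h _ t, of "real (Suc i) / 2 ^ L'"] by simp
        then have "real (Suc i) < D"
          by (simp add: D_def field_simps)
        then have "int (Suc i) \<le> \<lfloor>D\<rfloor>"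
          by (simp add: le_floor_iff)
        then have "i < nat \<lfloor>D\<rfloor>"
          by linarith
        then show "j \<in> \<pi> ` {..<nat \<lfloor>D\<rfloor>}"
          using i by auto
      qed
      then have "card {i. i < m \<and> t < \<bar>hu (Suc (\<sigma> i))\<bar>} \<le> card (\<pi> ` {..<nat \<lfloor>D\<rfloor>})"
        by (intro card_mono) auto
      also have "\<dots> \<le> nat \<lfloor>D\<rfloor>"
        using card_image_le[of "{..<nat \<lfloor>D\<rfloor>}" \<pi>] by simp
      finally have "real (card {i. i < m \<and> t < \<bar>hu (Suc (\<sigma> i))\<bar>}) \<le> D"
        using D0 by linarith
      then show "dfun h' t \<le> dfun h t"
        unfolding h'_eq by (subst cells(3)) (simp add: D_def field_simps)
    qed
    then have "nrm h' \<le> nrm h"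
      using h'X hX by (simp add: N_eq_nrm)
    then have "A * nrm h' \<le> A * nrm h"
      using A(1) by (intro mult_left_mono)
    then show ?thesis
      using 1 2 3 by linarith
  qed
  have "(\<integral>x. rearr f x * rearr h x \<partial>I01) \<le> A * nrm h"
  proof (rule LIMSEQ_le_const)
    have "(\<lambda>L'. A * nrm h + Bf * Bh / 2 ^ L') \<longlonglongrightarrow> A * nrm h + 0"
      by (intro tendsto_add tendsto_const LIMSEQ_divide_realpow_zero) auto
    then show "(\<lambda>L'. A * nrm h + Bf * Bh / 2 ^ L') \<longlonglongrightarrow> A * nrm h"
      by simp
    show "\<exists>L0. \<forall>L'\<ge>L0. (\<integral>x. rearr f x * rearr h x \<partial>I01) \<le> A * nrm h + Bf * Bh / 2 ^ L'"
      using main by blast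
  qed
  have "(\<integral>\<^sup>+x. ennreal \<bar>f x\<bar> * ennreal \<bar>h x\<bar> \<partial>I01) \<le> (\<integral>\<^sup>+x. ennreal \<bar>rearr f x\<bar> * ennreal \<bar>rearr h x\<bar> \<partial>I01)"
    by (rule Hardy_Littlewood[OF f h])
  also have "\<dots> = (\<integral>\<^sup>+x. ennreal (rearr f x * rearr h x) \<partial>I01)"
    using rearr_range(1)[OF f] rearr_range(1)[OF h] by (intro nn_integral_cong) (simp add: ennreal_mult)
  also have "\<dots> = ennreal (\<integral>x. rearr f x * rearr h x \<partial>I01)"
  proof (rule nn_integral_eq_integral[OF fh_int], rule AE_I2)
    fix x assume "x \<in> space I01"
    then have "0 \<le> x"
      by simp
    then show "0 \<le> rearr f x * rearr h x"
      by (intro mult_nonneg_nonneg rearr_range(1)[OF f] rearr_range(1)[OF h])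
  qed
  also have "\<dots> \<le> ennreal (A * nrm h)"
    using \<open>(\<integral>x. rearr f x * rearr h x \<partial>I01) \<le> A * nrm h\<close> by (rule ennreal_leI)
  finally show ?thesis .
qed

end

text \<open>Chebyshev's inequality for exp (f^2), whose integral is at most 2: the assumed bound
  plus the total mass 1.\<close>

lemma gaussian_tail:
  assumes f: "ess_bdd B f" and le: "(\<integral>\<^sup>+x. ennreal (exp (\<bar>f x\<bar>\<^sup>2) - 1) \<partial>I01) \<le> 1" and t: "0 \<le> t"
  shows "dfun f t \<le> 2 * exp (- t\<^sup>2)"
proof -
  have m [measurable]: "f \<in> borel_measurable I01"
    using f by (simp add: ess_bdd_def)
  have bd: "AE x in I01. norm (exp ((f x)\<^sup>2) - 1) \<le> exp (B\<^sup>2)"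
  proof -
    have "AE x in I01. \<bar>f x\<bar> \<le> B"
      using f by (simp add: ess_bdd_def)
    then show ?thesis
    proof (rule eventually_mono)
      fix x assume "\<bar>f x\<bar> \<le> B"
      then have "(f x)\<^sup>2 \<le> B\<^sup>2"
        using power_mono[of "\<bar>f x\<bar>" B 2] by simp
      then have "exp ((f x)\<^sup>2) \<le> exp (B\<^sup>2)"
        by simp
      moreover have "1 \<le> exp ((f x)\<^sup>2)"
        by simp
      ultimately show "norm (exp ((f x)\<^sup>2) - 1) \<le> exp (B\<^sup>2)"
        unfolding real_norm_def by linarith
    qed
  qed
  have int: "integrable I01 (\<lambda>x. exp ((f x)\<^sup>2) - 1)"
    by (rule I01.integrable_const_bound[OF bd]) measurable
  have "ennreal (\<integral>x. exp ((f x)\<^sup>2) - 1 \<partial>I01) = (\<integral>\<^sup>+x. ennreal (exp ((f x)\<^sup>2) - 1) \<partial>I01)"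
    by (rule nn_integral_eq_integral[OF int, symmetric]) simp
  also have "\<dots> \<le> 1"
    using le by simp
  finally have le1: "(\<integral>x. exp ((f x)\<^sup>2) - 1 \<partial>I01) \<le> 1"
    by simp
  define A where "A = {x \<in> {0..1}. t < \<bar>f x\<bar>}"
  have A: "A \<in> sets I01" "A \<inter> space I01 = A"
    using superlevel_sets[OF m] by (auto simp: A_def)
  have iA: "integrable I01 (indicat_real A)"
    using A by (simp add: I01.emeasure_finite less_top[symmetric])
  have "(\<integral>x. exp (t\<^sup>2) * indicat_real A x \<partial>I01) \<le> (\<integral>x. (exp ((f x)\<^sup>2) - 1) + 1 \<partial>I01)"
  proof (rule integral_mono)
    fix x assume "x \<in> space I01"
    show "exp (t\<^sup>2) * indicat_real A x \<le> (exp ((f x)\<^sup>2) - 1) + 1"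
    proof (cases "x \<in> A")
      case True
      then have "t\<^sup>2 \<le> (f x)\<^sup>2"
        using t power_mono[of t "\<bar>f x\<bar>" 2] by (simp add: A_def)
      then show ?thesis
        using True by simp
    qed auto
  qed (intro integrable_mult_right iA, intro Bochner_Integration.integrable_add int I01.integrable_const)
  also have "\<dots> = (\<integral>x. exp ((f x)\<^sup>2) - 1 \<partial>I01) + 1"
    using int by (subst Bochner_Integration.integral_add) auto
  also have "\<dots> \<le> 2"
    using le1 by simp
  also have "(\<integral>x. exp (t\<^sup>2) * indicat_real A x \<partial>I01) = exp (t\<^sup>2) * dfun f t"
    using A by (simp add: dfun_def A_def)
  finally show ?thesis
    by (simp add: exp_minus field_simps)
qed

text \<open>Carries an estimate for all admissible scalings over to the infimum in
  \<open>LM2_norm\<close>.\<close>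

lemma le_mult_Inf_ennreal:
  fixes a :: ennreal
  assumes "0 < c" "\<And>l. l \<in> S \<Longrightarrow> a \<le> ennreal c * l"
  shows "a \<le> ennreal c * Inf S"
proof -
  have c: "0 < ennreal c"
    using assms(1) by simp
  have "a / ennreal c \<le> Inf S"
    using assms(2) by (intro Inf_greatest divide_le_posI_ennreal[OF c]) (simp add: mult.commute)
  then have "ennreal c * (a / ennreal c) \<le> ennreal c * Inf S"
    by (intro mult_left_mono) auto
  moreover have "ennreal c * (a / ennreal c) = a"
    using c by (simp add: ennreal_times_divide mult_divide_eq_ennreal mult.commute[of "ennreal c"])
  ultimately show ?thesis
    by simp
qed

context ri_space
begin

text \<open>The number M of terms depends on the essential bound of f, whereas the estimates for S
  do not depend on M; hence the constants are uniform in f.\<close>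

lemma complemented_imp_embeddings:
  assumes q: "q > 1" "lacunary q n" and compl: "complemented_in N (walsh_span_X N n)"
  shows "\<exists>C C'. C > 0 \<and> C' > 0 \<and> (\<forall>f. Linf_fun f \<longrightarrow>
    N f \<le> ennreal C * LM2_norm f \<and> assoc_norm N f \<le> ennreal C' * LM2_norm f)"
proof -
  obtain P K0 where P: "\<And>f. inX N f \<Longrightarrow> P f \<in> wspan n"
    "\<And>f g a b. inX N f \<Longrightarrow> inX N g \<Longrightarrow> AE x in I01. P (\<lambda>t. a * f t + b * g t) x = a * P f x + b * P g x"
    "\<And>f. inX N f \<Longrightarrow> N (P f) \<le> ennreal K0 * N f"
    and id: "\<And>f. f \<in> wspan n \<Longrightarrow> AE x in I01. P f x = f x"
    using compl unfolding complemented_in_def walsh_span_X_eq by blast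
  define K where "K = max 0 K0"
  have K: "0 \<le> K"
    by (simp add: K_def)
  have bP: "bounded_into n K P"
    unfolding bounded_into_def
  proof (intro conjI allI impI)
    fix f assume f: "inX N f"
    have "N (P f) \<le> ennreal K * N f"
      using P(3)[OF f] by (rule order_trans) (auto simp: K_def intro!: mult_right_mono ennreal_leI)
    then have "ennreal (nrm (P f)) \<le> ennreal (K * nrm f)"
      using N_eq_nrm[OF f] N_eq_nrm[OF wspan_inX[OF P(1)[OF f]]] K by (simp add: ennreal_mult)
    then show "nrm (P f) \<le> K * nrm f"
      using K by simp
  qed (use P in auto)
  have n: "inj n"
    by (rule lacunary_inj[OF q])
  obtain \<nu> where \<nu>: "dyadic_lacunary \<nu>" "range \<nu> \<subseteq> range n"
    and sep: "\<And>j k. n j \<noteq> \<nu> k \<Longrightarrow> freq_bound \<nu> k \<le> xor (n j) (\<nu> k)"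
    using lacunary_subsequence[OF q] by blast
  \<comment> \<open>Both constants come from the comparison function 18 |S| + 6: 18 times the bound
    for S, then 6 times the constant for the function 1. The summand 1 ensures positivity.\<close>
  define C where "C = 36 * K * Cinf + 6 * Cinf + 1"
  define C' where "C' = 36 * Cone * K + 6 * Cone + 1"
  have C: "C > 0" "C' > 0"
    using K Cinf(1) Cone(1) unfolding C_def C'_def by (auto intro!: add_nonneg_pos add_nonneg_nonneg mult_nonneg_nonneg)
  have main: "N f \<le> ennreal C * ennreal l \<and> assoc_norm N f \<le> ennreal C' * ennreal l"
    if f: "Linf_fun f" and l: "l > 0" and int: "(\<integral>\<^sup>+ x. ennreal (exp ((\<bar>f x\<bar> / l)\<^sup>2) - 1) \<partial>I01) \<le> 1" for f l
  proof -
    have fm: "f \<in> borel_measurable I01"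
      using f by (simp add: Linf_fun_def)
    define f1 where "f1 = (\<lambda>x. 1 / l * f x)"
    have f1m: "f1 \<in> borel_measurable I01"
      unfolding f1_def using fm by (intro borel_measurable_times) auto
    obtain c where c: "AE x in I01. \<bar>f x\<bar> \<le> c"
      using f by (auto simp: Linf_fun_def)
    define B where "B = max 0 (c / l)"
    have f1: "ess_bdd B f1"
      unfolding ess_bdd_def
    proof (intro conjI f1m)
      show "AE x in I01. \<bar>f1 x\<bar> \<le> B"
        using c
      proof (rule eventually_mono)
        fix x assume "\<bar>f x\<bar> \<le> c"
        then have "\<bar>f x\<bar> / l \<le> c / l"
          using l by (intro divide_right_mono) auto
        then show "\<bar>f1 x\<bar> \<le> B"
          using l by (simp add: f1_def B_def abs_mult le_max_iff_disj)
      qed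
    qed (simp add: B_def)
    have int1: "(\<integral>\<^sup>+x. ennreal (exp (\<bar>f1 x\<bar>\<^sup>2) - 1) \<partial>I01) \<le> 1"
      using int l by (simp add: f1_def abs_mult)
    \<comment> \<open>The lower tail bound reaches s = sqrt M, that is t = 2 sqrt M. With B/2 \<le>
      sqrt M this covers all t < B, and from B on the distribution of f1 vanishes.\<close>
    obtain M0 :: nat where M0: "(B / 2)\<^sup>2 \<le> real M0"
      using real_arch_simple by blast
    define M where "M = Suc M0"
    have M: "0 < M" "B / 2 \<le> sqrt (real M)"
      using M0 real_le_rsqrt[of "B / 2" "real M"] by (auto simp: M_def)
    define b where "b = 1 / sqrt (real M)"
    have b: "real M * b\<^sup>2 \<le> 1"
      using M by (simp add: b_def power_divide)
    define S where "S = wcomb \<nu> M (\<lambda>_. b)"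
    define L where "L = \<nu> M"
    have L: "\<nu> k < 2 ^ L" if "k < M" for k
      unfolding L_def by (rule dyadic_lacunary_less_pow[OF \<nu>(1) that])
    have SX: "inX N S" and Sm: "S \<in> borel_measurable I01"
      by (simp_all add: S_def)
    have S_nrm: "nrm S \<le> K * Cinf * 2"
      unfolding S_def by (rule complemented_imp_bounds(1)[OF bP id K n \<nu> b sep])
    have S_pair: "(\<integral>x. u x * S x \<partial>I01) \<le> 2 * Cone * K * nrm u" if "inX N u" "step L' u" "L \<le> L'" for u L'
    proof -
      have "\<nu> k < 2 ^ L'" if "k < M" for k
        using L[OF that] power_increasing[OF \<open>L \<le> L'\<close>, of "2 :: nat"] by linarith
      then show ?thesis
        unfolding S_def by (intro complemented_imp_bounds(2)[OF bP id K n \<nu> b sep that(1,2)])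
    qed
    have S_step: "step L S"
      unfolding S_def wcomb_def[abs_def] using L
      by (intro step_sum step_compose[where h = "\<lambda>y. b * y"] step_wal)
    \<comment> \<open>From S \<ge> s/8 follows 18 S \<ge> 9/4 s, above 2 s = t. The constant 6
      covers t < 6, where the tail bound, valid for s \<ge> 3, says nothing.\<close>
    define g where "g x = 18 * \<bar>S x\<bar> + 6" for x
    have g_step: "step L g"
      unfolding g_def using step_compose[OF S_step, of "\<lambda>y. 18 * \<bar>y\<bar> + 6"] .
    have gm: "g \<in> borel_measurable I01"
      unfolding g_def using Sm by measurable
    have g_le: "\<bar>g x\<bar> \<le> 18 * (\<Sum>k<M. \<bar>b\<bar>) + 6" for x
      using abs_wcomb_le[of \<nu> M "\<lambda>_. b" x] by (simp add: g_def S_def)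
    have gb: "ess_bdd (18 * (\<Sum>k<M. \<bar>b\<bar>) + 6) g"
      unfolding ess_bdd_def using gm g_le by auto
    have dom: "dfun f1 t \<le> dfun g t" if t: "0 \<le> t" for t
    proof -
      consider "t < 6" | "B \<le> t" | "6 \<le> t" "t < B"
        by linarith
      then show ?thesis
      proof cases
        case 1
        have "t < \<bar>g x\<bar>" for x
        proof -
          have "6 \<le> g x"
            by (simp add: g_def)
          then show ?thesis
            using 1 by linarith
        qed
        then have "{x \<in> {0..1}. t < \<bar>g x\<bar>} = {0..1}"
          by auto
        then have "dfun g t = 1"
          by (simp add: dfun_def)
        then show ?thesis
          using dfun_le_1[of f1 t] by simp
      next
        case 2
        then show ?thesis
          using dfun_zero[OF f1 2] by simp
      next
        case 3
        define s where "s = t / 2"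
        have s: "3 \<le> s" "s \<le> sqrt (real M)" "t = 2 * s"
          using 3 M by (auto simp: s_def)
        have "dfun f1 t \<le> 2 * exp (- t\<^sup>2)"
          by (rule gaussian_tail[OF f1 int1 t])
        \<comment> \<open>As t^2 = 4 s^2, the spare exponent 5/2 s^2 with s^2 \<ge> 9 absorbs the
          factor 8.\<close>
        also have "\<dots> \<le> exp (- (3 * s\<^sup>2 / 2)) / 4"
        proof -
          have "9 \<le> s\<^sup>2"
            using s(1) power_mono[of 3 s 2] by simp
          moreover have "1 + 5 / 2 * s\<^sup>2 \<le> exp (5 / 2 * s\<^sup>2)"
            by (rule exp_ge_add_one_self)
          ultimately have "8 \<le> exp (5 / 2 * s\<^sup>2)"
            by linarith
          then have "8 * exp (- t\<^sup>2) \<le> exp (5 / 2 * s\<^sup>2) * exp (- t\<^sup>2)"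
            by (intro mult_right_mono) auto
          also have "\<dots> = exp (- (3 * s\<^sup>2 / 2))"
            by (simp add: s(3) power_mult_distrib flip: exp_add)
          finally show ?thesis
            by simp
        qed
        also have "\<dots> \<le> measure I01 {x \<in> {0..1}. s / 8 \<le> S x}"
          unfolding S_def b_def by (rule wcomb_tail_lower[OF \<nu>(1) M(1) s(1,2)])
        also have "\<dots> \<le> dfun g t"
          unfolding dfun_def
        proof (rule I01.finite_measure_mono[OF _ superlevel_sets[OF gm]])
          show "{x \<in> {0..1}. s / 8 \<le> S x} \<subseteq> {x \<in> {0..1}. t < \<bar>g x\<bar>}"
          proof
            fix x assume "x \<in> {x \<in> {0..1}. s / 8 \<le> S x}"
            then have x: "x \<in> {0..1}" "s / 8 \<le> S x"
              by auto
            then have "t < g x"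
              using s unfolding g_def by linarith
            then show "x \<in> {x \<in> {0..1}. t < \<bar>g x\<bar>}"
              using x by simp
          qed
        qed
        finally show ?thesis .
      qed
    qed
    have absSX: "inX N (\<lambda>x. \<bar>S x\<bar>)" "nrm (\<lambda>x. \<bar>S x\<bar>) \<le> nrm S"
      using inX_mono[of "\<lambda>x. \<bar>S x\<bar>" S] SX Sm by auto
    have gX: "inX N g" "nrm g \<le> 18 * nrm S + Cinf * 6"
    proof -
      have six: "nrm (\<lambda>x. 6) \<le> Cinf * 6"
        using inX_bounded(2)[of "\<lambda>x. 6" 6] by simp
      show "inX N g"
        unfolding g_def by (intro inX_add(1) inX_scale(1) absSX inX_const)
      have "nrm g \<le> nrm (\<lambda>x. 18 * \<bar>S x\<bar>) + nrm (\<lambda>x. 6)"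
        unfolding g_def by (intro inX_add(2) inX_scale(1) absSX inX_const)
      also have "\<dots> = 18 * nrm (\<lambda>x. \<bar>S x\<bar>) + nrm (\<lambda>x. 6)"
        using inX_scale(2)[OF absSX(1), of 18] by simp
      finally show "nrm g \<le> 18 * nrm S + Cinf * 6"
        using absSX(2) six by linarith
    qed
    have f1X: "inX N f1"
      using f1 inX_bounded_AE(1)[of f1 B] by (auto simp: ess_bdd_def)
    have "N f1 \<le> N g"
      by (rule N_dominated[OF f1 gb dom])
    then have "nrm f1 \<le> nrm g"
      by (simp add: N_eq_nrm[OF f1X] N_eq_nrm[OF gX(1)])
    then have f1C: "nrm f1 \<le> C"
      using gX(2) S_nrm by (simp add: C_def)
    have f_eq: "f = (\<lambda>x. l * f1 x)"
      using l by (simp add: f1_def)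
    have "N f = ennreal \<bar>l\<bar> * N f1"
      by (subst f_eq) (rule N_scale[OF f1m])
    also have "\<dots> \<le> ennreal l * ennreal C"
      using l f1C by (auto simp: N_eq_nrm[OF f1X] intro!: mult_left_mono ennreal_leI)
    finally have 1: "N f \<le> ennreal C * ennreal l"
      by (simp add: mult.commute)
    have pair: "(\<integral>x. u x * g x \<partial>I01) \<le> C' * nrm u" if u: "L \<le> L'" "step L' u" "inX N u" for L' u
    proof -
      \<comment> \<open>The sign of S is moved into u, which remains a step function of the same
        level; this turns |S| into S, whose pairing is already bounded.\<close>
      define u' where "u' x = u x * sgn (S x)" for x
      have um: "u \<in> borel_measurable I01"
        using u by auto
      have u'm: "u' \<in> borel_measurable I01"
        unfolding u'_def using um Sm by measurable
      have u'X: "inX N u'" "nrm u' \<le> nrm u"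
        using inX_mono[OF u'm u(3)] by (auto simp: u'_def abs_mult abs_sgn_eq)
      have u'_step: "step L' u'"
        unfolding u'_def by (rule step_compose2[OF u(2) step_mono[OF S_step u(1)], of "\<lambda>a b. a * sgn b"])
      have Sb: "\<bar>S x\<bar> \<le> (\<Sum>k<M. \<bar>b\<bar>)" for x
        unfolding S_def by (rule abs_wcomb_le)
      have i1: "integrable I01 (\<lambda>x. u' x * S x)"
        by (rule pairing(1)[OF u'X(1) Sm Sb])
      have i2: "integrable I01 (\<lambda>x. u x * wal 0 x)" "\<bar>\<integral>x. u x * wal 0 x \<partial>I01\<bar> \<le> Cone * nrm u"
        by (rule pairing_wal[OF u(3)])+
      have "(\<integral>x. u x * g x \<partial>I01) = (\<integral>x. 18 * (u' x * S x) + 6 * (u x * wal 0 x) \<partial>I01)"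
      proof (intro Bochner_Integration.integral_cong refl)
        fix x
        have "sgn (S x) * S x = \<bar>S x\<bar>"
          by (simp add: abs_sgn mult.commute)
        then show "u x * g x = 18 * (u' x * S x) + 6 * (u x * wal 0 x)"
          by (simp add: g_def u'_def algebra_simps)
      qed
      also have "\<dots> = 18 * (\<integral>x. u' x * S x \<partial>I01) + 6 * (\<integral>x. u x * wal 0 x \<partial>I01)"
        using i1 i2(1) by (subst Bochner_Integration.integral_add) (auto simp del: wal_0)
      also have "\<dots> \<le> 18 * (2 * Cone * K * nrm u') + 6 * (Cone * nrm u)"
        using S_pair[OF u'X(1) u'_step u(1)] i2(2) by linarith
      also have "\<dots> \<le> 18 * (2 * Cone * K * nrm u) + 6 * (Cone * nrm u)"
        using u'X(2) Cone(1) K by (intro add_mono mult_left_mono) auto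
      also have "\<dots> \<le> C' * nrm u"
        by (simp add: C'_def algebra_simps)
      finally show ?thesis .
    qed
    have g0: "0 \<le> g x" for x
      by (simp add: g_def)
    have hbound: "(\<integral>\<^sup>+x. ennreal \<bar>h x * f x\<bar> \<partial>I01) \<le> ennreal C' * ennreal l"
      if h: "h \<in> borel_measurable I01" "N h \<le> 1" for h
    proof -
      \<comment> \<open>Truncation, as \<open>product_bound\<close> asks for bounded functions;
        monotone convergence recovers h.\<close>
      define hj where "hj j x = max (- real j) (min (real j) (h x))" for j :: nat and x
      have hjm: "hj j \<in> borel_measurable I01" for j
        unfolding hj_def using h(1) by measurable
      have hj_abs: "\<bar>hj j x\<bar> = min \<bar>h x\<bar> (real j)" for j x
        by (auto simp: hj_def min_def max_def)
      have hjb: "ess_bdd (real j) (hj j)" for j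
        unfolding ess_bdd_def using hjm by (auto simp: hj_abs)
      have hX: "inX N h"
        using h by (auto simp: inX_def intro: le_less_trans)
      have "ennreal (nrm h) \<le> 1"
        using h(2) by (simp add: N_eq_nrm[OF hX])
      then have hn: "nrm h \<le> 1"
        by simp
      have hjn: "nrm (hj j) \<le> 1" for j
        using inX_mono(2)[OF hjm hX, of j] hn by (simp add: hj_abs)
      have b1: "(\<integral>\<^sup>+x. ennreal \<bar>f1 x\<bar> * ennreal \<bar>hj j x\<bar> \<partial>I01) \<le> ennreal C'" for j
      proof -
        have "(\<integral>\<^sup>+x. ennreal \<bar>f1 x\<bar> * ennreal \<bar>hj j x\<bar> \<partial>I01) \<le> ennreal (C' * nrm (hj j))"
          using C by (intro product_bound[OF f1 hjb g_step gm g0 dom _ pair]) auto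
        also have "\<dots> \<le> ennreal C'"
          using hjn[of j] C by (intro ennreal_leI) (simp add: mult_left_le)
        finally show ?thesis .
      qed
      have "(\<integral>\<^sup>+x. ennreal \<bar>f1 x\<bar> * ennreal \<bar>h x\<bar> \<partial>I01) = (\<integral>\<^sup>+x. (SUP j. ennreal \<bar>f1 x\<bar> * ennreal \<bar>hj j x\<bar>) \<partial>I01)"
      proof (intro nn_integral_cong)
        fix x
        obtain j0 :: nat where j0: "\<bar>h x\<bar> \<le> real j0"
          using real_arch_simple by blast
        have "(SUP j. ennreal \<bar>f1 x\<bar> * ennreal \<bar>hj j x\<bar>) = ennreal \<bar>f1 x\<bar> * ennreal \<bar>h x\<bar>"
        proof (rule antisym)
          show "(SUP j. ennreal \<bar>f1 x\<bar> * ennreal \<bar>hj j x\<bar>) \<le> ennreal \<bar>f1 x\<bar> * ennreal \<bar>h x\<bar>"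
            by (intro SUP_least mult_left_mono ennreal_leI) (auto simp: hj_abs)
          have "ennreal \<bar>f1 x\<bar> * ennreal \<bar>h x\<bar> = ennreal \<bar>f1 x\<bar> * ennreal \<bar>hj j0 x\<bar>"
            using j0 by (simp add: hj_abs min_absorb1)
          also have "\<dots> \<le> (SUP j. ennreal \<bar>f1 x\<bar> * ennreal \<bar>hj j x\<bar>)"
            by (rule SUP_upper) simp
          finally show "ennreal \<bar>f1 x\<bar> * ennreal \<bar>h x\<bar> \<le> (SUP j. ennreal \<bar>f1 x\<bar> * ennreal \<bar>hj j x\<bar>)" .
        qed
        then show "ennreal \<bar>f1 x\<bar> * ennreal \<bar>h x\<bar> = (SUP j. ennreal \<bar>f1 x\<bar> * ennreal \<bar>hj j x\<bar>)" ..
      qed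
      also have "\<dots> = (SUP j. \<integral>\<^sup>+x. ennreal \<bar>f1 x\<bar> * ennreal \<bar>hj j x\<bar> \<partial>I01)"
      proof (rule nn_integral_monotone_convergence_SUP)
        show "incseq (\<lambda>j x. ennreal \<bar>f1 x\<bar> * ennreal \<bar>hj j x\<bar>)"
        proof (intro incseq_SucI le_funI mult_left_mono ennreal_leI)
          fix j x
          show "\<bar>hj j x\<bar> \<le> \<bar>hj (Suc j) x\<bar>"
            by (simp add: hj_abs min_def)
        qed simp
        show "(\<lambda>x. ennreal \<bar>f1 x\<bar> * ennreal \<bar>hj j x\<bar>) \<in> borel_measurable I01" for j
          using f1m hjm[of j] by measurable
      qed
      also have "\<dots> \<le> ennreal C'"
        by (intro SUP_least b1)
      finally have b2: "(\<integral>\<^sup>+x. ennreal \<bar>f1 x\<bar> * ennreal \<bar>h x\<bar> \<partial>I01) \<le> ennreal C'" .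
      have "(\<integral>\<^sup>+x. ennreal \<bar>h x * f x\<bar> \<partial>I01) = (\<integral>\<^sup>+x. ennreal l * (ennreal \<bar>f1 x\<bar> * ennreal \<bar>h x\<bar>) \<partial>I01)"
        using l by (intro nn_integral_cong) (simp add: f1_def abs_mult ennreal_mult[symmetric] mult_ac)
      also have "\<dots> = ennreal l * (\<integral>\<^sup>+x. ennreal \<bar>f1 x\<bar> * ennreal \<bar>h x\<bar> \<partial>I01)"
        using f1m h(1)
        by (intro nn_integral_cmult borel_measurable_times_ennreal measurable_compose[OF _ measurable_ennreal] borel_measurable_abs)
      also have "\<dots> \<le> ennreal l * ennreal C'"
        using b2 by (intro mult_left_mono) auto
      finally show ?thesis
        by (simp add: mult.commute)
    qed
    have "assoc_norm N f \<le> ennreal C' * ennreal l"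
      unfolding assoc_norm_def using hbound by (intro SUP_least) auto
    with 1 show ?thesis
      by blast
  qed
  have "N f \<le> ennreal C * LM2_norm f \<and> assoc_norm N f \<le> ennreal C' * LM2_norm f" if "Linf_fun f" for f
    unfolding LM2_norm_def using main[OF that] C by (auto intro!: le_mult_Inf_ennreal)
  then show ?thesis
    using C by blast
qed

end

section \<open>From the embeddings to complementation\<close>

context ri_space
begin

text \<open>The recursion behind the bound: conditioning on all signs but the last replaces \<open>a\<close> by
  \<open>a + 2 a\<^sup>2 c\<^sup>2\<close> at the price of a factor \<open>exp (a c\<^sup>2)\<close>, by \<open>cosh y \<le> exp (y\<^sup>2 / 2)\<close>.\<close>

lemma wcomb_square_exp:
  assumes \<nu>: "dyadic_lacunary \<nu>" and a: "0 \<le> a" "2 * a * (\<Sum>k<K. (c k)\<^sup>2) < 1"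
  shows "(\<integral>x. exp (a * (wcomb \<nu> K c x)\<^sup>2) \<partial>I01) \<le> 1 / sqrt (1 - 2 * a * (\<Sum>k<K. (c k)\<^sup>2))"
  using a
proof (induction K arbitrary: a)
  case 0
  then show ?case
    by (simp add: wcomb_def)
next
  case (Suc K)
  define d where "d = (c K)\<^sup>2"
  define s where "s = (\<Sum>k<K. (c k)\<^sup>2)"
  define a' where "a' = a + 2 * a\<^sup>2 * d"
  have d: "0 \<le> d" and s: "0 \<le> s"
    by (simp_all add: d_def s_def sum_nonneg)
  have lt: "2 * a * (s + d) < 1"
    using Suc.prems(2) by (simp add: s_def d_def)
  have "0 \<le> 2 * a * s"
    using Suc.prems(1) s by simp
  then have ad: "2 * a * d < 1"
    using lt by (simp add: algebra_simps)
  \<comment> \<open>For a centred Gaussian of variance v the mean of exp (a x^2) is 1 / sqrt (1 - 2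
    a v); the bound has this form with v the sum of squares. The comparison of one recursion step
    with adding d to the variance rests on (1 - 2 a d)(1 + 2 a d) \<le> 1.\<close>
  have key: "1 - 2 * a * (s + d) \<le> (1 - 2 * a * d) * (1 - 2 * a' * s)"
  proof -
    have "(1 - 2 * a * d) * (1 - 2 * a' * s) - (1 - 2 * a * (s + d)) = 2 * s * (2 * a * d) * (2 * a\<^sup>2 * d)"
      by (simp add: a'_def power2_eq_square algebra_simps)
    moreover have "0 \<le> 2 * s * (2 * a * d) * (2 * a\<^sup>2 * d)"
      using Suc.prems(1) s d by simp
    ultimately show ?thesis
      by linarith
  qed
  have pos: "0 < 1 - 2 * a' * s"
  proof -
    have "0 < (1 - 2 * a * d) * (1 - 2 * a' * s)"
      using key lt by linarith
    then show ?thesis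
      using ad by (simp add: zero_less_mult_iff)
  qed
  have a': "0 \<le> a'"
    using Suc.prems(1) d by (simp add: a'_def)
  have int: "integrable I01 (\<lambda>x. exp (t * (wcomb \<nu> K c x)\<^sup>2))" for t
    using continuous_wcomb_integrable(2)[of "\<lambda>y. exp (t * y\<^sup>2)" \<nu> K c 0 0] by (simp add: continuous_intros)
  have pt: "(exp (a * (y + c K)\<^sup>2) + exp (a * (y - c K)\<^sup>2)) / 2 \<le> exp (a * d) * exp (a' * y\<^sup>2)" for y
  proof -
    have "exp (a * (y + c K)\<^sup>2) + exp (a * (y - c K)\<^sup>2) = 2 * (exp (a * y\<^sup>2 + a * d) * cosh (2 * a * y * c K))"
      by (simp add: cosh_field_def d_def power2_eq_square algebra_simps flip: exp_add)
    also have "\<dots> \<le> 2 * (exp (a * y\<^sup>2 + a * d) * exp ((2 * a * y * c K)\<^sup>2 / 2))"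
      by (intro mult_left_mono cosh_le_exp) auto
    also have "exp (a * y\<^sup>2 + a * d) * exp ((2 * a * y * c K)\<^sup>2 / 2) = exp (a * d) * exp (a' * y\<^sup>2)"
      by (simp add: a'_def d_def power2_eq_square algebra_simps flip: exp_add)
    finally show ?thesis
      by simp
  qed
  have "(\<integral>x. exp (a * (wcomb \<nu> (Suc K) c x)\<^sup>2) \<partial>I01) =
      (\<integral>x. (exp (a * (wcomb \<nu> K c x + c K)\<^sup>2) + exp (a * (wcomb \<nu> K c x - c K)\<^sup>2)) / 2 \<partial>I01)"
    by (intro integral_last_sign[OF _ \<nu>, of "\<lambda>y. exp (a * y\<^sup>2)"] continuous_intros)
  also have "\<dots> \<le> (\<integral>x. exp (a * d) * exp (a' * (wcomb \<nu> K c x)\<^sup>2) \<partial>I01)"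
  proof (rule integral_mono)
    have "integrable I01 (\<lambda>x. exp (a * (wcomb \<nu> K c x + c K * wal 0 x)\<^sup>2))"
      "integrable I01 (\<lambda>x. exp (a * (wcomb \<nu> K c x + (- c K) * wal 0 x)\<^sup>2))"
      by (rule continuous_wcomb_integrable(2)[of "\<lambda>y. exp (a * y\<^sup>2)"], intro continuous_intros)+
    then show "integrable I01 (\<lambda>x. (exp (a * (wcomb \<nu> K c x + c K)\<^sup>2) + exp (a * (wcomb \<nu> K c x - c K)\<^sup>2)) / 2)"
      by simp
  qed (intro integrable_mult_right int, rule pt)
  also have "\<dots> = exp (a * d) * (\<integral>x. exp (a' * (wcomb \<nu> K c x)\<^sup>2) \<partial>I01)"
    by (rule integral_mult_right_zero)
  also have "\<dots> \<le> exp (a * d) * (1 / sqrt (1 - 2 * a' * s))"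
    using Suc.IH[OF a'] pos by (intro mult_left_mono) (auto simp: s_def)
  also have "\<dots> \<le> 1 / sqrt (1 - 2 * a * (s + d))"
  proof -
    \<comment> \<open>Equivalently \<open>exp (a * d)\<close> is at most 1 / sqrt (1 - 2 a d), which
      fits the factor produced by the recursion into \<open>key\<close>.\<close>
    have "1 - 2 * a * d \<le> exp (- (2 * a * d))"
      using exp_ge_add_one_self[of "- (2 * a * d)"] by simp
    then have "1 - 2 * a * (s + d) \<le> exp (- (2 * a * d)) * (1 - 2 * a' * s)"
      using key pos by (meson mult_right_mono less_imp_le order_trans)
    then have "sqrt (1 - 2 * a * (s + d)) \<le> sqrt (exp (- (2 * a * d)) * (1 - 2 * a' * s))"
      by (rule real_sqrt_le_mono)
    also have "\<dots> = exp (- (a * d)) * sqrt (1 - 2 * a' * s)"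
    proof -
      have "exp (- (2 * a * d)) = (exp (- (a * d)))\<^sup>2"
        by (simp add: exp_double[symmetric])
      then show ?thesis
        by (simp add: real_sqrt_mult)
    qed
    finally have "exp (a * d) * sqrt (1 - 2 * a * (s + d)) \<le> sqrt (1 - 2 * a' * s)"
      by (simp add: exp_minus field_simps)
    then show ?thesis
      using lt pos by (simp add: field_simps)
  qed
  finally show ?case
    by (simp add: s_def d_def)
qed

end

section \<open>Lacunary Walsh sums in the Orlicz norm\<close>

lemma lacunary_imp_dyadic_subsequences:
  assumes q: "q > 1" "lacunary q n"
  obtains m where "m > 0" "\<And>j. dyadic_lacunary (\<lambda>k. n (m * k + j))"
proof -
  obtain m where m: "2 < q ^ m"
    using real_arch_pow[OF q(1)] by blast
  then have "m > 0"
    by (cases m) auto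
  moreover have "dyadic_lacunary (\<lambda>k. n (m * k + j))" for j
    unfolding dyadic_lacunary_def
  proof
    fix k
    show "freq_bound (\<lambda>k. n (m * k + j)) k \<le> n (m * k + j)"
    proof (cases k)
      case 0
      then show ?thesis
        using lacunary_pos[OF q(2), of j] by (simp add: freq_bound_def)
    next
      case (Suc i)
      have "2 * real (n (m * i + j)) \<le> q ^ m * real (n (m * i + j))"
        using m by (intro mult_right_mono) auto
      also have "\<dots> \<le> real (n (m * i + j + m))"
        by (rule lacunary_growth[OF q])
      finally have "2 * n (m * i + j) \<le> n (m * i + j + m)"
        by linarith
      then show ?thesis
        by (simp add: Suc freq_bound_def algebra_simps)
    qed
  qed
  ultimately show ?thesis
    using that by blast
qed

context ri_space
begin

text \<open>Division with remainder, i = m k + j. Each residue class keeps the full range k < K,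
  padded with zeros.\<close>

lemma wcomb_split_mod:
  assumes m: "m > 0"
  shows "wcomb n K c x = (\<Sum>j<m. wcomb (\<lambda>k. n (m * k + j)) K (\<lambda>k. if m * k + j < K then c (m * k + j) else 0) x)"
proof -
  have "(\<Sum>j<m. \<Sum>k<K. if m * k + j < K then c (m * k + j) * wal (n (m * k + j)) x else 0) =
      (\<Sum>(j, k)\<in>{..<m} \<times> {..<K}. if m * k + j < K then c (m * k + j) * wal (n (m * k + j)) x else 0)"
    by (rule sum.cartesian_product)
  also have "\<dots> = (\<Sum>(j, k)\<in>{(j, k). j < m \<and> k < K \<and> m * k + j < K}. c (m * k + j) * wal (n (m * k + j)) x)"
    by (rule sum.mono_neutral_cong_right) (auto split: if_splits)
  also have "\<dots> = (\<Sum>i<K. c i * wal (n i) x)"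
  proof (rule sum.reindex_bij_witness[of _ "\<lambda>i. (i mod m, i div m)" "\<lambda>(j, k). m * k + j"])
    fix i assume i: "i \<in> {..<K}"
    have "i div m < K"
      using i by (intro le_less_trans[OF div_le_dividend]) simp
    then show "(i mod m, i div m) \<in> {(j, k). j < m \<and> k < K \<and> m * k + j < K}"
      using i m by simp
  qed (use m in auto)
  finally show ?thesis
    by (simp add: wcomb_def if_distrib[of "\<lambda>y. y * _"] cong: if_cong)
qed

lemma LM2_norm_leI:
  assumes "l > 0" "(\<integral>\<^sup>+ x. ennreal (exp ((\<bar>f x\<bar> / l)\<^sup>2) - 1) \<partial>I01) \<le> 1"
  shows "LM2_norm f \<le> ennreal l"
  unfolding LM2_norm_def using assms by (intro Inf_lower) blast

lemma LM2_norm_wcomb: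
  assumes q: "q > 1" "lacunary q n"
  shows "\<exists>D>0. \<forall>K c. LM2_norm (wcomb n K c) \<le> ennreal (D * sqrt (\<Sum>k<K. (c k)\<^sup>2))"
proof -
  obtain m where m: "m > 0" and dl: "\<And>j. dyadic_lacunary (\<lambda>k. n (m * k + j))"
    using lacunary_imp_dyadic_subsequences[OF q] by blast
  \<comment> \<open>The constant is chosen so that \<open>m * (1 / sqrt (1 - 2 * a * C) - 1) \<le> 1\<close> for \<open>a = m\<^sup>2 / l\<^sup>2\<close>.\<close>
  define D where "D = sqrt (2 * real m ^ 2 * (real m + 1))"
  have D: "D > 0" "D\<^sup>2 = 2 * real m ^ 2 * (real m + 1)"
    using m by (simp_all add: D_def)
  \<comment> \<open>The scaling in \<open>LM2_norm\<close> must be positive, so r is a positive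
    number that may exceed the l^2 norm; letting it decrease at the end includes zero
    coefficients.\<close>
  have "LM2_norm (wcomb n K c) \<le> ennreal (D * r)" if r: "r > 0" "(\<Sum>k<K. (c k)\<^sup>2) \<le> r\<^sup>2" for K c r
  proof (rule LM2_norm_leI)
    define l where "l = D * r"
    show "D * r > 0"
      using D r by simp
    then have l: "l > 0"
      by (simp add: l_def)
    define w where "w j = wcomb (\<lambda>k. n (m * k + j)) K (\<lambda>k. if m * k + j < K then c (m * k + j) else 0)" for j
    define a where "a = (real m)\<^sup>2 / l\<^sup>2"
    have a0: "0 \<le> a"
      by (simp add: a_def)
    have split: "wcomb n K c x = (\<Sum>j<m. w j x)" for x
      unfolding w_def by (rule wcomb_split_mod[OF m])
    have sq: "(\<Sum>k<K. (if m * k + j < K then c (m * k + j) else 0)\<^sup>2) \<le> r\<^sup>2" for j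
    proof -
      have "(\<Sum>k<K. (if m * k + j < K then c (m * k + j) else 0)\<^sup>2) = (\<Sum>k\<in>{k. k < K \<and> m * k + j < K}. (c (m * k + j))\<^sup>2)"
        by (rule sum.mono_neutral_cong_right) auto
      also have "\<dots> = (\<Sum>i\<in>(\<lambda>k. m * k + j) ` {k. k < K \<and> m * k + j < K}. (c i)\<^sup>2)"
        using m by (subst sum.reindex) (auto simp: inj_on_def)
      also have "\<dots> \<le> (\<Sum>k<K. (c k)\<^sup>2)"
        by (rule sum_mono2) auto
      finally show ?thesis
        using r by simp
    qed
    have ar: "2 * a * r\<^sup>2 = 1 / (real m + 1)"
    proof -
      have "l\<^sup>2 = (2 * (real m)\<^sup>2 * r\<^sup>2) * (real m + 1)"
        unfolding l_def power_mult_distrib D(2) by (simp only: mult_ac)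
      moreover have "2 * a * r\<^sup>2 = ((2 * (real m)\<^sup>2 * r\<^sup>2) * 1) / l\<^sup>2"
        by (simp add: a_def)
      moreover have "2 * (real m)\<^sup>2 * r\<^sup>2 \<noteq> 0"
        using r m by simp
      ultimately show ?thesis
        by (simp only: mult_divide_mult_cancel_left not_False_eq_True)
    qed
    have int: "integrable I01 (\<lambda>x. exp (a * (w j x)\<^sup>2))" for j
      unfolding w_def using continuous_wcomb_integrable(2)[of "\<lambda>y. exp (a * y\<^sup>2)" _ _ _ 0 0]
      by (simp add: continuous_intros)
    have bound: "(\<integral>x. exp (a * (w j x)\<^sup>2) \<partial>I01) \<le> 1 + 1 / real m" for j
    proof -
      define s where "s = (\<Sum>k<K. (if m * k + j < K then c (m * k + j) else 0)\<^sup>2)"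
      have "2 * a * s \<le> 2 * a * r\<^sup>2"
        using sq[of j] a0 by (intro mult_left_mono) (auto simp: s_def)
      then have s: "2 * a * s \<le> 1 / (real m + 1)"
        by (simp add: ar)
      moreover have "1 / (real m + 1) < 1"
        using m by simp
      ultimately have s1: "2 * a * s < 1"
        by linarith
      have e: "1 - 1 / (real m + 1) = real m / (real m + 1)"
        by (simp add: field_simps)
      have "(\<integral>x. exp (a * (w j x)\<^sup>2) \<partial>I01) \<le> 1 / sqrt (1 - 2 * a * s)"
        unfolding w_def s_def using s1 by (intro wcomb_square_exp dl a0) (simp add: s_def)
      \<comment> \<open>The number x = m / (m + 1) satisfies x^2 \<le> x, so x is at most the square
        root; the reciprocal of x is 1 + 1/m.\<close>
      also have "\<dots> \<le> 1 / (real m / (real m + 1))"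
      proof (rule divide_left_mono)
        have "real m / (real m + 1) \<le> 1 - 2 * a * s"
          using s e by linarith
        then have "(real m / (real m + 1))\<^sup>2 \<le> 1 - 2 * a * s"
          using m mult_left_le[of "real m / (real m + 1)" "real m / (real m + 1)"]
          by (simp add: power2_eq_square)
        then show "real m / (real m + 1) \<le> sqrt (1 - 2 * a * s)"
          by (rule real_le_rsqrt)
        show "0 < sqrt (1 - 2 * a * s) * (real m / (real m + 1))"
          using s1 m by simp
      qed simp
      also have "\<dots> = 1 + 1 / real m"
        using m by (simp add: field_simps)
      finally show ?thesis .
    qed
    have pt: "exp ((\<bar>wcomb n K c x\<bar> / l)\<^sup>2) - 1 \<le> (\<Sum>j<m. exp (a * (w j x)\<^sup>2) - 1)" for x
    proof -
      \<comment> \<open>The whole sum is at most m times its largest class in modulus, so a single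
        class dominates the exponential. Summing over all classes removes the dependence of that
        class on x.\<close>
      define M where "M = Max ((\<lambda>j. \<bar>w j x\<bar>) ` {..<m})"
      have ne: "(\<lambda>j. \<bar>w j x\<bar>) ` {..<m} \<noteq> {}"
        using m by auto
      obtain j where j: "j < m" "M = \<bar>w j x\<bar>"
        using Max_in[OF _ ne] unfolding M_def by auto
      have "\<bar>wcomb n K c x\<bar> \<le> (\<Sum>j<m. \<bar>w j x\<bar>)"
        unfolding split by (rule sum_abs)
      also have "\<dots> \<le> (\<Sum>j<m. M)"
        unfolding M_def by (intro sum_mono Max_ge) auto
      finally have "\<bar>wcomb n K c x\<bar> \<le> real m * \<bar>w j x\<bar>"
        by (simp add: j)
      then have "(\<bar>wcomb n K c x\<bar> / l)\<^sup>2 \<le> (real m * \<bar>w j x\<bar> / l)\<^sup>2"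
        using l by (intro power_mono divide_right_mono) auto
      also have "\<dots> = a * (w j x)\<^sup>2"
        by (simp add: a_def power_mult_distrib power_divide)
      finally have "exp ((\<bar>wcomb n K c x\<bar> / l)\<^sup>2) - 1 \<le> exp (a * (w j x)\<^sup>2) - 1"
        by simp
      also have "\<dots> \<le> (\<Sum>j<m. exp (a * (w j x)\<^sup>2) - 1)"
        using j a0 by (intro member_le_sum) auto
      finally show ?thesis .
    qed
    have int2: "integrable I01 (\<lambda>x. \<Sum>j<m. exp (a * (w j x)\<^sup>2) - 1)"
      by (intro Bochner_Integration.integrable_sum Bochner_Integration.integrable_diff int I01.integrable_const)
    have "(\<integral>\<^sup>+ x. ennreal (exp ((\<bar>wcomb n K c x\<bar> / l)\<^sup>2) - 1) \<partial>I01) \<le> (\<integral>\<^sup>+ x. ennreal (\<Sum>j<m. exp (a * (w j x)\<^sup>2) - 1) \<partial>I01)"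
      using pt by (intro nn_integral_mono ennreal_leI)
    also have "\<dots> = ennreal (\<integral>x. (\<Sum>j<m. exp (a * (w j x)\<^sup>2) - 1) \<partial>I01)"
      using a0 by (intro nn_integral_eq_integral int2 AE_I2 sum_nonneg) auto
    also have "(\<integral>x. (\<Sum>j<m. exp (a * (w j x)\<^sup>2) - 1) \<partial>I01) = (\<Sum>j<m. (\<integral>x. exp (a * (w j x)\<^sup>2) \<partial>I01) - 1)"
      using int by (subst Bochner_Integration.integral_sum) (auto intro!: Bochner_Integration.integrable_diff)
    also have "ennreal \<dots> \<le> ennreal (\<Sum>j<m. 1 / real m)"
      using bound by (intro ennreal_leI sum_mono) (simp add: algebra_simps)
    also have "\<dots> = 1"
      using m by simp
    finally show "(\<integral>\<^sup>+ x. ennreal (exp ((\<bar>wcomb n K c x\<bar> / (D * r))\<^sup>2) - 1) \<partial>I01) \<le> 1"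
      by (simp add: l_def)
  qed note * = this
  have "LM2_norm (wcomb n K c) \<le> ennreal (D * sqrt (\<Sum>k<K. (c k)\<^sup>2))" for K c
  proof (rule ennreal_le_epsilon)
    fix e :: real assume e: "0 < e"
    define s where "s = (\<Sum>k<K. (c k)\<^sup>2)"
    have s: "0 \<le> s"
      by (simp add: s_def sum_nonneg)
    have "LM2_norm (wcomb n K c) \<le> ennreal (D * (sqrt s + e / D))"
    proof (rule *)
      show "0 < sqrt s + e / D"
        using s e D by (intro add_nonneg_pos) auto
      have "s = (sqrt s)\<^sup>2"
        using s by simp
      also have "\<dots> \<le> (sqrt s + e / D)\<^sup>2"
        using s e D by (intro power_mono) auto
      finally show "(\<Sum>k<K. (c k)\<^sup>2) \<le> (sqrt s + e / D)\<^sup>2"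
        by (simp add: s_def)
    qed
    also have "D * (sqrt s + e / D) = D * sqrt s + e"
      using D by (simp add: field_simps)
    also have "ennreal (D * sqrt s + e) = ennreal (D * sqrt s) + ennreal e"
      using D s e by (intro ennreal_plus) auto
    finally show "LM2_norm (wcomb n K c) \<le> ennreal (D * sqrt (\<Sum>k<K. (c k)\<^sup>2)) + ennreal e"
      by (simp add: s_def)
  qed
  then show ?thesis
    using D by blast
qed

text \<open>The supremum in \<open>assoc_norm\<close> runs over the unit ball, so f is normalised;
  for norm 0 the embedding into L^1 already gives 0.\<close>

lemma Holder_assoc:
  assumes f: "inX N f" and g: "g \<in> borel_measurable I01" "\<And>x. \<bar>g x\<bar> \<le> M" "assoc_norm N g \<le> ennreal A" "0 \<le> A"
  shows "\<bar>\<integral>x. f x * g x \<partial>I01\<bar> \<le> A * nrm f"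
proof (cases "nrm f = 0")
  case True
  then have "\<bar>\<integral>x. f x * g x \<partial>I01\<bar> \<le> M * Cone * 0"
    using pairing(2)[OF f g(1,2)] by simp
  then show ?thesis
    using True by simp
next
  case False
  then have p: "0 < nrm f"
    using nrm_nonneg[of f] by linarith
  define f1 where "f1 = (\<lambda>x. 1 / nrm f * f x)"
  have f1: "inX N f1" "nrm f1 = 1"
    using inX_scale[OF f, of "1 / nrm f"] p by (simp_all add: f1_def)
  have "(\<integral>\<^sup>+ x. ennreal \<bar>f1 x * g x\<bar> \<partial>I01) \<le> assoc_norm N g"
    unfolding assoc_norm_def using f1 N_eq_nrm[OF f1(1)] by (intro SUP_upper) auto
  then have le: "(\<integral>\<^sup>+ x. ennreal (norm (f1 x * g x)) \<partial>I01) \<le> ennreal A"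
    using g(3) by (simp add: order_trans)
  have int: "integrable I01 (\<lambda>x. f1 x * g x)"
    by (rule pairing(1)[OF f1(1) g(1,2)])
  have "norm (\<integral>x. f1 x * g x \<partial>I01) \<le> (\<integral>x. norm (f1 x * g x) \<partial>I01)"
    by (rule integral_norm_bound)
  also have "\<dots> = enn2real (\<integral>\<^sup>+ x. ennreal (norm (f1 x * g x)) \<partial>I01)"
    using borel_measurable_integrable[OF int] by (intro integral_eq_nn_integral) (auto intro!: borel_measurable_norm)
  also have "\<dots> \<le> A"
    using le g(4) by (intro enn2real_leI)
  finally have "\<bar>\<integral>x. f1 x * g x \<partial>I01\<bar> \<le> A"
    by simp
  moreover have "(\<integral>x. f1 x * g x \<partial>I01) = 1 / nrm f * (\<integral>x. f x * g x \<partial>I01)"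
    by (simp add: f1_def mult.assoc)
  ultimately have "\<bar>\<integral>x. f x * g x \<partial>I01\<bar> / nrm f \<le> A"
    by (simp add: abs_mult)
  then show ?thesis
    using p by (simp add: field_simps)
qed

lemma wcomb_restrict_le: "wcomb n K c x - wcomb n K' c x = wcomb n K (\<lambda>k. if K' \<le> k then c k else 0) x" if "K' \<le> K"
proof -
  have "wcomb n K' c x = wcomb n K (\<lambda>k. if k < K' then c k else 0) x"
    using that by (rule wcomb_extend)
  then show ?thesis
    by (simp add: wcomb_def sum_subtractf[symmetric] left_diff_distrib[symmetric] cong: if_cong) (intro sum.cong, auto)
qed

lemma embeddings_imp_complemented:
  assumes q: "q > 1" "lacunary q n" and C: "C > 0" "C' > 0"
    and emb: "\<And>f. Linf_fun f \<Longrightarrow> N f \<le> ennreal C * LM2_norm f \<and> assoc_norm N f \<le> ennreal C' * LM2_norm f"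
  shows "complemented_in N (walsh_span_X N n)"
proof -
  have n: "inj n"
    by (rule lacunary_inj[OF q])
  obtain D where D: "D > 0" "\<And>K c. LM2_norm (wcomb n K c) \<le> ennreal (D * sqrt (\<Sum>k<K. (c k)\<^sup>2))"
    using LM2_norm_wcomb[OF q] by blast
  have Linf: "Linf_fun (wcomb n K c)" for K c
    unfolding Linf_fun_def using abs_wcomb_le by (auto intro!: exI[of _ "\<Sum>k<K. \<bar>c k\<bar>"])
  have up: "nrm (wcomb n K c) \<le> C * D * sqrt (\<Sum>k<K. (c k)\<^sup>2)" for K c
  proof -
    have "ennreal (nrm (wcomb n K c)) \<le> ennreal C * LM2_norm (wcomb n K c)"
      using emb[OF Linf] by (simp flip: N_eq_nrm[OF inX_wcomb])
    also have "\<dots> \<le> ennreal C * ennreal (D * sqrt (\<Sum>k<K. (c k)\<^sup>2))"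
      by (intro mult_left_mono D(2)) simp
    also have "\<dots> = ennreal (C * D * sqrt (\<Sum>k<K. (c k)\<^sup>2))"
      using C D(1) by (simp add: ennreal_mult[symmetric] sum_nonneg mult.assoc)
    finally show ?thesis
      using C D(1) by (simp add: sum_nonneg)
  qed
  have assoc: "assoc_norm N (wcomb n K c) \<le> ennreal (C' * D * sqrt (\<Sum>k<K. (c k)\<^sup>2))" for K c
  proof -
    have "assoc_norm N (wcomb n K c) \<le> ennreal C' * LM2_norm (wcomb n K c)"
      using emb[OF Linf] by blast
    also have "\<dots> \<le> ennreal C' * ennreal (D * sqrt (\<Sum>k<K. (c k)\<^sup>2))"
      by (intro mult_left_mono D(2)) simp
    also have "\<dots> = ennreal (C' * D * sqrt (\<Sum>k<K. (c k)\<^sup>2))"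
      using C D(1) by (simp add: ennreal_mult[symmetric] sum_nonneg mult.assoc)
    finally show ?thesis .
  qed
  define co where "co f k = (\<integral>x. f x * wal (n k) x \<partial>I01)" for f k
  define E where "E = C' * D"
  have E: "0 < E"
    using C D(1) by (simp add: E_def)
  \<comment> \<open>Paired with its own partial sum, f gives s \<le> E * sqrt s * nrm f for the sum
    of squares s; then sqrt s is cancelled.\<close>
  have bessel: "(\<Sum>k<K. (co f k)\<^sup>2) \<le> (E * nrm f)\<^sup>2" if f: "inX N f" for f K
  proof -
    define s where "s = (\<Sum>k<K. (co f k)\<^sup>2)"
    have s: "0 \<le> s"
      by (simp add: s_def sum_nonneg)
    have "s = (\<Sum>k<K. co f k * (\<integral>x. f x * wal (n k) x \<partial>I01))"
      by (simp add: s_def co_def power2_eq_square)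
    also have "\<dots> = (\<integral>x. f x * wcomb n K (co f) x \<partial>I01)"
      by (rule integral_mult_wcomb[OF f, symmetric])
    also have "\<dots> \<le> (E * sqrt s) * nrm f"
      using Holder_assoc[OF f wcomb_measurable[of n K "co f"] abs_wcomb_le assoc[of K "co f"]] C D(1) s
      by (simp add: E_def s_def)
    finally have le: "sqrt s * sqrt s \<le> (E * nrm f) * sqrt s"
      using s by (simp add: mult_ac)
    have "sqrt s \<le> E * nrm f"
    proof (cases "s = 0")
      case False
      then show ?thesis
        using s by (intro mult_right_le_imp_le[OF le]) simp
    qed (use E in simp)
    then have "(sqrt s)\<^sup>2 \<le> (E * nrm f)\<^sup>2"
      using s by (intro power_mono) auto
    then show ?thesis
      using s by (simp add: s_def)
  qed
  have partial: "nrm (wcomb n K (co f)) \<le> C * D * E * nrm f" if f: "inX N f" for f K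
  proof -
    have "sqrt (\<Sum>k<K. (co f k)\<^sup>2) \<le> E * nrm f"
      using bessel[OF f, of K] E by (intro real_le_lsqrt) auto
    then have "C * D * sqrt (\<Sum>k<K. (co f k)\<^sup>2) \<le> C * D * (E * nrm f)"
      using C D(1) by (intro mult_left_mono) auto
    then show ?thesis
      using up[of K "co f"] by (simp add: mult.assoc)
  qed
  have lim_ex: "\<exists>g. inX N g \<and> (\<lambda>K. N (\<lambda>x. wcomb n K (co f) x - g x)) \<longlonglongrightarrow> 0" if f: "inX N f" for f
  proof -
    have "bounded (range (\<lambda>K. \<Sum>k<K. (co f k)\<^sup>2))"
      using bessel[OF f] by (intro boundedI[of _ "(E * nrm f)\<^sup>2"]) (auto simp: sum_nonneg)
    then have "Bseq (\<lambda>K. \<Sum>k<K. (co f k)\<^sup>2)"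
      by (simp add: Bseq_eq_bounded)
    moreover have "incseq (\<lambda>K. \<Sum>k<K. (co f k)\<^sup>2)"
      by (intro incseq_SucI) simp
    ultimately have "convergent (\<lambda>K. \<Sum>k<K. (co f k)\<^sup>2)"
      by (intro Bseq_monoseq_convergent) (auto simp: monoseq_iff)
    then have cau: "Cauchy (\<lambda>K. \<Sum>k<K. (co f k)\<^sup>2)"
      by (rule convergent_Cauchy)
    \<comment> \<open>The difference of two partial sums is a Walsh sum over a block, and its square
      sum is the difference of the square sums. So the norms inherit the Cauchy property of a
      convergent series.\<close>
    have diff: "nrm (\<lambda>x. wcomb n i (co f) x - wcomb n j (co f) x) \<le> C * D * sqrt \<bar>(\<Sum>k<i. (co f k)\<^sup>2) - (\<Sum>k<j. (co f k)\<^sup>2)\<bar>"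
      if "j \<le> i" for i j
    proof -
      have "(\<Sum>k<i. (if j \<le> k then co f k else 0)\<^sup>2) = (\<Sum>k<i. (co f k)\<^sup>2) - (\<Sum>k<j. (co f k)\<^sup>2)"
      proof -
        have "(\<Sum>k<j. (co f k)\<^sup>2) = (\<Sum>k<i. if k < j then (co f k)\<^sup>2 else 0)"
          using that by (intro sum.mono_neutral_cong_left) auto
        then show ?thesis
          by (simp add: sum_subtractf[symmetric]) (intro sum.cong, auto)
      qed
      moreover have "0 \<le> (\<Sum>k<i. (if j \<le> k then co f k else 0)\<^sup>2)"
        by (simp add: sum_nonneg)
      ultimately show ?thesis
        using up[of i "\<lambda>k. if j \<le> k then co f k else 0"] wcomb_restrict_le[OF that, of n "co f"] by simp
    qed
    show ?thesis
    proof (rule N_complete[of "\<lambda>K. wcomb n K (co f)"])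
      fix e :: real assume e: "0 < e"
      define d where "d = (e / (C * D))\<^sup>2"
      have d: "0 < d"
        using e C D(1) by (simp add: d_def)
      obtain M where M: "\<And>i j. i \<ge> M \<Longrightarrow> j \<ge> M \<Longrightarrow> dist (\<Sum>k<i. (co f k)\<^sup>2) (\<Sum>k<j. (co f k)\<^sup>2) < d"
        using cau d unfolding Cauchy_def by blast
      have small: "nrm (\<lambda>x. wcomb n i (co f) x - wcomb n j (co f) x) < e" if "i \<ge> M" "j \<ge> M" "j \<le> i" for i j
      proof -
        have "\<bar>(\<Sum>k<i. (co f k)\<^sup>2) - (\<Sum>k<j. (co f k)\<^sup>2)\<bar> < d"
          using M[OF that(1,2)] by (simp add: dist_real_def)
        then have "sqrt \<bar>(\<Sum>k<i. (co f k)\<^sup>2) - (\<Sum>k<j. (co f k)\<^sup>2)\<bar> < sqrt d"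
          by (rule real_sqrt_less_mono)
        also have "sqrt d = e / (C * D)"
          using e C D(1) by (simp add: d_def)
        finally have "C * D * sqrt \<bar>(\<Sum>k<i. (co f k)\<^sup>2) - (\<Sum>k<j. (co f k)\<^sup>2)\<bar> < C * D * (e / (C * D))"
          using C D(1) by (intro mult_strict_left_mono) auto
        also have "C * D * (e / (C * D)) = e"
          using C D(1) by simp
        finally show ?thesis
          using diff[OF that(3)] by linarith
      qed
      have "N (\<lambda>x. wcomb n i (co f) x - wcomb n j (co f) x) < ennreal e" if "i \<ge> M" "j \<ge> M" for i j
      proof -
        have "nrm (\<lambda>x. wcomb n i (co f) x - wcomb n j (co f) x) < e"
          using small[of i j] small[of j i] that nrm_diff_commute[OF inX_wcomb[of n i "co f"] inX_wcomb[of n j "co f"]]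
          by (cases "j \<le> i") auto
        then show ?thesis
          using N_eq_nrm[OF inX_diff(1)[OF inX_wcomb inX_wcomb]] by (simp add: ennreal_less_iff)
      qed
      then show "\<exists>m. \<forall>i\<ge>m. \<forall>j\<ge>m. N (\<lambda>x. wcomb n i (co f) x - wcomb n j (co f) x) < ennreal e"
        by blast
    qed (use inX_wcomb in auto)
  qed
  \<comment> \<open>The chosen limit is determined only almost everywhere, which is why linearity
    and the identity on the span are derived through \<open>unique\<close>.\<close>
  define P where "P f = (SOME g. inX N g \<and> (\<lambda>K. N (\<lambda>x. wcomb n K (co f) x - g x)) \<longlonglongrightarrow> 0)" for f
  have PX: "inX N (P f)" and Plim: "(\<lambda>K. nrm (\<lambda>x. wcomb n K (co f) x - P f x)) \<longlonglongrightarrow> 0" if f: "inX N f" for f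
  proof -
    have *: "inX N (P f) \<and> (\<lambda>K. N (\<lambda>x. wcomb n K (co f) x - P f x)) \<longlonglongrightarrow> 0"
      unfolding P_def by (rule someI_ex[OF lim_ex[OF f]])
    then show X: "inX N (P f)"
      by blast
    have "(\<lambda>K. enn2real (N (\<lambda>x. wcomb n K (co f) x - P f x))) \<longlonglongrightarrow> enn2real 0"
      using * by (intro tendsto_enn2real) auto
    then show "(\<lambda>K. nrm (\<lambda>x. wcomb n K (co f) x - P f x)) \<longlonglongrightarrow> 0"
      by (simp add: nrm_def)
  qed
  have unique: "AE x in I01. g x = h x"
    if "inX N g" "inX N h" "\<And>e. e > 0 \<Longrightarrow> nrm (\<lambda>x. g x - h x) \<le> e" for g h
  proof -
    have X: "inX N (\<lambda>x. g x - h x)"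
      using that by (intro inX_diff)
    have "nrm (\<lambda>x. g x - h x) \<le> 0"
      by (rule field_le_epsilon) (simp add: that(3))
    then have "nrm (\<lambda>x. g x - h x) = 0"
      using nrm_nonneg antisym by blast
    then show ?thesis
      using nrm_zero_iff[OF X] by simp
  qed
  have approx: "\<exists>K0. \<forall>K\<ge>K0. nrm (\<lambda>x. wcomb n K (co f) x - P f x) < e" if f: "inX N f" and "e > 0" for f e
    using LIMSEQ_D[OF Plim[OF f] \<open>e > 0\<close>] by simp
  have Pbound: "nrm (P f) \<le> C * D * E * nrm f" if f: "inX N f" for f
  proof (rule field_le_epsilon)
    fix e :: real assume "e > 0"
    then obtain K where K: "nrm (\<lambda>x. wcomb n K (co f) x - P f x) < e"
      using approx[OF f] by blast
    have "P f = (\<lambda>x. wcomb n K (co f) x - (wcomb n K (co f) x - P f x))"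
      by simp
    then have "nrm (P f) \<le> nrm (wcomb n K (co f)) + nrm (\<lambda>x. wcomb n K (co f) x - P f x)"
      using inX_diff(2)[OF inX_wcomb inX_diff(1)[OF inX_wcomb PX[OF f]], of n K "co f" n K "co f"] by simp
    then show "nrm (P f) \<le> C * D * E * nrm f + e"
      using partial[OF f, of K] K by linarith
  qed
  have Pspan: "P f \<in> wspan n" if f: "inX N f" for f
    unfolding wspan_def
  proof (intro CollectI conjI PX[OF f] allI impI)
    fix e :: real assume "e > 0"
    then obtain K where K: "nrm (\<lambda>x. wcomb n K (co f) x - P f x) < e"
      using approx[OF f] by blast
    then show "\<exists>K c. nrm (\<lambda>x. P f x - wcomb n K c x) < e"
      using nrm_diff_commute[OF PX[OF f] inX_wcomb[of n K "co f"]] by (intro exI[of _ K] exI[of _ "co f"]) simp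
  qed
  have co_lin: "co (\<lambda>t. a * f t + b * g t) k = a * co f k + b * co g k" if f: "inX N f" and g: "inX N g" for f g a b k
    using pairing_wal(1)[OF f, of "n k"] pairing_wal(1)[OF g, of "n k"]
    by (simp add: co_def distrib_right mult.assoc)
  have Plin: "AE x in I01. P (\<lambda>t. a * f t + b * g t) x = a * P f x + b * P g x"
    if f: "inX N f" and g: "inX N g" for f g a b
  proof (rule unique)
    let ?h = "\<lambda>t. a * f t + b * g t"
    have hX: "inX N ?h"
      by (intro inX_lin f g)
    show "inX N (P ?h)"
      by (rule PX[OF hX])
    show "inX N (\<lambda>x. a * P f x + b * P g x)"
      by (intro inX_lin PX f g)
    fix e :: real assume e: "e > 0"
    define d where "d = e / (1 + \<bar>a\<bar> + \<bar>b\<bar>)"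
    have d: "d > 0"
      using e by (simp add: d_def add_pos_nonneg)
    obtain K1 K2 K3 where K: "\<And>K. K1 \<le> K \<Longrightarrow> nrm (\<lambda>x. wcomb n K (co ?h) x - P ?h x) < d"
        "\<And>K. K2 \<le> K \<Longrightarrow> nrm (\<lambda>x. wcomb n K (co f) x - P f x) < d"
        "\<And>K. K3 \<le> K \<Longrightarrow> nrm (\<lambda>x. wcomb n K (co g) x - P g x) < d"
      using approx[OF hX d] approx[OF f d] approx[OF g d] by blast
    define K where "K = max K1 (max K2 K3)"
    define u where "u = (\<lambda>x. wcomb n K (co ?h) x - P ?h x)"
    define v where "v = (\<lambda>x. wcomb n K (co f) x - P f x)"
    define w where "w = (\<lambda>x. wcomb n K (co g) x - P g x)"
    have X: "inX N u" "inX N v" "inX N w"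
      unfolding u_def v_def w_def by (intro inX_diff(1) inX_wcomb PX hX f g)+
    have small: "nrm u < d" "nrm v < d" "nrm w < d"
      unfolding u_def v_def w_def by (rule K, simp add: K_def)+
    have "wcomb n K (co ?h) x = a * wcomb n K (co f) x + b * wcomb n K (co g) x" for x
      by (simp add: wcomb_def co_lin[OF f g] sum.distrib sum_distrib_left algebra_simps)
    then have eq: "(\<lambda>x. P ?h x - (a * P f x + b * P g x)) = (\<lambda>x. (a * v x + b * w x) - u x)"
      by (simp add: u_def v_def w_def algebra_simps)
    have "nrm (\<lambda>x. (a * v x + b * w x) - u x) \<le> nrm (\<lambda>x. a * v x + b * w x) + nrm u"
      by (intro inX_diff(2) inX_lin X)
    moreover have "nrm (\<lambda>x. a * v x + b * w x) \<le> nrm (\<lambda>x. a * v x) + nrm (\<lambda>x. b * w x)"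
      by (intro inX_add(2) inX_scale(1) X)
    ultimately have "nrm (\<lambda>x. (a * v x + b * w x) - u x) \<le> nrm (\<lambda>x. a * v x) + nrm (\<lambda>x. b * w x) + nrm u"
      by linarith
    also have "nrm (\<lambda>x. a * v x) + nrm (\<lambda>x. b * w x) + nrm u = \<bar>a\<bar> * nrm v + \<bar>b\<bar> * nrm w + nrm u"
      by (simp add: inX_scale(2)[OF X(2)] inX_scale(2)[OF X(3)])
    also have "\<dots> \<le> \<bar>a\<bar> * d + \<bar>b\<bar> * d + d"
      using small by (intro add_mono mult_left_mono) auto
    also have "\<dots> = (1 + \<bar>a\<bar> + \<bar>b\<bar>) * d"
      by (simp add: algebra_simps)
    also have "\<dots> = e"
      using abs_ge_zero[of a] abs_ge_zero[of b] unfolding d_def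
      by (subst times_divide_eq_right, subst nonzero_mult_div_cancel_left) linarith+
    finally show "nrm (\<lambda>x. P ?h x - (a * P f x + b * P g x)) \<le> e"
      unfolding eq .
  qed
  have Pid: "AE x in I01. P f x = f x" if fS: "f \<in> wspan n" for f
  proof (rule unique)
    have f: "inX N f"
      using fS by blast
    show "inX N (P f)" "inX N f"
      by (rule PX[OF f], rule f)
    fix e :: real assume e: "e > 0"
    \<comment> \<open>Three errors add up: the partial sum of h, at most C * D * E times its norm,
      then h itself, then the distance of the partial sum of f from P f.\<close>
    define Q where "Q = C * D * E + 2"
    have Q: "Q > 0"
      unfolding Q_def using C D(1) E by (intro add_pos_pos mult_pos_pos) auto
    define d where "d = e / Q"
    have d: "d > 0"
      using e Q by (simp add: d_def)
    obtain K c where c: "nrm (\<lambda>x. f x - wcomb n K c x) < d"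
      using wspan_approx[OF fS d] .
    define h where "h = (\<lambda>x. f x - wcomb n K c x)"
    have h: "inX N h" "nrm h < d"
      using c by (auto simp: h_def intro!: inX_diff f)
    obtain K0 where K0: "\<And>K. K0 \<le> K \<Longrightarrow> nrm (\<lambda>x. wcomb n K (co f) x - P f x) < d"
      using approx[OF f d] by blast
    define K' where "K' = max K K0"
    have coh: "co h k = co f k - (if k < K then c k else 0)" for k
    proof -
      have "(\<integral>x. (f x - wcomb n K c x) * wal (n k) x \<partial>I01) =
          (\<integral>x. f x * wal (n k) x \<partial>I01) - (\<integral>x. wcomb n K c x * wal (n k) x \<partial>I01)"
        using pairing_wal(1)[OF f] pairing_wal(1)[OF inX_wcomb] by (simp add: left_diff_distrib)
      then show ?thesis
        by (simp add: co_def h_def wcomb_coeff[OF n])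
    qed
    \<comment> \<open>Partial sums of length at least K reproduce the combination
      \<open>wcomb n K c\<close> exactly, so only those of the small remainder h are left.\<close>
    have wh: "wcomb n K' (co f) x = wcomb n K' (co h) x + wcomb n K c x" for x
    proof -
      have "wcomb n K c x = wcomb n K' (\<lambda>k. if k < K then c k else 0) x"
        by (rule wcomb_extend) (simp add: K'_def)
      moreover have "wcomb n K' (co h) x = wcomb n K' (co f) x - wcomb n K' (\<lambda>k. if k < K then c k else 0) x"
        unfolding wcomb_def coh by (simp add: left_diff_distrib sum_subtractf)
      ultimately show ?thesis
        by simp
    qed
    define u where "u = (\<lambda>x. wcomb n K' (co f) x - P f x)"
    have u: "inX N u" "nrm u < d"
      unfolding u_def by (intro inX_diff(1) inX_wcomb PX f, rule K0, simp add: K'_def)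
    have eq: "(\<lambda>x. P f x - f x) = (\<lambda>x. (wcomb n K' (co h) x - h x) - u x)"
      by (simp add: u_def h_def wh)
    have "nrm (\<lambda>x. (wcomb n K' (co h) x - h x) - u x) \<le> nrm (\<lambda>x. wcomb n K' (co h) x - h x) + nrm u"
      by (intro inX_diff h u inX_wcomb)
    moreover have "nrm (\<lambda>x. wcomb n K' (co h) x - h x) \<le> nrm (wcomb n K' (co h)) + nrm h"
      by (intro inX_diff h inX_wcomb)
    ultimately have "nrm (\<lambda>x. (wcomb n K' (co h) x - h x) - u x) \<le> nrm (wcomb n K' (co h)) + nrm h + nrm u"
      by linarith
    also have "nrm (wcomb n K' (co h)) + nrm h + nrm u \<le> C * D * E * nrm h + nrm h + nrm u"
      using partial[OF h(1), of K'] by simp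
    also have "\<dots> \<le> C * D * E * d + d + d"
      using h(2) u(2) C D(1) E by (intro add_mono mult_left_mono) auto
    also have "\<dots> = Q * d"
      by (simp add: Q_def algebra_simps)
    also have "\<dots> = e"
      using Q by (simp add: d_def)
    finally show "nrm (\<lambda>x. P f x - f x) \<le> e"
      unfolding eq .
  qed
  have "N (P f) \<le> ennreal (C * D * E) * N f" if f: "inX N f" for f
    using Pbound[OF f] C D(1) E by (simp add: N_eq_nrm[OF f] N_eq_nrm[OF PX[OF f]] ennreal_mult[symmetric] ennreal_leI)
  then show ?thesis
    unfolding complemented_in_def walsh_span_X_eq
    using Pspan Plin Pid by (intro exI[of _ P]) blast
qed

end

text \<open>These are the indices of the Rademacher functions. They provide the sequence that the
  step from (ii) to (iii) has to exhibit.\<close>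

lemma lacunary_pow2: "lacunary 2 (\<lambda>k. 2 ^ k)"
  by (simp add: lacunary_def)

theorem theorem4p1:
  fixes N :: "(real \<Rightarrow> real) \<Rightarrow> ennreal"
  assumes "banach_function_space N"
    and "rearrangement_invariant N"
    and "interpolation_L1_Linf N"
  defines "cond_i \<equiv> (\<exists>C C'. C > 0 \<and> C' > 0 \<and>
              (\<forall>f. Linf_fun f \<longrightarrow> N f \<le> ennreal C * LM2_norm f \<and>
                                  assoc_norm N f \<le> ennreal C' * LM2_norm f))"
    and "cond_ii \<equiv> (\<forall>q>1. \<forall>n. lacunary q n \<longrightarrow> complemented_in N (walsh_span_X N n))"
    and "cond_iii \<equiv> (\<exists>q>1. \<exists>n. lacunary q n \<and> complemented_in N (walsh_span_X N n))"
  shows "(cond_i \<longleftrightarrow> cond_ii) \<and> (cond_ii \<longleftrightarrow> cond_iii)"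
proof -
  interpret ri_space N
    by (rule ri_space.intro[OF assms(1-3)])
  have "cond_i \<Longrightarrow> cond_ii"
    unfolding cond_i_def cond_ii_def using embeddings_imp_complemented by blast
  moreover have "cond_ii \<Longrightarrow> cond_iii"
    unfolding cond_ii_def cond_iii_def using lacunary_pow2 one_less_numeral_iff semiring_norm(76) by blast
  moreover have "cond_iii \<Longrightarrow> cond_i"
    unfolding cond_iii_def cond_i_def using complemented_imp_embeddings by blast
  ultimately show ?thesis
    by blast
qed

end
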